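(* Let $D$ be the unit disk in $\mathbb{R}^2$. Assume that $n$ and $\eta$ are positive constants with $n\ne1$. Then there exist infinitely many complex-valued (i.e. non-real) interior transmission eigenvalues for $D$, provided that $\eta$ is sufficiently small (depending on $n$).
   Context: For a domain $D$ with unit outward normal $\nu$ and constants $n,\eta$, a number $k\in\mathbb{C}$ is an interior transmission eigenvalue (with conductive boundary condition) if there is a nontrivial pair $(w,v)\in L^2(D)\times L^2(D)$ with $w-v\in H^2(D)\cap H^1_0(D)$ such that $$\Delta w+k^2nw=0,\quad \Delta v+k^2v=0\ \text{ in }D,\qquad w-v=0,\quad \partial_\nu w-\partial_\nu v=\eta v\ \text{ on }\partial D.$$ *)

theory Defs
  imports "HOL-Analysis.Analysis"
begin

text \<open>
  Throughout, \<open>D\<close> is a bounded smooth domain of a Euclidean space, \<open>\<sigma>\<close> the surface measure of its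
  boundary and \<open>\<nu>\<close> its unit outward normal field. Functions are complex-valued and elements of
  \<open>L\<^sup>2\<close> are represented by functions (equality is equality almost everywhere).
\<close>

subsection \<open>Smooth functions and test functions\<close>

definition partial :: "'a::euclidean_space \<Rightarrow> ('a \<Rightarrow> complex) \<Rightarrow> 'a \<Rightarrow> complex" where
  "partial i f = (\<lambda>x. frechet_derivative f (at x) i)"

primrec C_k :: "nat \<Rightarrow> ('a::euclidean_space \<Rightarrow> complex) \<Rightarrow> bool" where
  "C_k 0 f \<longleftrightarrow> continuous_on UNIV f"
| "C_k (Suc k) f \<longleftrightarrow> (\<forall>x. f differentiable (at x)) \<and> (\<forall>i\<in>Basis. C_k k (partial i f))"

definition smooth :: "('a::euclidean_space \<Rightarrow> complex) \<Rightarrow> bool" where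
  "smooth f \<longleftrightarrow> (\<forall>k. C_k k f)"

definition test_function :: "'a::euclidean_space set \<Rightarrow> ('a \<Rightarrow> complex) \<Rightarrow> bool" where
  "test_function D \<phi> \<longleftrightarrow> smooth \<phi> \<and> (\<exists>K. compact K \<and> K \<subseteq> D \<and> (\<forall>x. x \<notin> K \<longrightarrow> \<phi> x = 0))"

subsection \<open>Sobolev spaces\<close>

definition L2 :: "'a measure \<Rightarrow> ('a \<Rightarrow> complex) \<Rightarrow> bool" where
  "L2 M f \<longleftrightarrow> f \<in> borel_measurable M \<and> integrable M (\<lambda>x. (norm (f x))\<^sup>2)"

definition L2_tendsto :: "'a measure \<Rightarrow> (nat \<Rightarrow> 'a \<Rightarrow> complex) \<Rightarrow> ('a \<Rightarrow> complex) \<Rightarrow> bool" where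
  "L2_tendsto M F f \<longleftrightarrow> (\<forall>m. L2 M (F m)) \<and> L2 M f \<and>
     (\<lambda>m. LINT x|M. (norm (F m x - f x))\<^sup>2) \<longlonglongrightarrow> 0"

definition weak_partial ::
  "'a::euclidean_space set \<Rightarrow> 'a \<Rightarrow> ('a \<Rightarrow> complex) \<Rightarrow> ('a \<Rightarrow> complex) \<Rightarrow> bool" where
  "weak_partial D i f g \<longleftrightarrow> L2 (lebesgue_on D) f \<and> L2 (lebesgue_on D) g \<and>
     (\<forall>\<phi>. test_function D \<phi> \<longrightarrow>
        (LINT x|lebesgue_on D. f x * partial i \<phi> x) = - (LINT x|lebesgue_on D. g x * \<phi> x))"

definition weak_laplacian ::
  "'a::euclidean_space set \<Rightarrow> ('a \<Rightarrow> complex) \<Rightarrow> ('a \<Rightarrow> complex) \<Rightarrow> bool" where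
  "weak_laplacian D f g \<longleftrightarrow> L2 (lebesgue_on D) f \<and> L2 (lebesgue_on D) g \<and>
     (\<forall>\<phi>. test_function D \<phi> \<longrightarrow>
        (LINT x|lebesgue_on D. f x * (\<Sum>i\<in>Basis. partial i (partial i \<phi>) x))
          = (LINT x|lebesgue_on D. g x * \<phi> x))"

text \<open>\<open>H_k k D\<close> is \<open>H\<^sup>k(D)\<close>.\<close>

primrec H_k :: "nat \<Rightarrow> 'a::euclidean_space set \<Rightarrow> ('a \<Rightarrow> complex) \<Rightarrow> bool" where
  "H_k 0 D f \<longleftrightarrow> L2 (lebesgue_on D) f"
| "H_k (Suc k) D f \<longleftrightarrow> L2 (lebesgue_on D) f \<and> (\<forall>i\<in>Basis. \<exists>g. weak_partial D i f g \<and> H_k k D g)"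

text \<open>Convergence of smooth functions to \<open>f\<close> in the norm of \<open>H\<^sup>1(D)\<close>; this includes
  \<open>f \<in> H\<^sup>1(D)\<close>. The choice of the weak derivative \<open>g\<close> is immaterial.\<close>

definition H1_tendsto ::
  "'a::euclidean_space set \<Rightarrow> (nat \<Rightarrow> 'a \<Rightarrow> complex) \<Rightarrow> ('a \<Rightarrow> complex) \<Rightarrow> bool" where
  "H1_tendsto D \<Phi> f \<longleftrightarrow> L2_tendsto (lebesgue_on D) \<Phi> f \<and>
     (\<forall>i\<in>Basis. \<exists>g. weak_partial D i f g \<and> L2_tendsto (lebesgue_on D) (\<lambda>m. partial i (\<Phi> m)) g)"

definition H1_0 :: "'a::euclidean_space set \<Rightarrow> ('a \<Rightarrow> complex) \<Rightarrow> bool" where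
  "H1_0 D f \<longleftrightarrow> (\<exists>\<Phi>. (\<forall>m. test_function D (\<Phi> m)) \<and> H1_tendsto D \<Phi> f)"

subsection \<open>Traces\<close>

text \<open>The trace \<open>H\<^sup>1(D) \<rightarrow> L\<^sup>2(\<partial>D)\<close> as the continuous extension of the restriction of smooth functions
  to the boundary, given as a relation between a function and its trace.\<close>

definition has_trace ::
  "'a::euclidean_space set \<Rightarrow> 'a measure \<Rightarrow> ('a \<Rightarrow> complex) \<Rightarrow> ('a \<Rightarrow> complex) \<Rightarrow> bool" where
  "has_trace D \<sigma> f t \<longleftrightarrow>
     (\<exists>\<Phi>. (\<forall>m. smooth (\<Phi> m)) \<and> H1_tendsto D \<Phi> f \<and> L2_tendsto \<sigma> \<Phi> t)"

text \<open>The normal derivative of a function in \<open>H\<^sup>2(D)\<close>: the sum of the traces of the first order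
  weak derivatives, which lie in \<open>H\<^sup>1(D)\<close>, weighted by the components of the normal.\<close>

definition has_normal_deriv ::
  "'a::euclidean_space set \<Rightarrow> 'a measure \<Rightarrow> ('a \<Rightarrow> 'a) \<Rightarrow> ('a \<Rightarrow> complex) \<Rightarrow> ('a \<Rightarrow> complex) \<Rightarrow> bool"
  where
  "has_normal_deriv D \<sigma> \<nu> u q \<longleftrightarrow>
     L2 \<sigma> q \<and>
     (\<exists>G T. (\<forall>i\<in>Basis. weak_partial D i u (G i) \<and> has_trace D \<sigma> (G i) (T i)) \<and>
            (AE x in \<sigma>. q x = (\<Sum>i\<in>Basis. of_real (\<nu> x \<bullet> i) * T i x)))"

text \<open>A function \<open>v \<in> L\<^sup>2(D)\<close> with \<open>\<Delta>v \<in> L\<^sup>2(D)\<close> has a trace only in \<open>H\<^sup>-\<^sup>1\<^sup>/\<^sup>2(\<partial>D)\<close>. It is defined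
  by Green's formula
  \<open>\<langle>v, \<partial>\<^sub>\<nu>\<phi>\<rangle> = \<integral>\<^sub>D (v \<Delta>\<phi> - \<phi> \<Delta>v)\<close> for \<open>\<phi> \<in> H\<^sup>2(D) \<inter> H\<^sup>1\<^sub>0(D)\<close>, the normal derivatives of such \<open>\<phi>\<close>
  making up all of \<open>H\<^sup>1\<^sup>/\<^sup>2(\<partial>D)\<close>. The following says that this trace is given by \<open>b \<in> L\<^sup>2(\<partial>D)\<close>.\<close>

definition has_dual_trace ::
  "'a::euclidean_space set \<Rightarrow> 'a measure \<Rightarrow> ('a \<Rightarrow> 'a) \<Rightarrow> ('a \<Rightarrow> complex) \<Rightarrow> ('a \<Rightarrow> complex) \<Rightarrow> bool"
  where
  "has_dual_trace D \<sigma> \<nu> v b \<longleftrightarrow>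
     L2 \<sigma> b \<and>
     (\<exists>g. weak_laplacian D v g \<and>
       (\<forall>\<phi> h p. H_k 2 D \<phi> \<and> H1_0 D \<phi> \<and> weak_laplacian D \<phi> h \<and> has_normal_deriv D \<sigma> \<nu> \<phi> p \<longrightarrow>
          (LINT x|lebesgue_on D. v x * h x - \<phi> x * g x) = (LINT x|\<sigma>. b x * p x)))"

subsection \<open>Interior transmission eigenvalues with conductive boundary condition\<close>

text \<open>Since \<open>w\<close> and \<open>v\<close> are only in \<open>L\<^sup>2(D)\<close>, the expression \<open>\<partial>\<^sub>\<nu>w - \<partial>\<^sub>\<nu>v\<close> means \<open>\<partial>\<^sub>\<nu>(w - v)\<close>, with
  \<open>w - v \<in> H\<^sup>2(D)\<close>, and the boundary values of \<open>\<eta>v\<close> are understood in the dual sense above.\<close>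

definition transmission_eigenvalue ::
  "'a::euclidean_space set \<Rightarrow> 'a measure \<Rightarrow> ('a \<Rightarrow> 'a) \<Rightarrow> real \<Rightarrow> real \<Rightarrow> complex \<Rightarrow> bool" where
  "transmission_eigenvalue D \<sigma> \<nu> n \<eta> k \<longleftrightarrow>
     (\<exists>w v. L2 (lebesgue_on D) w \<and> L2 (lebesgue_on D) v \<and>
        \<not> (AE x in lebesgue_on D. w x = 0 \<and> v x = 0) \<and>
        H_k 2 D (\<lambda>x. w x - v x) \<and> H1_0 D (\<lambda>x. w x - v x) \<and>
        weak_laplacian D w (\<lambda>x. - (k\<^sup>2 * of_real n * w x)) \<and>
        weak_laplacian D v (\<lambda>x. - (k\<^sup>2 * v x)) \<and>
        has_trace D \<sigma> (\<lambda>x. w x - v x) (\<lambda>x. 0) \<and>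
        (\<exists>q. has_normal_deriv D \<sigma> \<nu> (\<lambda>x. w x - v x) q \<and>
             has_dual_trace D \<sigma> \<nu> (\<lambda>x. of_real \<eta> * v x) q))"

subsection \<open>The unit disk\<close>

abbreviation unit_disk :: "(real^2) set" where
  "unit_disk \<equiv> ball 0 1"

text \<open>Arc length on the unit circle, as a measure on the plane.\<close>

definition arc_length :: "(real^2) measure" where
  "arc_length = distr (lebesgue_on {0..2 * pi}) borel (\<lambda>t. vector [cos t, sin t])"

text \<open>The unit outward normal at a point of the unit circle is the point itself.\<close>

definition disk_transmission_eigenvalue :: "real \<Rightarrow> real \<Rightarrow> complex \<Rightarrow> bool" where
  "disk_transmission_eigenvalue n \<eta> k \<longleftrightarrow> transmission_eigenvalue unit_disk arc_length (\<lambda>x. x) n \<eta> k"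

end

theory Submission
  imports Defs "HOL-Complex_Analysis.Complex_Analysis" "HOL-Real_Asymp.Real_Asymp"
begin

text \<open>
  It suffices to look at radial pairs \<open>w = a J\<^sub>0(k s \<bar>x\<bar>)\<close>, \<open>v = b J\<^sub>0(k \<bar>x\<bar>)\<close> with \<open>s = sqrt n\<close>: the boundary
  conditions have a nontrivial solution \<open>(a, b)\<close> iff the entire function
  \<open>d(k) = k s J\<^sub>0'(k s) J\<^sub>0(k) - k J\<^sub>0'(k) J\<^sub>0(k s) - \<eta> J\<^sub>0(k) J\<^sub>0(k s)\<close> vanishes. Exchanging the two Bessel
  functions replaces \<open>s\<close> by \<open>1/s\<close> and \<open>\<eta>\<close> by \<open>-\<eta>\<close>, so let \<open>s < 1\<close> and \<open>\<eta>\<close> be of either sign.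

  As \<open>d\<close> is of exponential type, a function of this kind with only finitely many nonreal zeros satisfies
  \<open>(d'/d)'(x) \<le> O(1/x\<^sup>2)\<close> on the real line. But Bessel's equation gives
  \<open>d' = (1 - s\<^sup>2) k J\<^sub>0(k) J\<^sub>0(k s) - \<eta> (J\<^sub>0(k) J\<^sub>0(k s))'\<close>, whence \<open>(d'/d)'(q) = 1 - s\<^sup>2 + O(\<eta>)\<close> at the zeros \<open>q\<close>
  of \<open>J\<^sub>0(s \<cdot>)\<close> that keep a distance of at least a fixed multiple of \<open>1/q\<close> from the zeros of \<open>J\<^sub>0\<close>, and
  Sturm comparison shows that there are arbitrarily large such \<open>q\<close>.
\<close>

subsection \<open>Logarithmic derivatives of entire functions of exponential type\<close>

definition logderiv2 :: "(complex \<Rightarrow> complex) \<Rightarrow> complex \<Rightarrow> complex" where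
  "logderiv2 f x = deriv (deriv f) x / f x - (deriv f x / f x)\<^sup>2"

lemma deriv_cong_open:
  assumes "open S" "x \<in> S" "\<And>z. z \<in> S \<Longrightarrow> f z = g z"
  shows "deriv f x = deriv g x"
  by (rule deriv_cong_ev[OF eventually_mono[OF eventually_nhds_in_open[OF assms(1,2)]] refl])
     (rule assms(3))

lemma logderiv2_cong:
  assumes "open S" "x \<in> S" "\<And>z. z \<in> S \<Longrightarrow> f z = g z"
  shows "logderiv2 f x = logderiv2 g x"
proof -
  have *: "deriv f z = deriv g z" if "z \<in> S" for z
    by (rule deriv_cong_open[OF assms(1) that assms(3)])
  then have "deriv (deriv f) x = deriv (deriv g) x"
    by (intro deriv_cong_open[OF assms(1,2)])
  then show ?thesis
    using * assms by (simp add: logderiv2_def)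
qed

lemma logderiv2_mult:
  assumes S: "open S" "x \<in> S" and f: "f holomorphic_on S" and g: "g holomorphic_on S"
    and nz: "f x \<noteq> 0" "g x \<noteq> 0"
  shows "logderiv2 (\<lambda>z. f z * g z) x = logderiv2 f x + logderiv2 g x"
proof -
  note df = holomorphic_derivI[OF f S(1)] holomorphic_derivI[OF holomorphic_deriv[OF f S(1)] S(1)]
  note dg = holomorphic_derivI[OF g S(1)] holomorphic_derivI[OF holomorphic_deriv[OF g S(1)] S(1)]
  have 1: "deriv (\<lambda>z. f z * g z) z = deriv f z * g z + f z * deriv g z" if "z \<in> S" for z
    by (rule DERIV_imp_deriv) (auto intro!: derivative_eq_intros df dg that)
  have "deriv (deriv (\<lambda>z. f z * g z)) x = deriv (\<lambda>z. deriv f z * g z + f z * deriv g z) x"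
    by (rule deriv_cong_open[OF S 1])
  also have "\<dots> = deriv (deriv f) x * g x + 2 * (deriv f x * deriv g x) + f x * deriv (deriv g) x"
    by (rule DERIV_imp_deriv) (auto intro!: derivative_eq_intros df dg S)
  finally show ?thesis
    using nz by (simp add: logderiv2_def 1[OF S(2)] field_simps power2_eq_square)
qed

lemma logderiv2_exp:
  assumes S: "open S" "x \<in> S" and h: "h holomorphic_on S"
  shows "logderiv2 (\<lambda>z. exp (h z)) x = deriv (deriv h) x"
proof -
  note dh = holomorphic_derivI[OF h S(1)] holomorphic_derivI[OF holomorphic_deriv[OF h S(1)] S(1)]
  have 1: "deriv (\<lambda>z. exp (h z)) z = deriv h z * exp (h z)" if "z \<in> S" for z
    by (rule DERIV_imp_deriv) (auto intro!: derivative_eq_intros dh that)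
  have "deriv (deriv (\<lambda>z. exp (h z))) x = deriv (\<lambda>z. deriv h z * exp (h z)) x"
    by (rule deriv_cong_open[OF S 1])
  also have "\<dots> = deriv (deriv h) x * exp (h x) + (deriv h x)\<^sup>2 * exp (h x)"
    by (rule DERIV_imp_deriv) (auto intro!: derivative_eq_intros dh S simp: power2_eq_square)
  finally show ?thesis
    by (simp add: logderiv2_def 1[OF S(2)] field_simps power2_eq_square)
qed

lemma logderiv2_linear_power:
  assumes "x \<noteq> a"
  shows "logderiv2 (\<lambda>z. (z - a) ^ m) x = - of_nat m / (x - a)\<^sup>2"
proof (induction m)
  case 0
  have "deriv (\<lambda>z::complex. 1::complex) = (\<lambda>z. 0)" by (simp add: fun_eq_iff)
  then show ?case by (simp add: logderiv2_def)
next
  case (Suc m)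
  have d: "deriv (\<lambda>z. z - a) = (\<lambda>z. 1)"
    by (auto simp: fun_eq_iff intro!: DERIV_imp_deriv derivative_eq_intros)
  have "logderiv2 (\<lambda>z. (z - a) * (z - a) ^ m) x = logderiv2 (\<lambda>z. z - a) x + logderiv2 (\<lambda>z. (z - a) ^ m) x"
    by (rule logderiv2_mult[of UNIV]) (use assms in \<open>auto intro!: holomorphic_intros\<close>)
  also have "logderiv2 (\<lambda>z. z - a) x = - 1 / (x - a)\<^sup>2"
    by (simp add: logderiv2_def d power_divide)
  finally have "logderiv2 (\<lambda>z. (z - a) ^ Suc m) x = - 1 / (x - a)\<^sup>2 - of_nat m / (x - a)\<^sup>2"
    using Suc by simp
  then show ?case by (simp only: of_nat_Suc) (simp add: diff_divide_distrib)
qed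

lemma logderiv2_prod_linear:
  assumes "finite Z" "x \<notin> Z"
  shows "logderiv2 (\<lambda>z. \<Prod>a\<in>Z. (z - a) ^ m a) x = - (\<Sum>a\<in>Z. of_nat (m a) / (x - a)\<^sup>2)"
  using assms
proof (induction Z rule: finite_induct)
  case empty
  show ?case using logderiv2_linear_power[of x "x + 1" 0] by simp
next
  case (insert b Z)
  have "logderiv2 (\<lambda>z. (z - b) ^ m b * (\<Prod>a\<in>Z. (z - a) ^ m a)) x =
      logderiv2 (\<lambda>z. (z - b) ^ m b) x + logderiv2 (\<lambda>z. \<Prod>a\<in>Z. (z - a) ^ m a) x"
    by (rule logderiv2_mult[of UNIV]) (use insert in \<open>auto intro!: holomorphic_intros\<close>)
  then show ?case
    using insert logderiv2_linear_power[of x b "m b"] by simp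
qed

lemma entire_factor_zeros:
  assumes f: "f holomorphic_on UNIV" and nz: "f x0 \<noteq> 0" and "finite Z"
  obtains g where "g holomorphic_on UNIV" "\<And>a. a \<in> Z \<Longrightarrow> g a \<noteq> 0"
    "\<And>z. f z = g z * (\<Prod>a\<in>Z. (z - a) ^ nat (zorder f a))"
proof -
  have "\<exists>g. g holomorphic_on UNIV \<and> (\<forall>a\<in>Z. g a \<noteq> 0) \<and>
      (\<forall>z. f z = g z * (\<Prod>a\<in>Z. (z - a) ^ nat (zorder f a)))"
    using \<open>finite Z\<close>
  proof (induction Z rule: finite_induct)
    case empty
    then show ?case using f by auto
  next
    case (insert b Z)
    then obtain g where g: "g holomorphic_on UNIV" "\<And>a. a \<in> Z \<Longrightarrow> g a \<noteq> 0"
      "\<And>z. f z = g z * (\<Prod>a\<in>Z. (z - a) ^ nat (zorder f a))" by auto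
    define m where "m a = nat (zorder f a)" for a
    define p where "p z = (\<Prod>a\<in>Z. (z - a) ^ m a)" for z
    have p0: "p z \<noteq> 0" if "z \<notin> Z" for z
      using that insert(1) by (auto simp: p_def)
    obtain r where r: "r > 0" "zor_poly f b holomorphic_on cball b r"
      "\<And>w. w \<in> cball b r \<Longrightarrow> f w = zor_poly f b w * (w - b) ^ m b \<and> zor_poly f b w \<noteq> 0"
      using zorder_exist_zero[OF f open_UNIV connected_UNIV UNIV_I] nz unfolding m_def by blast
    define g1 where "g1 z = (if z = b then zor_poly f b b / p b else g z / (z - b) ^ m b)" for z
    have holp: "p holomorphic_on A" for A
      unfolding p_def by (auto intro!: holomorphic_intros)
    have U: "open (ball b r - Z)" using insert(1) by (simp add: finite_imp_closed open_Diff)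
    have eq: "g1 z = zor_poly f b z / p z" if "z \<in> ball b r - Z" for z
    proof (cases "z = b")
      case False
      then have "g z * p z = zor_poly f b z * (z - b) ^ m b"
        using g(3)[of z] r(3)[of z] that by (simp add: m_def p_def)
      then show ?thesis using False p0[of z] that by (simp add: g1_def field_simps)
    qed (simp add: g1_def)
    have "(\<lambda>z. zor_poly f b z / p z) holomorphic_on (ball b r - Z)"
      using r(2) p0 holp by (intro holomorphic_on_divide) (auto elim: holomorphic_on_subset)
    then have 1: "g1 holomorphic_on (ball b r - Z)"
      by (rule holomorphic_transform) (simp add: eq)
    have "(\<lambda>z. g z / (z - b) ^ m b) holomorphic_on (- {b})"
      using g(1) by (auto intro!: holomorphic_intros elim: holomorphic_on_subset)
    then have 2: "g1 holomorphic_on (- {b})"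
      by (rule holomorphic_transform) (auto simp: g1_def)
    have "g1 holomorphic_on ((ball b r - Z) \<union> - {b})"
      using 1 2 U by (intro holomorphic_on_Un) auto
    moreover have "(ball b r - Z) \<union> - {b} = UNIV" using r(1) insert(2) by auto
    ultimately have "g1 holomorphic_on UNIV" by simp
    moreover have "g1 b \<noteq> 0" using r(1) r(3)[of b] p0[of b] insert(2) by (simp add: g1_def)
    moreover have "g1 a \<noteq> 0" if "a \<in> Z" for a
      using g(2)[OF that] insert(2) that by (auto simp: g1_def)
    moreover have "f z = g1 z * (\<Prod>a\<in>insert b Z. (z - a) ^ m a)" for z
    proof (cases "z = b")
      case True
      then show ?thesis using r(1) r(3)[of b] p0[of b] insert(1,2)
        by (simp add: g1_def p_def)
    next
      case False
      then show ?thesis using g(3)[of z] insert(1,2) by (simp add: g1_def m_def)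
    qed
    ultimately show ?case unfolding m_def by (intro exI[of _ g1]) blast
  qed
  then show ?thesis using that by blast
qed

lemma Borel_Caratheodory_deriv2:
  assumes h: "h holomorphic_on ball 0 R" and "R > 0" and "h 0 = 0"
    and M: "\<And>z. z \<in> ball 0 R \<Longrightarrow> Re (h z) < M"
  shows "norm (deriv (deriv h) 0) \<le> 16 * M / R\<^sup>2"
proof -
  have M0: "M > 0" using M[of 0] assms by simp
  define \<phi> where "\<phi> z = h (of_real R * z) / (2 * of_real M - h (of_real R * z))" for z
  have in_ball: "of_real R * z \<in> ball 0 R" if "norm z < 1" for z :: complex
    using that \<open>R > 0\<close> by (simp add: norm_mult)
  have lt: "norm (h z) < norm (2 * of_real M - h z)" if "z \<in> ball 0 R" for z
  proof -
    have "(norm (2 * of_real M - h z))\<^sup>2 - (norm (h z))\<^sup>2 = 4 * M * (M - Re (h z))"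
      by (simp only: cmod_power2) (simp add: algebra_simps power2_eq_square)
    also have "\<dots> > 0" using M0 M[OF that] by simp
    finally show ?thesis by (simp add: power2_less_imp_less)
  qed
  have "norm (\<phi> z) \<le> norm z" if "norm z < 1" for z
  proof (rule Schwarz_Lemma(1)[OF _ _ _ that])
    have "(\<lambda>z. h (of_real R * z)) holomorphic_on ball 0 1"
      using in_ball by (intro holomorphic_on_compose_gen[OF _ h, unfolded o_def]) (auto intro!: holomorphic_intros)
    moreover have "2 * of_real M - h (of_real R * z) \<noteq> 0" if "z \<in> ball 0 1" for z
      using lt[OF in_ball[of z]] that by auto
    ultimately show "\<phi> holomorphic_on ball 0 1"
      unfolding \<phi>_def by (intro holomorphic_intros) auto
    show "\<phi> 0 = 0" by (simp add: \<phi>_def assms)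
    show "norm (\<phi> z) < 1" if "norm z < 1" for z
      using lt[OF in_ball[OF that]] by (auto simp: \<phi>_def norm_divide divide_simps)
  qed
  then have phi: "norm (\<phi> z) \<le> norm z" if "norm z < 1" for z using that by blast
  have bound: "norm (h z) \<le> 2 * M" if "norm z = R / 2" for z
  proof -
    define y where "y = z / of_real R"
    have y: "norm y = 1/2" "z = of_real R * y"
      using that \<open>R > 0\<close> by (auto simp: y_def norm_divide)
    have "z \<in> ball 0 R" using that \<open>R > 0\<close> by simp
    then have pos: "norm (2 * of_real M - h z) > 0"
      using lt by (meson norm_ge_zero order_le_less_trans)
    have "norm (h z) \<le> norm (2 * of_real M - h z) / 2"
      using phi[of y] y pos by (simp add: \<phi>_def norm_divide divide_simps)
    also have "norm (2 * of_real M - h z) \<le> 2 * M + norm (h z)"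
      using norm_triangle_ineq4[of "2 * of_real M" "h z"] M0 by simp
    finally show ?thesis by simp
  qed
  have "norm ((deriv ^^ 2) h 0) \<le> fact 2 * (2 * M) / (R / 2) ^ 2"
  proof (rule Cauchy_inequality)
    show "h holomorphic_on ball 0 (R/2)" using h by (rule holomorphic_on_subset) (use \<open>R > 0\<close> in auto)
    have "h holomorphic_on cball 0 (R/2)" using h by (rule holomorphic_on_subset) (use \<open>R > 0\<close> in auto)
    then show "continuous_on (cball 0 (R/2)) h" by (rule holomorphic_on_imp_continuous_on)
  qed (use \<open>R > 0\<close> bound in auto)
  then show ?thesis by (simp add: numeral_2_eq_2 field_simps)
qed

lemma logderiv2_bound_at_0:
  fixes f :: "complex \<Rightarrow> complex"
  assumes f: "f holomorphic_on UNIV" and f0: "f 0 \<noteq> 0"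
    and growth: "\<And>z. norm (f z) \<le> A * exp (B * norm z)" and "R > 0" "B \<ge> 0"
    and Z: "Z = {z \<in> cball 0 R. f z = 0}"
  shows "finite Z \<and> norm (logderiv2 f 0 + (\<Sum>a\<in>Z. of_nat (nat (zorder f a)) / (0 - a)\<^sup>2))
           \<le> 16 * (ln (A / norm (f 0)) + 2 * B * R + 1) / R\<^sup>2"
proof -
  have fin: "finite Z"
  proof (cases "f constant_on UNIV")
    case True
    then have "f z = f 0" for z by (auto simp: constant_on_def)
    then have "Z = {}" using f0 by (auto simp: Z) (metis f0)
    then show ?thesis by simp
  next
    case False
    show ?thesis
      unfolding Z by (rule holomorphic_compact_finite_zeros[OF f open_UNIV connected_UNIV compact_cball _ False]) auto
  qed
  have zZ: "0 \<notin> Z" using f0 by (auto simp: Z)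
  define m where "m a = nat (zorder f a)" for a
  obtain g where g: "g holomorphic_on UNIV" "\<And>a. a \<in> Z \<Longrightarrow> g a \<noteq> 0"
    "\<And>z. f z = g z * (\<Prod>a\<in>Z. (z - a) ^ m a)"
    using entire_factor_zeros[OF f f0 fin] unfolding m_def by blast
  define p where "p z = (\<Prod>a\<in>Z. (z - a) ^ m a)" for z
  have gnz: "g z \<noteq> 0" if "z \<in> cball 0 R" for z
  proof (cases "z \<in> Z")
    case False
    then have "f z \<noteq> 0" using that by (auto simp: Z)
    then show ?thesis using g(3)[of z] by auto
  qed (use g in auto)
  have p0: "p 0 \<noteq> 0" using fin zZ by (auto simp: p_def)
  have pge: "norm (p z) \<ge> norm (p 0)" if "norm z = 2 * R" for z
    unfolding p_def prod_norm[symmetric]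
  proof (rule prod_mono, intro conjI)
    fix a assume a: "a \<in> Z"
    then have "norm a \<le> R" by (auto simp: Z)
    then have "norm a \<le> norm (z - a)" using norm_triangle_ineq2[of z a] that by simp
    then show "norm ((0 - a) ^ m a) \<le> norm ((z - a) ^ m a)"
      by (simp add: norm_power power_mono)
  qed simp
  have A: "A > 0" using growth[of 0] f0 by (simp add: order_less_le_trans[of 0 "norm (f 0)"])
  have g0: "g 0 \<noteq> 0" using gnz \<open>R > 0\<close> by auto
  have f0': "norm (f 0) > 0" using f0 by simp
  have gb: "norm (g z) \<le> norm (g 0) * (A / norm (f 0) * exp (2 * B * R))" if "norm z = 2 * R" for z
  proof -
    have "norm (g z) * norm (p 0) \<le> norm (g z) * norm (p z)"
      using pge[OF that] by (simp add: mult_left_mono)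
    also have "\<dots> = norm (f z)" using g(3)[of z] by (simp add: p_def norm_mult)
    also have "\<dots> \<le> A * exp (2 * B * R)" using growth[of z] that by (simp add: mult_ac)
    finally have "norm (g z) \<le> A * exp (2 * B * R) / norm (p 0)" using p0 by (simp add: field_simps)
    also have "norm (p 0) = norm (f 0) / norm (g 0)"
      using g(3)[of 0] g0 by (simp add: p_def norm_mult)
    finally show ?thesis by (simp add: field_simps)
  qed
  have gb': "norm (g z) \<le> norm (g 0) * (A / norm (f 0) * exp (2 * B * R))" if "z \<in> ball 0 (2 * R)" for z
  proof (rule maximum_modulus_frontier[of g "cball 0 (2 * R)"])
    show "g holomorphic_on interior (cball 0 (2 * R))" using g(1) by (rule holomorphic_on_subset) auto
    show "continuous_on (closure (cball 0 (2 * R))) g"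
      using holomorphic_on_imp_continuous_on[OF g(1)] by (rule continuous_on_subset) auto
  qed (use that gb \<open>R > 0\<close> in \<open>auto simp: frontier_cball\<close>)
  obtain h0 where h0: "h0 holomorphic_on ball 0 R" "\<And>z. z \<in> ball 0 R \<Longrightarrow> exp (h0 z) = g z"
    using holomorphic_logarithm_exists[of "ball 0 R" g 0] g(1) gnz \<open>R > 0\<close>
    by (metis ball_subset_cball centre_in_ball convex_ball holomorphic_on_subset open_ball subset_UNIV subset_iff)
  define h where "h z = h0 z - h0 0" for z
  have hh: "h holomorphic_on ball 0 R" unfolding h_def by (intro holomorphic_intros h0)
  define M where "M = ln (A / norm (f 0)) + 2 * B * R + 1"
  have eh: "exp (h z) = g z / g 0" if "z \<in> ball 0 R" for z
    using h0(2)[OF that] h0(2)[of 0] \<open>R > 0\<close> by (simp add: h_def exp_diff)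
  have "Re (h z) < M" if "z \<in> ball 0 R" for z
  proof -
    have "exp (Re (h z)) = norm (g z) / norm (g 0)"
      using eh[OF that] by (metis norm_divide norm_exp_eq_Re)
    also have "\<dots> \<le> A / norm (f 0) * exp (2 * B * R)"
      using gb'[of z] that \<open>R > 0\<close> g0 by (simp add: field_simps)
    also have "\<dots> = exp (M - 1)" using A f0' by (simp add: M_def exp_add)
    finally show ?thesis by simp
  qed
  then have "norm (deriv (deriv h) 0) \<le> 16 * M / R\<^sup>2"
    by (intro Borel_Caratheodory_deriv2 hh) (use \<open>R > 0\<close> in \<open>auto simp: h_def\<close>)
  moreover have "logderiv2 f 0 = deriv (deriv h) 0 - (\<Sum>a\<in>Z. of_nat (m a) / (0 - a)\<^sup>2)"
  proof -
    have "logderiv2 f 0 = logderiv2 (\<lambda>z. g z * p z) 0" using g(3) by (intro logderiv2_cong[of UNIV]) (auto simp: p_def)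
    also have "\<dots> = logderiv2 g 0 + logderiv2 p 0"
      using g(1) g0 p0 by (intro logderiv2_mult[of UNIV]) (auto simp: p_def intro!: holomorphic_intros)
    also have "logderiv2 p 0 = - (\<Sum>a\<in>Z. of_nat (m a) / (0 - a)\<^sup>2)"
      unfolding p_def by (rule logderiv2_prod_linear[OF fin zZ])
    also have "logderiv2 g 0 = logderiv2 (\<lambda>z. exp (h0 z)) 0"
      by (rule logderiv2_cong[of "ball 0 R"]) (use h0 \<open>R > 0\<close> in auto)
    also have "\<dots> = deriv (deriv h0) 0"
      by (rule logderiv2_exp[of "ball 0 R"]) (use h0 \<open>R > 0\<close> in auto)
    also have "deriv (deriv h0) 0 = deriv (deriv h) 0"
    proof -
      have "deriv h z = deriv h0 z" if "z \<in> ball 0 R" for z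
        unfolding h_def using holomorphic_derivI[OF h0(1) _ that]
        by (intro DERIV_imp_deriv) (auto intro!: derivative_eq_intros)
      then show ?thesis
        using \<open>R > 0\<close> by (intro deriv_cong_open[of "ball 0 R" 0 "deriv h0" "deriv h"]) auto
    qed
    finally show ?thesis by simp
  qed
  ultimately show ?thesis using fin by (simp add: M_def m_def)
qed

lemma logderiv2_shift:
  assumes f: "f holomorphic_on UNIV"
  shows "logderiv2 (\<lambda>z. f (z + x)) y = logderiv2 f (y + x)"
proof -
  have *: "deriv (\<lambda>z. g (z + x)) = (\<lambda>z. deriv g (z + x))" if "g holomorphic_on UNIV" for g
  proof
    fix z
    have "(g has_field_derivative deriv g (z + x)) (at (z + x))"
      using that by (intro holomorphic_derivI) auto
    then show "deriv (\<lambda>z. g (z + x)) z = deriv g (z + x)"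
      by (intro DERIV_imp_deriv) (simp add: DERIV_shift)
  qed
  show ?thesis
    using *[OF f] *[OF holomorphic_deriv[OF f open_UNIV]] by (simp add: logderiv2_def)
qed

theorem Re_logderiv2_le_nonreal_zeros:
  fixes f :: "complex \<Rightarrow> complex" and x :: real
  assumes f: "f holomorphic_on UNIV" and fx: "f (of_real x) \<noteq> 0"
    and growth: "\<And>z. norm (f z) \<le> A * exp (B * norm z)" and B: "B \<ge> 0"
    and fin: "finite {z. f z = 0 \<and> z \<notin> \<real>}"
  shows "Re (logderiv2 f (of_real x))
    \<le> (\<Sum>a | f a = 0 \<and> a \<notin> \<real>. real (nat (zorder f a)) / (norm (of_real x - a))\<^sup>2)"
proof -
  define F where "F z = f (z + of_real x)" for z
  define A' where "A' = A * exp (B * \<bar>x\<bar>)"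
  define m where "m a = nat (zorder F a)" for a
  define N where "N = {z. F z = 0 \<and> z \<notin> \<real>}"
  have F: "F holomorphic_on UNIV"
    unfolding F_def by (intro holomorphic_on_compose_gen[OF _ f, unfolded o_def]) (auto intro!: holomorphic_intros)
  have A: "A > 0" using growth[of "of_real x"] fx
    by (smt (verit) exp_gt_zero mult_nonpos_nonneg norm_le_zero_iff)
  have growth': "norm (F z) \<le> A' * exp (B * norm z)" for z
  proof -
    have "norm (F z) \<le> A * exp (B * norm (z + of_real x))" using growth by (simp add: F_def)
    also have "\<dots> \<le> A * exp (B * (\<bar>x\<bar> + norm z))"
      using A B norm_triangle_ineq[of z "of_real x"] by (auto intro!: mult_left_mono)
    finally show ?thesis by (simp add: A'_def exp_add ring_distribs)
  qed
  have bij: "bij_betw (\<lambda>z. z - of_real x) {z. f z = 0 \<and> z \<notin> \<real>} N"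
    by (rule bij_betwI[where g = "\<lambda>z. z + of_real x"])
       (auto simp: N_def F_def dest: Reals_diff[of _ "of_real x"] Reals_add[of _ "of_real x"])
  have finN: "finite N" using bij fin bij_betw_finite by blast
  have F0: "F 0 \<noteq> 0" using fx by (simp add: F_def)
  define S where "S = (\<Sum>a\<in>N. real (m a) / (norm a)\<^sup>2)"
  define E where "E R = 16 * (ln (A' / norm (F 0)) + 2 * B * R + 1) / R\<^sup>2" for R
  have bound: "Re (logderiv2 F 0) \<le> S + E R" if "R > 0" for R
  proof -
    define Z where "Z = {z \<in> cball 0 R. F z = 0}"
    have *: "finite Z" "norm (logderiv2 F 0 + (\<Sum>a\<in>Z. of_nat (m a) / (0 - a)\<^sup>2)) \<le> E R"
      using logderiv2_bound_at_0[OF F _ growth' that B Z_def] F0 unfolding E_def m_def by blast+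
    have "Re (logderiv2 F 0) \<le> E R - (\<Sum>a\<in>Z. Re (of_nat (m a) / a\<^sup>2))"
      using complex_Re_le_cmod[of "logderiv2 F 0 + (\<Sum>a\<in>Z. of_nat (m a) / (0 - a)\<^sup>2)"] *(2) by simp
    moreover have "- (\<Sum>a\<in>Z. Re (of_nat (m a) / a\<^sup>2)) \<le> (\<Sum>a\<in>Z. if a \<in> N then real (m a) / (norm a)\<^sup>2 else 0)"
      unfolding sum_negf[symmetric]
    proof (rule sum_mono)
      fix a assume "a \<in> Z"
      show "- Re (of_nat (m a) / a\<^sup>2) \<le> (if a \<in> N then real (m a) / (norm a)\<^sup>2 else 0)"
      proof (cases "a \<in> N")
        case True
        then show ?thesis
          using abs_Re_le_cmod[of "of_nat (m a) / a\<^sup>2"] by (simp add: norm_divide norm_power)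
      next
        case False
        then have "a \<in> \<real>" using \<open>a \<in> Z\<close> by (auto simp: N_def Z_def)
        then obtain r where "a = of_real r" by (auto elim: Reals_cases)
        then have "of_nat (m a) / a\<^sup>2 = complex_of_real (real (m a) / r\<^sup>2)" by simp
        then show ?thesis using False by (simp del: of_real_divide of_real_power)
      qed
    qed
    moreover have "(\<Sum>a\<in>Z. if a \<in> N then real (m a) / (norm a)\<^sup>2 else 0) = (\<Sum>a\<in>Z \<inter> N. real (m a) / (norm a)\<^sup>2)"
      using *(1) by (simp add: sum.inter_restrict)
    moreover have "(\<Sum>a\<in>Z \<inter> N. real (m a) / (norm a)\<^sup>2) \<le> S"
      unfolding S_def by (rule sum_mono2[OF finN]) auto
    ultimately show ?thesis by linarith
  qed
  have "(E \<longlongrightarrow> 0) at_top"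
    unfolding E_def by real_asymp
  then have "((\<lambda>R. S + E R) \<longlongrightarrow> S + 0) at_top" by (intro tendsto_intros)
  then have "Re (logderiv2 F 0) \<le> S + 0"
    by (rule tendsto_lowerbound)
       (auto intro!: eventually_mono[OF eventually_gt_at_top[of 0]] bound)
  also have "S = (\<Sum>a | f a = 0 \<and> a \<notin> \<real>. real (m (a - of_real x)) / (norm (a - of_real x))\<^sup>2)"
    unfolding S_def using sum.reindex_bij_betw[OF bij, of "\<lambda>a. real (m a) / (norm a)\<^sup>2"] by simp
  also have "\<dots> = (\<Sum>a | f a = 0 \<and> a \<notin> \<real>. real (nat (zorder f a)) / (norm (of_real x - a))\<^sup>2)"
  proof -
    have "m (a - of_real x) = nat (zorder f a)" for a
      unfolding m_def zorder_shift[of f a] zorder_shift[of F "a - of_real x"]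
      by (simp add: F_def algebra_simps)
    then show ?thesis by (simp add: norm_minus_commute)
  qed
  finally show ?thesis
    using logderiv2_shift[OF f, of "of_real x" 0] by (simp add: F_def[abs_def])
qed

lemma infinite_nonreal_zeros:
  fixes f :: "complex \<Rightarrow> complex"
  assumes f: "f holomorphic_on UNIV"
    and growth: "\<And>z. norm (f z) \<le> A * exp (B * norm z)" and B: "B \<ge> 0"
    and \<delta>: "\<delta> > 0"
    and large: "\<And>T. \<exists>x\<ge>T. f (of_real x) \<noteq> 0 \<and> \<delta> \<le> Re (logderiv2 f (of_real x))"
  shows "infinite {z. f z = 0 \<and> z \<notin> \<real>}"
proof
  assume fin: "finite {z. f z = 0 \<and> z \<notin> \<real>}"
  define N where "N = {z. f z = 0 \<and> z \<notin> \<real>}"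
  have *: "((\<lambda>x::real. real m / (norm (of_real x - a))\<^sup>2) \<longlongrightarrow> 0) at_top" for m :: nat and a :: complex
  proof (rule Lim_null_comparison)
    show "\<forall>\<^sub>F x in at_top. norm (real m / (norm (of_real x - a))\<^sup>2) \<le> real m / (x - norm a)\<^sup>2"
      using eventually_gt_at_top[of "norm a"]
    proof eventually_elim
      case (elim x)
      have "x - norm a \<le> norm (of_real x - a)"
        using norm_triangle_ineq2[of "of_real x" a] elim by simp
      then have "(x - norm a)\<^sup>2 \<le> (norm (of_real x - a))\<^sup>2" using elim by (intro power_mono) auto
      moreover have "0 < (x - norm a)\<^sup>2" using elim by simp
      ultimately show ?case by (simp add: frac_le)
    qed
    show "((\<lambda>x. real m / (x - norm a)\<^sup>2) \<longlongrightarrow> 0) at_top" by real_asymp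
  qed
  have "((\<lambda>x::real. \<Sum>a\<in>N. real (nat (zorder f a)) / (norm (of_real x - a))\<^sup>2) \<longlongrightarrow> 0) at_top"
    by (rule tendsto_null_sum) (rule *)
  from order_tendstoD(2)[OF this \<delta>]
  obtain T where T: "\<And>x. x \<ge> T \<Longrightarrow> (\<Sum>a\<in>N. real (nat (zorder f a)) / (norm (of_real x - a))\<^sup>2) < \<delta>"
    unfolding eventually_at_top_linorder by auto
  obtain x where "x \<ge> T" "f (of_real x) \<noteq> 0" "\<delta> \<le> Re (logderiv2 f (of_real x))"
    using large by blast
  then show False
    using Re_logderiv2_le_nonreal_zeros[OF f _ growth B fin, of x] T[of x] by (simp add: N_def)
qed

subsection \<open>The Bessel function of order zero\<close>

definition power_series :: "(nat \<Rightarrow> real) \<Rightarrow> 'a::{real_normed_field,banach} \<Rightarrow> 'a" where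
  "power_series c z = (\<Sum>i. of_real (c i) * z ^ i)"

definition fast_decay :: "(nat \<Rightarrow> real) \<Rightarrow> bool" where
  "fast_decay c \<longleftrightarrow> (\<forall>r::real. summable (\<lambda>i. c i * r ^ i))"

lemma fast_decay_summable:
  assumes "fast_decay c"
  shows "summable (\<lambda>i. of_real (c i) * (z::'a::{real_normed_field,banach}) ^ i)"
proof -
  have *: "summable (\<lambda>i. norm (c i * (norm z) ^ i))"
    using assms by (intro powser_insidea[of c "norm z + 1" "norm z"]) (auto simp: fast_decay_def)
  show ?thesis
    by (rule summable_norm_cancel) (use * in \<open>simp add: norm_mult norm_power abs_mult\<close>)
qed

lemma fast_decay_diffs: "fast_decay c \<Longrightarrow> fast_decay (diffs c)"
  unfolding fast_decay_def by (metis termdiff_converges_all)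

lemma diffs_of_real_fun: "diffs (\<lambda>i. of_real (c i)) = (\<lambda>i. of_real (diffs c i) :: 'a::{real_normed_field,banach})"
  by (simp add: diffs_def fun_eq_iff)

lemma power_series_deriv:
  assumes "fast_decay c"
  shows "(power_series c has_field_derivative power_series (diffs c) z) (at (z::'a::{real_normed_field,banach}))"
  using termdiffs_strong_converges_everywhere[of "\<lambda>i. of_real (c i) :: 'a" z] fast_decay_summable[OF assms]
  unfolding power_series_def[abs_def] diffs_of_real_fun by blast

lemma of_real_power_series:
  assumes "fast_decay c"
  shows "(of_real (power_series c x) :: 'a::{real_normed_field,banach}) = power_series c (of_real x)"
  using suminf_of_real[OF fast_decay_summable[OF assms, of x]]
  by (simp add: power_series_def)

definition bessel_coeff :: "nat \<Rightarrow> real" where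
  "bessel_coeff i = (- 1 / 4) ^ i / (fact i)\<^sup>2"

definition bessel_euler_coeff :: "nat \<Rightarrow> real" where
  "bessel_euler_coeff i = of_nat i * bessel_coeff i"

lemma fast_decay_bessel_euler_coeff: "fast_decay bessel_euler_coeff"
  unfolding fast_decay_def
proof
  fix r :: real
  show "summable (\<lambda>i. bessel_euler_coeff i * r ^ i)"
  proof (rule summable_comparison_test'[OF summable_exp[of "\<bar>r\<bar>"]])
    fix i :: nat
    have "(1/4 :: real) ^ i \<le> 1" by (simp add: power_le_one)
    moreover have "real i \<le> fact i" by (metis fact_ge_self of_nat_fact of_nat_mono)
    ultimately have "real i * (1/4) ^ i \<le> fact i * 1" by (intro mult_mono) auto
    then have "real i * (1/4) ^ i / (fact i)\<^sup>2 \<le> inverse (fact i)"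
      by (simp add: power2_eq_square field_simps)
    then have "real i * (1/4) ^ i / (fact i)\<^sup>2 * \<bar>r\<bar> ^ i \<le> inverse (fact i) * \<bar>r\<bar> ^ i"
      by (intro mult_right_mono) auto
    then show "norm (bessel_euler_coeff i * r ^ i) \<le> inverse (fact i) * \<bar>r\<bar> ^ i"
      by (simp add: bessel_euler_coeff_def bessel_coeff_def abs_mult power_abs)
  qed
qed

lemma fast_decay_bessel_coeff: "fast_decay bessel_coeff"
  unfolding fast_decay_def
proof
  fix r :: real
  show "summable (\<lambda>i. bessel_coeff i * r ^ i)"
  proof (rule summable_comparison_test'[where N = 1])
    show "summable (\<lambda>i. norm (bessel_euler_coeff i * r ^ i))"
      using fast_decay_bessel_euler_coeff powser_insidea[of bessel_euler_coeff "\<bar>r\<bar> + 1" r]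
      by (simp add: fast_decay_def)
    show "norm (bessel_coeff i * r ^ i) \<le> norm (bessel_euler_coeff i * r ^ i)" if "1 \<le> i" for i
      using that mult_right_mono[of 1 "real i" "\<bar>bessel_coeff i\<bar> * \<bar>r ^ i\<bar>"]
      by (simp add: bessel_euler_coeff_def abs_mult mult.assoc)
  qed
qed

lemma diffs_bessel_euler_coeff: "diffs bessel_euler_coeff = (\<lambda>i. - bessel_coeff i / 4)"
  by (auto simp: fun_eq_iff diffs_def bessel_euler_coeff_def bessel_coeff_def power2_eq_square divide_simps)

abbreviation bessel0 :: "'a::{real_normed_field,banach} \<Rightarrow> 'a" where
  "bessel0 \<equiv> power_series bessel_coeff"

definition J0 :: "'a::{real_normed_field,banach} \<Rightarrow> 'a" where
  "J0 z = bessel0 (z\<^sup>2)"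

text \<open>\<open>zJ0' z\<close> is \<open>z J\<^sub>0'(z)\<close>; with the factor \<open>z\<close>, Bessel's equation reads \<open>(z J\<^sub>0')' = - z J\<^sub>0\<close>.\<close>

definition zJ0' :: "'a::{real_normed_field,banach} \<Rightarrow> 'a" where
  "zJ0' z = 2 * power_series bessel_euler_coeff (z\<^sup>2)"

lemma power_series_bessel_euler:
  "power_series bessel_euler_coeff z = z * power_series (diffs bessel_coeff) (z::'a::{real_normed_field,banach})"
proof -
  have "power_series bessel_euler_coeff z = (\<Sum>i. of_real (bessel_euler_coeff (Suc i)) * z ^ Suc i)"
    unfolding power_series_def
    using suminf_split_head[OF fast_decay_summable[OF fast_decay_bessel_euler_coeff, of z]]
    by (simp add: bessel_euler_coeff_def)
  also have "\<dots> = (\<Sum>i. z * (of_real (diffs bessel_coeff i) * z ^ i))"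
    by (simp add: bessel_euler_coeff_def diffs_def algebra_simps)
  finally show ?thesis
    unfolding power_series_def
    using suminf_mult[OF fast_decay_summable[OF fast_decay_diffs[OF fast_decay_bessel_coeff], of z]] by simp
qed

lemma zJ0'_eq: "zJ0' z = z * (2 * z * power_series (diffs bessel_coeff) (z\<^sup>2))"
  by (simp add: zJ0'_def power_series_bessel_euler power2_eq_square)

lemma J0_deriv_gen: "(J0 has_field_derivative 2 * z * power_series (diffs bessel_coeff) (z\<^sup>2)) (at z)"
  unfolding J0_def[abs_def]
  by (rule DERIV_chain2[OF power_series_deriv[OF fast_decay_bessel_coeff], THEN DERIV_cong])
     (auto intro!: derivative_eq_intros)

lemma J0_deriv: "z \<noteq> 0 \<Longrightarrow> (J0 has_field_derivative zJ0' z / z) (at z)"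
  using J0_deriv_gen[of z] by (simp add: zJ0'_eq)

lemma power_series_diffs_bessel_euler:
  "power_series (diffs bessel_euler_coeff) z = - bessel0 (z::'a::{real_normed_field,banach}) / 4"
  unfolding diffs_bessel_euler_coeff power_series_def
  using suminf_mult[OF fast_decay_summable[OF fast_decay_bessel_coeff, of z], of "-1/4"]
  by (simp add: mult_ac)

lemma zJ0'_deriv: "(zJ0' has_field_derivative - z * J0 z) (at z)"
proof -
  have "(zJ0' has_field_derivative 2 * (power_series (diffs bessel_euler_coeff) (z\<^sup>2) * (2 * z))) (at z)"
    unfolding zJ0'_def[abs_def]
    by (rule DERIV_cmult, rule DERIV_chain2[OF power_series_deriv[OF fast_decay_bessel_euler_coeff]])
       (auto intro!: derivative_eq_intros)
  then show ?thesis by (simp add: power_series_diffs_bessel_euler J0_def)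
qed

lemma of_real_J0: "of_real (J0 x) = J0 (of_real x)"
  by (simp add: J0_def of_real_power_series[OF fast_decay_bessel_coeff])

lemma of_real_zJ0': "of_real (zJ0' x) = zJ0' (of_real x)"
  by (simp add: zJ0'_def of_real_power_series[OF fast_decay_bessel_euler_coeff])

lemma bessel0_0 [simp]: "bessel0 0 = 1"
  unfolding power_series_def powser_zero by (simp add: bessel_coeff_def)

lemma J0_0 [simp]: "J0 0 = 1"
  by (simp add: J0_def)

lemma norm_J0_le: "norm (J0 (z::complex)) \<le> exp (norm z)"
proof -
  define t where "t = norm z / 2"
  have "(\<lambda>i. t ^ i /\<^sub>R fact i) sums exp t" by (rule exp_converges)
  then have es: "(\<lambda>i. inverse (fact i) * t ^ i) sums exp t" by (simp only: real_scaleR_def)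
  have le: "norm (of_real (bessel_coeff i) * (z\<^sup>2) ^ i) \<le> exp t * (inverse (fact i) * t ^ i)" for i
  proof -
    have t0: "t \<ge> 0" by (simp add: t_def)
    have 1: "inverse (fact i) * t ^ i \<le> exp t"
      using sum_le_suminf[OF sums_summable[OF es], of "{i}"] t0 sums_unique[OF es] by (simp only:) auto
    have "(norm z ^ 2) ^ i = (4 * t ^ 2) ^ i" by (simp add: t_def power_divide)
    also have "\<dots> = 4 ^ i * (t ^ i) ^ 2"
      by (metis power_mult_distrib power_mult mult.commute)
    finally have zt: "(norm z ^ 2) ^ i = 4 ^ i * (t ^ i) ^ 2" .
    have "norm (of_real (bessel_coeff i) * (z\<^sup>2) ^ i) = (1 / 4) ^ i / (fact i)\<^sup>2 * (4 ^ i * (t ^ i) ^ 2)"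
    proof -
      have "\<bar>bessel_coeff i\<bar> = (1 / 4) ^ i / (fact i)\<^sup>2"
        by (simp only: bessel_coeff_def abs_divide power_abs abs_minus_cancel) simp
      with zt show ?thesis by (simp only: norm_mult norm_power norm_of_real)
    qed
    also have "\<dots> = (inverse (fact i) * t ^ i) * (inverse (fact i) * t ^ i)"
    proof -
      have q: "(1 / 4 :: real) ^ i * 4 ^ i = 1" unfolding power_mult_distrib[symmetric] by simp
      have "c / f\<^sup>2 * (d * (x::real) ^ 2) = (inverse f * x) * (inverse f * x)" if "c * d = 1" "f \<noteq> 0" for c d f x
        using that by (simp add: field_simps power2_eq_square)
      then show ?thesis using q by (metis fact_nonzero)
    qed
    also have "\<dots> \<le> exp t * (inverse (fact i) * t ^ i)"
      using 1 t0 by (intro mult_right_mono) auto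
    finally show ?thesis .
  qed
  have "norm (J0 z) \<le> (\<Sum>i. exp t * (inverse (fact i) * t ^ i))"
    unfolding J0_def power_series_def
    by (rule norm_suminf_le[OF le]) (rule summable_mult[OF sums_summable[OF es]])
  also have "\<dots> = exp t * exp t"
    unfolding suminf_mult[OF sums_summable[OF es]] sums_unique[OF es, symmetric] ..
  also have "\<dots> = exp (norm z)" unfolding exp_add[symmetric] t_def by simp
  finally show ?thesis .
qed

lemma J0_holomorphic: "J0 holomorphic_on A"
  unfolding holomorphic_on_def field_differentiable_def
  by (auto intro: has_field_derivative_at_within[OF J0_deriv_gen])

lemma zJ0'_holomorphic: "zJ0' holomorphic_on A"
  unfolding holomorphic_on_def field_differentiable_def
  by (auto intro: has_field_derivative_at_within[OF zJ0'_deriv])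

lemma norm_zJ0'_le: "norm (zJ0' (z::complex)) \<le> exp 1 * exp (2 * norm z)"
proof -
  have "norm ((deriv ^^ 1) J0 z) \<le> fact 1 * exp (norm z + 1) / 1 ^ 1"
  proof (rule Cauchy_inequality)
    fix x assume "norm (z - x) = 1"
    then have "norm x \<le> norm z + 1" using norm_triangle_ineq2[of x z] by (simp add: norm_minus_commute)
    then show "norm (J0 x) \<le> exp (norm z + 1)" using norm_J0_le[of x] by (meson exp_le_cancel_iff order_trans)
  qed (auto intro!: J0_holomorphic holomorphic_on_imp_continuous_on)
  then have "norm (deriv J0 z) \<le> exp (norm z + 1)" by simp
  then have "norm z * norm (deriv J0 z) \<le> norm z * exp (norm z + 1)" by (rule mult_left_mono) simp
  then have "norm (zJ0' z) \<le> norm z * exp (norm z + 1)"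
    unfolding zJ0'_eq DERIV_imp_deriv[OF J0_deriv_gen[of z]] norm_mult .
  also have "\<dots> \<le> exp (norm z) * exp (norm z + 1)"
    by (intro mult_right_mono) (use exp_ge_add_one_self[of "norm z"] in linarith, simp)
  also have "\<dots> = exp 1 * exp (2 * norm z)" unfolding exp_add[symmetric] by simp
  finally show ?thesis .
qed

subsection \<open>Sturm comparison\<close>

text \<open>\<open>u(x) = sqrt x J\<^sub>0(x)\<close> solves \<open>u'' + (1 + 1/(4 x\<^sup>2)) u = 0\<close>.\<close>

definition liouville_Q :: "real \<Rightarrow> real" where
  "liouville_Q x = 1 + 1 / (4 * x\<^sup>2)"

lemma liouville_Q_antimono: "0 < x \<Longrightarrow> x \<le> y \<Longrightarrow> liouville_Q y \<le> liouville_Q x"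
  by (simp add: liouville_Q_def frac_le power_mono)

lemma liouville_Q_gt_1: "x \<noteq> 0 \<Longrightarrow> 1 < liouville_Q x"
  by (simp add: liouville_Q_def)

definition liouville_ode :: "(real \<Rightarrow> real) \<Rightarrow> (real \<Rightarrow> real) \<Rightarrow> bool" where
  "liouville_ode u u' \<longleftrightarrow> (\<forall>x>0. (u has_real_derivative u' x) (at x) \<and>
     (u' has_real_derivative - liouville_Q x * u x) (at x))"

lemma liouville_odeD:
  assumes "liouville_ode u u'" "x > 0"
  shows "(u has_real_derivative u' x) (at x)" "(u' has_real_derivative - liouville_Q x * u x) (at x)"
  using assms by (auto simp: liouville_ode_def)

lemma liouville_ode_uminus:
  "liouville_ode u u' \<Longrightarrow> liouville_ode (\<lambda>x. - u x) (\<lambda>x. - u' x)"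
  unfolding liouville_ode_def by (auto intro!: derivative_eq_intros)

lemma liouville_ode_continuous:
  assumes "liouville_ode u u'" "a > 0"
  shows "continuous_on {a..b} u"
proof (intro continuous_at_imp_continuous_on ballI)
  fix x assume "x \<in> {a..b}"
  then show "isCont u x" using liouville_odeD(1)[OF assms(1), of x] assms(2) by (intro DERIV_isCont) auto
qed

lemma ivt_sign:
  fixes u :: "real \<Rightarrow> real"
  assumes "continuous_on {a..b} u" "\<And>x. x \<in> {a..b} \<Longrightarrow> u x \<noteq> 0"
  shows "(\<forall>x\<in>{a..b}. u x > 0) \<or> (\<forall>x\<in>{a..b}. - u x > 0)"
proof (rule ccontr)
  assume "\<not> ?thesis"
  then obtain x y where xy: "x \<in> {a..b}" "y \<in> {a..b}" "u x < 0" "0 < u y"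
    using assms(2) by (smt (verit))
  have "connected (u ` {a..b})" using assms(1) by (intro connected_continuous_image) auto
  then have "0 \<in> u ` {a..b}"
    using xy by (meson connectedD_interval image_eqI less_imp_le)
  then show False using assms(2) by auto
qed

lemma liouville_ode_zero_exists:
  assumes ode: "liouville_ode u u'" and "a > 0"
  shows "\<exists>z\<in>{a..a+pi}. u z = 0"
proof (rule ccontr)
  assume no: "\<not> ?thesis"
  have "\<not> (\<forall>x\<in>{a..a+pi}. v x > 0)" if v: "liouville_ode v v'" for v v'
  proof
    assume pos: "\<forall>x\<in>{a..a+pi}. v x > 0"
    define W where "W x = v' x * sin (x - a) - v x * cos (x - a)" for x
    have "W (a + pi) \<le> W a"
    proof (rule DERIV_nonpos_imp_nonincreasing[where f = "W"])
      fix x assume x: "a \<le> x" "x \<le> a + pi"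
      then have x0: "x > 0" using \<open>a > 0\<close> by simp
      have "(W has_real_derivative (1 - liouville_Q x) * v x * sin (x - a)) (at x)"
        unfolding W_def[abs_def]
        by (auto intro!: derivative_eq_intros liouville_odeD[OF v x0] simp: algebra_simps)
      moreover have "sin (x - a) \<ge> 0" using x by (intro sin_ge_zero) auto
      then have "(1 - liouville_Q x) * v x * sin (x - a) \<le> 0"
        using pos x liouville_Q_gt_1[of x] x0 by (simp add: mult_nonpos_nonneg less_imp_le)
      ultimately show "\<exists>y. (W has_real_derivative y) (at x) \<and> y \<le> 0" by blast
    qed simp
    moreover have "v a > 0" "v (a + pi) > 0" using pos by auto
    ultimately show False by (simp add: W_def)
  qed
  from this[OF ode] this[OF liouville_ode_uminus[OF ode]] show False
    using ivt_sign[OF liouville_ode_continuous[OF ode \<open>a > 0\<close>], of "a + pi"] no by blast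
qed

lemma liouville_ode_endpoint_slopes:
  assumes ode: "liouville_ode u u'" and ab: "0 < a" "a < b" "u a = 0" "u b = 0"
    and pos: "\<And>x. a < x \<Longrightarrow> x < b \<Longrightarrow> u x > 0"
  shows "u' a > 0" "u' b < 0"
proof -
  have nonneg: "u x \<ge> 0" if "a \<le> x" "x \<le> b" for x
    using pos[of x] ab that by (cases "x = a \<or> x = b") (auto simp: less_imp_le)
  have dec: "u' y \<le> u' x" if "a \<le> x" "x \<le> y" "y \<le> b" for x y
  proof (rule DERIV_nonpos_imp_nonincreasing[where f = u', OF that(2)])
    fix t assume "x \<le> t" "t \<le> y"
    then have t: "t > 0" "u t \<ge> 0" using that ab nonneg[of t] by auto
    have "liouville_Q t * u t \<ge> 0" using liouville_Q_gt_1[of t] t by auto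
    then show "\<exists>z. (u' has_real_derivative z) (at t) \<and> z \<le> 0"
      using liouville_odeD(2)[OF ode t(1)] by force
  qed
  define m where "m = (a + b) / 2"
  have m: "a < m" "m < b" using ab by (auto simp: m_def)
  show "u' a > 0"
  proof (rule ccontr)
    assume "\<not> u' a > 0"
    have "u m \<le> u a"
    proof (rule DERIV_nonpos_imp_nonincreasing[where f = "u"])
      fix t assume t: "a \<le> t" "t \<le> m"
      then have "u' t \<le> 0" using dec[of a t] m \<open>\<not> u' a > 0\<close> by simp
      then show "\<exists>z. (u has_real_derivative z) (at t) \<and> z \<le> 0"
        using liouville_odeD(1)[OF ode, of t] t ab by force
    qed (use m in simp)
    then show False using pos[OF m] ab by simp
  qed
  show "u' b < 0"
  proof (rule ccontr)
    assume "\<not> u' b < 0"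
    have "u m \<le> u b"
    proof (rule DERIV_nonneg_imp_nondecreasing[where f = "u"])
      fix t assume t: "m \<le> t" "t \<le> b"
      then have "u' t \<ge> 0" using dec[of t b] m \<open>\<not> u' b < 0\<close> by simp
      then show "\<exists>z. (u has_real_derivative z) (at t) \<and> z \<ge> 0"
        using liouville_odeD(1)[OF ode, of t] t ab m by force
    qed (use m in simp)
    then show False using pos[OF m] ab by simp
  qed
qed

lemma liouville_ode_gap_pos:
  assumes ode: "liouville_ode u u'" and ab: "0 < a" "a < b" "u a = 0" "u b = 0"
    and pos: "\<And>x. a < x \<Longrightarrow> x < b \<Longrightarrow> u x > 0"
  shows "pi / sqrt (liouville_Q a) \<le> b - a" "b - a \<le> pi / sqrt (liouville_Q b)"
proof -
  have nonneg: "u x \<ge> 0" if "a \<le> x" "x \<le> b" for x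
    using pos[of x] ab that by (cases "x = a \<or> x = b") (auto simp: less_imp_le)
  define W where "W \<omega> x = u' x * sin (\<omega> * (x - a)) - \<omega> * u x * cos (\<omega> * (x - a))" for \<omega> x
  have dW: "(W \<omega> has_real_derivative (\<omega>\<^sup>2 - liouville_Q x) * (u x * sin (\<omega> * (x - a)))) (at x)"
    if "x > 0" for x \<omega>
    unfolding W_def
    by (auto intro!: derivative_eq_intros liouville_odeD[OF ode that] simp: algebra_simps power2_eq_square)
  show "b - a \<le> pi / sqrt (liouville_Q b)"
  proof (rule ccontr)
    assume *: "\<not> b - a \<le> pi / sqrt (liouville_Q b)"
    define \<omega> where "\<omega> = sqrt (liouville_Q b)"
    have \<omega>: "\<omega> > 0" "\<omega>\<^sup>2 = liouville_Q b" using liouville_Q_gt_1[of b] ab by (auto simp: \<omega>_def)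
    define c where "c = a + pi / \<omega>"
    have c: "a < c" "c < b" using * \<omega> by (auto simp: c_def \<omega>_def)
    have "W \<omega> c \<le> W \<omega> a"
    proof (rule DERIV_nonpos_imp_nonincreasing[where f = "W \<omega>"])
      fix x assume x: "a \<le> x" "x \<le> c"
      have "\<omega> * (x - a) \<le> \<omega> * (c - a)" using x \<omega> by simp
      then have "\<omega> * (x - a) \<le> pi" using \<omega> by (simp add: c_def)
      then have "sin (\<omega> * (x - a)) \<ge> 0" using x \<omega> by (intro sin_ge_zero) auto
      moreover have "\<omega>\<^sup>2 \<le> liouville_Q x" using liouville_Q_antimono[of x b] x c ab \<omega> by simp
      ultimately have "(\<omega>\<^sup>2 - liouville_Q x) * (u x * sin (\<omega> * (x - a))) \<le> 0"
        using nonneg[of x] x c by (simp add: mult_nonpos_nonneg)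
      then show "\<exists>y. (W \<omega> has_real_derivative y) (at x) \<and> y \<le> 0" using dW[of x \<omega>] x ab by force
    qed (use c in simp)
    moreover have "W \<omega> c = \<omega> * u c" using \<omega> by (simp add: W_def c_def)
    moreover have "W \<omega> a = 0" using ab by (simp add: W_def)
    ultimately show False using pos[OF c] \<omega> by (simp add: mult_le_0_iff)
  qed
  show "pi / sqrt (liouville_Q a) \<le> b - a"
  proof (rule ccontr)
    assume *: "\<not> pi / sqrt (liouville_Q a) \<le> b - a"
    define \<omega> where "\<omega> = sqrt (liouville_Q a)"
    have \<omega>: "\<omega> > 0" "\<omega>\<^sup>2 = liouville_Q a" using liouville_Q_gt_1[of a] ab by (auto simp: \<omega>_def)
    have b: "\<omega> * (b - a) < pi" using * \<omega> by (simp add: \<omega>_def field_simps)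
    have "W \<omega> a \<le> W \<omega> b"
    proof (rule DERIV_nonneg_imp_nondecreasing[where f = "W \<omega>"])
      fix x assume x: "a \<le> x" "x \<le> b"
      have "\<omega> * (x - a) \<le> \<omega> * (b - a)" using x \<omega> by simp
      then have "\<omega> * (x - a) \<le> pi" using b by linarith
      then have "sin (\<omega> * (x - a)) \<ge> 0" using x \<omega> by (intro sin_ge_zero) auto
      moreover have "\<omega>\<^sup>2 \<ge> liouville_Q x" using liouville_Q_antimono[of a x] x ab \<omega> by simp
      ultimately have "(\<omega>\<^sup>2 - liouville_Q x) * (u x * sin (\<omega> * (x - a))) \<ge> 0"
        using nonneg[of x] x by simp
      then show "\<exists>y. (W \<omega> has_real_derivative y) (at x) \<and> y \<ge> 0" using dW[of x \<omega>] x ab by force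
    qed (use ab in simp)
    moreover have "W \<omega> a = 0" using ab by (simp add: W_def)
    moreover have "W \<omega> b = u' b * sin (\<omega> * (b - a))" using ab by (simp add: W_def)
    moreover have "sin (\<omega> * (b - a)) > 0" using b \<omega> ab by (intro sin_gt_zero) auto
    moreover have "u' b < 0" using liouville_ode_endpoint_slopes[OF ode ab pos] by simp
    ultimately show False by (simp add: zero_le_mult_iff)
  qed
qed

lemma ivt_sign_open:
  fixes u :: "real \<Rightarrow> real"
  assumes "continuous_on {a..b} u" "\<And>x. a < x \<Longrightarrow> x < b \<Longrightarrow> u x \<noteq> 0"
  shows "(\<forall>x. a < x \<and> x < b \<longrightarrow> u x > 0) \<or> (\<forall>x. a < x \<and> x < b \<longrightarrow> - u x > 0)"
proof (rule ccontr)
  assume "\<not> ?thesis"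
  then obtain x y where xy: "a < x" "x < b" "a < y" "y < b" "u x < 0" "0 < u y"
    using assms(2) by (smt (verit))
  have "continuous_on {min x y..max x y} u"
    using assms(1) by (rule continuous_on_subset) (use xy in auto)
  from ivt_sign[OF this] show False using xy assms(2)
    by (smt (verit) atLeastAtMost_iff)
qed

lemma liouville_ode_gap:
  assumes ode: "liouville_ode u u'" and ab: "0 < a" "a < b" "u a = 0" "u b = 0"
    and nz: "\<And>x. a < x \<Longrightarrow> x < b \<Longrightarrow> u x \<noteq> 0"
  shows "pi / sqrt (liouville_Q a) \<le> b - a" "b - a \<le> pi / sqrt (liouville_Q b)" "u' a \<noteq> 0"
proof -
  have "pi / sqrt (liouville_Q a) \<le> b - a \<and> b - a \<le> pi / sqrt (liouville_Q b) \<and> u' a \<noteq> 0"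
    using ivt_sign_open[OF liouville_ode_continuous[OF ode ab(1)] nz]
  proof
    assume "\<forall>x. a < x \<and> x < b \<longrightarrow> u x > 0"
    then show ?thesis
      using liouville_ode_gap_pos[OF ode ab] liouville_ode_endpoint_slopes(1)[OF ode ab] by force
  next
    assume "\<forall>x. a < x \<and> x < b \<longrightarrow> - u x > 0"
    then show ?thesis
      using liouville_ode_gap_pos[OF liouville_ode_uminus[OF ode], of a b]
        liouville_ode_endpoint_slopes(1)[OF liouville_ode_uminus[OF ode], of a b] ab by force
  qed
  then show "pi / sqrt (liouville_Q a) \<le> b - a" "b - a \<le> pi / sqrt (liouville_Q b)" "u' a \<noteq> 0"
    by auto
qed

lemma liouville_ode_steep_pos:
  assumes ode: "liouville_ode u u'" and M: "M > 0" "1 / M < q" and pos: "u q > 0"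
    and steep: "\<bar>u' q\<bar> \<ge> M * u q"
  shows "\<exists>p. p > 0 \<and> \<bar>p - q\<bar> \<le> 1 / M \<and> u p = 0"
proof (rule ccontr)
  assume no: "\<not> ?thesis"
  define l r where "l = q - 1 / M" and "r = q + 1 / M"
  have lr: "0 < l" "l < q" "q < r" using M by (auto simp: l_def r_def)
  have nz: "u x \<noteq> 0" if "x \<in> {l..r}" for x
    using no that lr by (auto simp: l_def r_def abs_le_iff)
  have upos: "u x > 0" if "x \<in> {l..r}" for x
  proof -
    have "(\<forall>x\<in>{l..r}. u x > 0) \<or> (\<forall>x\<in>{l..r}. - u x > 0)"
      by (rule ivt_sign[OF liouville_ode_continuous[OF ode lr(1)]]) (rule nz)
    moreover have "q \<in> {l..r}" using lr by simp
    ultimately show ?thesis using pos that by force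
  qed
  have dec: "u' y \<le> u' x" if "l \<le> x" "x \<le> y" "y \<le> r" for x y
  proof (rule DERIV_nonpos_imp_nonincreasing[where f = u', OF that(2)])
    fix t assume "x \<le> t" "t \<le> y"
    then have t: "t > 0" "u t \<ge> 0" using that lr upos[of t] by auto
    have "liouville_Q t * u t \<ge> 0" using liouville_Q_gt_1[of t] t by auto
    then show "\<exists>z. (u' has_real_derivative z) (at t) \<and> z \<le> 0"
      using liouville_odeD(2)[OF ode t(1)] by force
  qed
  have mvt: "\<exists>z. x < z \<and> z < y \<and> u y - u x = (y - x) * u' z" if "l \<le> x" "x < y" for x y
    using MVT2[OF that(2), of u u'] liouville_odeD(1)[OF ode] that lr by force
  show False
  proof (cases "u' q \<ge> 0")
    case True
    obtain z where z: "l < z" "z < q" "u q - u l = (q - l) * u' z" using mvt[of l q] lr by auto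
    have "M * u q \<le> u' z" using dec[of z q] z lr steep True by simp
    then have "(q - l) * (M * u q) \<le> u q - u l" unfolding z(3) using lr by (intro mult_left_mono) auto
    then have "u q \<le> u q - u l" using M by (simp add: l_def)
    then show False using upos[of l] lr by simp
  next
    case False
    obtain z where z: "q < z" "z < r" "u r - u q = (r - q) * u' z" using mvt[of q r] lr by auto
    have "u' z \<le> - (M * u q)" using dec[of q z] z lr steep False by simp
    then have "u r - u q \<le> (r - q) * - (M * u q)" unfolding z(3) using lr by (intro mult_left_mono) auto
    then have "u r - u q \<le> - u q" using M by (simp add: r_def)
    then show False using upos[of r] lr by simp
  qed
qed

lemma liouville_ode_steep:
  assumes ode: "liouville_ode u u'" and M: "M > 0" "1 / M < q"
    and steep: "\<bar>u' q\<bar> \<ge> M * \<bar>u q\<bar>"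
  shows "\<exists>p. p > 0 \<and> \<bar>p - q\<bar> \<le> 1 / M \<and> u p = 0"
proof -
  have q: "q > 0" using M by (meson less_trans zero_less_divide_1_iff)
  consider "u q = 0" | "u q > 0" | "- u q > 0" by linarith
  then show ?thesis
  proof cases
    case 1
    then show ?thesis using q M by (intro exI[of _ q]) auto
  next
    case 2
    then show ?thesis using liouville_ode_steep_pos[OF ode M] steep by simp
  next
    case 3
    then show ?thesis using liouville_ode_steep_pos[OF liouville_ode_uminus[OF ode] M] steep by simp
  qed
qed

subsection \<open>Zeros of \<open>J\<^sub>0\<close>\<close>

definition J0_liouville :: "real \<Rightarrow> real" where
  "J0_liouville x = sqrt x * J0 x"

definition J0_liouville' :: "real \<Rightarrow> real" where
  "J0_liouville' x = J0 x / (2 * sqrt x) + zJ0' x / sqrt x"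

lemma liouville_ode_J0: "liouville_ode J0_liouville J0_liouville'"
  unfolding liouville_ode_def
proof (intro allI impI conjI)
  fix x :: real assume x: "x > 0"
  define r where "r = sqrt x"
  have r: "r > 0" "x = r\<^sup>2" "sqrt x = r" using x by (auto simp: r_def)
  have dJ: "(J0 has_real_derivative zJ0' x / x) (at x)" using x by (intro J0_deriv) simp
  note dz = zJ0'_deriv[of x] and ds = DERIV_real_sqrt[OF x]
  show "(J0_liouville has_real_derivative J0_liouville' x) (at x)"
    unfolding J0_liouville_def[abs_def] J0_liouville'_def
    by (rule DERIV_cong[OF DERIV_mult[OF ds dJ]])
       (simp only: r(3), use r in \<open>simp add: field_simps power2_eq_square\<close>)
  have nz: "2 * sqrt x \<noteq> 0" "sqrt x \<noteq> 0" using x by auto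
  show "(J0_liouville' has_real_derivative - liouville_Q x * J0_liouville x) (at x)"
    unfolding J0_liouville_def J0_liouville'_def[abs_def] liouville_Q_def
    by (rule DERIV_cong[OF DERIV_add[OF DERIV_divide[OF dJ DERIV_cmult[OF ds] nz(1)] DERIV_divide[OF dz ds nz(2)]]])
       (simp only: r(3), use r in \<open>simp add: field_simps power2_eq_square\<close>)
qed

lemma J0_liouville_eq_0_iff: "x > 0 \<Longrightarrow> J0_liouville x = 0 \<longleftrightarrow> J0 x = 0"
  by (simp add: J0_liouville_def)

lemma J0_zero_exists:
  assumes "a > 0" obtains z :: real where "a \<le> z" "z \<le> a + pi" "J0 z = 0"
  using liouville_ode_zero_exists[OF liouville_ode_J0 assms] J0_liouville_eq_0_iff assms by auto

lemma finite_J0_zeros: "finite {x \<in> {a..b::real}. J0 x = 0}"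
proof -
  define R where "R = max \<bar>a\<bar> \<bar>b\<bar>"
  have "finite {z \<in> cball 0 R. J0 z = (0::complex)}"
  proof (rule holomorphic_compact_finite_zeros[OF J0_holomorphic open_UNIV connected_UNIV])
    obtain x where x: "J0 (x::real) = 0" using J0_zero_exists[of 1] by auto
    then have "J0 (of_real x :: complex) = 0" by (simp flip: of_real_J0)
    then have "J0 (of_real x) \<noteq> J0 (0::complex)" by simp
    then show "\<not> (J0 :: complex \<Rightarrow> complex) constant_on UNIV" by (metis UNIV_I constant_on_def)
  qed auto
  moreover have "of_real ` {x \<in> {a..b}. J0 x = 0} \<subseteq> {z \<in> cball 0 R. J0 z = (0::complex)}"
    by (auto simp: R_def simp flip: of_real_J0)
  ultimately have "finite ((of_real :: real \<Rightarrow> complex) ` {x \<in> {a..b}. J0 x = 0})"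
    by (rule rev_finite_subset)
  then show ?thesis by (rule finite_imageD) (auto simp: inj_on_def)
qed

lemma J0_next_zero:
  assumes "a > 0"
  obtains b :: real where "a < b" "J0 b = 0" "\<And>x. a < x \<Longrightarrow> x < b \<Longrightarrow> J0 x \<noteq> 0"
proof -
  define Z where "Z = {x \<in> {a..a + 1 + pi}. J0 x = 0} - {a}"
  have fin: "finite Z" unfolding Z_def by (intro finite_Diff finite_J0_zeros)
  obtain z where "a + 1 \<le> z" "z \<le> a + 1 + pi" "J0 z = 0"
    using J0_zero_exists[of "a + 1"] assms by auto
  then have "z \<in> Z" by (simp add: Z_def)
  then have ne: "Z \<noteq> {}" by blast
  show ?thesis
  proof (rule that[of "Min Z"])
    show "a < Min Z" "J0 (Min Z) = 0" using Min_in[OF fin ne] by (auto simp: Z_def)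
    show "J0 x \<noteq> 0" if "a < x" "x < Min Z" for x
    proof
      assume "J0 x = 0"
      then have "x \<in> Z" using that Min_in[OF fin ne] by (auto simp: Z_def)
      then show False using that Min_le[OF fin] by force
    qed
  qed
qed

lemma zJ0'_nonzero:
  assumes "a > 0" "J0 a = 0" shows "zJ0' a \<noteq> (0::real)"
proof -
  obtain b where b: "a < b" "J0 b = 0" "\<And>x. a < x \<Longrightarrow> x < b \<Longrightarrow> J0 x \<noteq> 0"
    using J0_next_zero[OF assms(1)] by blast
  have "J0_liouville' a \<noteq> 0"
    by (rule liouville_ode_gap(3)[OF liouville_ode_J0 assms(1) b(1)])
       (use b assms in \<open>auto simp: J0_liouville_eq_0_iff\<close>)
  then show ?thesis using assms by (simp add: J0_liouville'_def)
qed

lemma J0_zero_gaps: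
  assumes "0 < a" "a < b" "J0 a = 0" "J0 b = 0"
  shows "\<exists>k::nat. real k \<ge> 1 \<and> k * pi / sqrt (liouville_Q a) \<le> b - a \<and> b - a \<le> k * pi / sqrt (liouville_Q b)"
  using assms
proof (induction "card {x \<in> {a..b}. J0 x = 0}" arbitrary: a b rule: less_induct)
  case less
  show ?case
  proof (cases "\<exists>c. a < c \<and> c < b \<and> J0 c = 0")
    case False
    then have "pi / sqrt (liouville_Q a) \<le> b - a" "b - a \<le> pi / sqrt (liouville_Q b)"
      using liouville_ode_gap(1,2)[OF liouville_ode_J0, of a b] less.prems
      by (auto simp: J0_liouville_eq_0_iff)
    then show ?thesis by (intro exI[of _ 1]) auto
  next
    case True
    then obtain c where c: "a < c" "c < b" "J0 c = 0" by blast
    have "{x \<in> {a..c}. J0 x = 0} \<subseteq> {x \<in> {a..b}. J0 x = 0}"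
      "{x \<in> {c..b}. J0 x = 0} \<subseteq> {x \<in> {a..b}. J0 x = 0}"
      using c less.prems by auto
    moreover have "b \<in> {x \<in> {a..b}. J0 x = 0}" "a \<in> {x \<in> {a..b}. J0 x = 0}"
      "b \<notin> {x \<in> {a..c}. J0 x = 0}" "a \<notin> {x \<in> {c..b}. J0 x = 0}"
      using c less.prems by auto
    ultimately have "{x \<in> {a..c}. J0 x = 0} \<subset> {x \<in> {a..b}. J0 x = 0}"
      "{x \<in> {c..b}. J0 x = 0} \<subset> {x \<in> {a..b}. J0 x = 0}"
      by blast+
    note card = this[THEN psubset_card_mono[OF finite_J0_zeros]]
    from card obtain k l :: nat where kl: "real k \<ge> 1" "real l \<ge> 1"
      "k * pi / sqrt (liouville_Q a) \<le> c - a" "c - a \<le> k * pi / sqrt (liouville_Q c)"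
      "l * pi / sqrt (liouville_Q c) \<le> b - c" "b - c \<le> l * pi / sqrt (liouville_Q b)"
      using less.hyps[of a c] less.hyps[of c b] less.prems c by (smt (verit))
    have Q: "1 < liouville_Q a" "1 < liouville_Q b" "1 < liouville_Q c" "liouville_Q c \<le> liouville_Q a"
      "liouville_Q b \<le> liouville_Q c"
      using c less.prems by (auto intro!: liouville_Q_gt_1 liouville_Q_antimono)
    have "l * pi / sqrt (liouville_Q a) \<le> l * pi / sqrt (liouville_Q c)"
      "k * pi / sqrt (liouville_Q c) \<le> k * pi / sqrt (liouville_Q b)"
      using Q by (auto intro!: divide_left_mono)
    then show ?thesis
      using kl by (intro exI[of _ "k + l"]) (auto simp: ring_distribs add_divide_distrib)
  qed
qed

lemma liouville_Q_gap:
  assumes "y \<ge> 1" "r > 1"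
  shows "(1 - 1 / r\<^sup>2) / (24 * y\<^sup>2) \<le> 1 / sqrt (liouville_Q (r * y)) - 1 / sqrt (liouville_Q y)"
proof -
  define A B where "A = sqrt (liouville_Q (r * y))" and "B = sqrt (liouville_Q y)"
  have y2: "1 / y\<^sup>2 \<le> 1" using assms by (simp add: one_le_power)
  have AB: "1 < A" "A \<le> B"
    using assms liouville_Q_gt_1[of "r * y"] liouville_Q_antimono[of y "r * y"]
    by (auto simp: A_def B_def)
  have "B \<le> sqrt (5/4)" using y2 by (simp add: B_def liouville_Q_def)
  also have "\<dots> \<le> 5/4" by (rule real_le_lsqrt) (auto simp: power2_eq_square)
  finally have B: "B \<le> 5/4" .
  have "(1 - 1 / r\<^sup>2) / (12 * y\<^sup>2) * 3 = (1 - 1 / r\<^sup>2) / (4 * y\<^sup>2)"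
    by (simp only: times_divide_eq_left) (simp add: divide_simps)
  also have "\<dots> = B\<^sup>2 - A\<^sup>2"
    using liouville_Q_gt_1[of "r * y"] liouville_Q_gt_1[of y] assms
    by (simp add: A_def B_def) (simp add: liouville_Q_def field_simps power2_eq_square)
  also have "\<dots> = (B - A) * (A + B)" by (simp add: power2_eq_square algebra_simps)
  also have "\<dots> \<le> (B - A) * 3" using AB B by (intro mult_left_mono) auto
  finally have 1: "(1 - 1 / r\<^sup>2) / (12 * y\<^sup>2) \<le> B - A" by (rule mult_right_le_imp_le) simp
  have "A * B \<le> (5/4) * (5/4)" using AB B by (intro mult_mono) auto
  then have "(B - A) / 2 \<le> (B - A) / (A * B)"
    using AB by (intro divide_left_mono) auto
  also have "\<dots> = 1 / A - 1 / B" using AB by (simp add: field_simps)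
  finally have 2: "(B - A) / 2 \<le> 1 / A - 1 / B" .
  have "(1 - 1 / r\<^sup>2) / (24 * y\<^sup>2) = (1 - 1 / r\<^sup>2) / (12 * y\<^sup>2) / 2" by (simp add: divide_divide_eq_left)
  also have "\<dots> \<le> (B - A) / 2" by (rule divide_right_mono[OF 1]) simp
  also note 2
  finally show ?thesis unfolding A_def B_def .
qed

lemma nat_near_real:
  fixes S :: real
  obtains e where "e > 0" "\<And>N::nat. \<bar>real N - S\<bar> < e \<Longrightarrow> real N = S"
proof -
  define F where "F = {N::nat. \<bar>real N - S\<bar> < 1 \<and> real N \<noteq> S}"
  have "F \<subseteq> {..nat \<lceil>S + 1\<rceil>}" by (auto simp: F_def) linarith
  then have fin: "finite F" by (rule finite_subset) simp
  define e where "e = Min (insert 1 ((\<lambda>N. \<bar>real N - S\<bar>) ` F))"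
  show ?thesis
  proof (rule that)
    show "e > 0" unfolding e_def by (subst Min_gr_iff) (use fin in \<open>auto simp: F_def\<close>)
    show "real N = S" if "\<bar>real N - S\<bar> < e" for N
    proof (rule ccontr)
      assume "real N \<noteq> S"
      moreover have "e \<le> 1" unfolding e_def by (rule Min_le) (use fin in auto)
      ultimately have "N \<in> F" using that by (auto simp: F_def)
      then have "e \<le> \<bar>real N - S\<bar>" unfolding e_def by (intro Min_le) (use fin in auto)
      then show False using that by simp
    qed
  qed
qed

text \<open>If \<open>S j\<close> stayed within \<open>O(1 / j)\<close> of the zeros of \<open>J\<^sub>0\<close>, then \<open>S\<close> would be an integer, and the
  excess of the spacing of the dilated zeros over that of the zeros, which is at least a multiple
  of \<open>1 / j\<^sup>2\<close>, would push the difference beyond any small multiple of \<open>1 / j\<close>.\<close>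

lemma dilated_J0_zeros_apart:
  fixes S :: real
  assumes S: "S > 1"
  shows "\<exists>\<kappa>>0. \<forall>T. \<exists>j\<ge>T. j > 0 \<and> J0 j = 0 \<and> (\<forall>p>0. J0 p = 0 \<longrightarrow> \<bar>S * j - p\<bar> > \<kappa> / j)"
proof -
  define r where "r = (S + 1) / 2"
  define c2 where "c2 = S * pi * ((1 - 1 / r\<^sup>2) / 24)"
  define c where "c = c2 / 30"
  have r: "r > 1" "r < S" using S by (auto simp: r_def)
  have "1 / r\<^sup>2 < 1" using r by (simp add: one_less_power)
  then have c2: "c2 > 0" using S by (simp add: c2_def)
  define \<kappa> where "\<kappa> = c / 2"
  have \<kappa>: "\<kappa> > 0" "\<kappa> < c" using c2 by (auto simp: \<kappa>_def c_def)
  show ?thesis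
  proof (intro exI[of _ \<kappa>] conjI \<kappa>(1), rule ccontr)
    assume "\<not> (\<forall>T. \<exists>j\<ge>T. j > 0 \<and> J0 j = 0 \<and> (\<forall>p>0. J0 p = 0 \<longrightarrow> \<bar>S * j - p\<bar> > \<kappa> / j))"
    then obtain T0 where "\<And>j. j \<ge> T0 \<Longrightarrow> j > 0 \<Longrightarrow> J0 j = 0 \<Longrightarrow> \<exists>p>0. J0 p = 0 \<and> \<bar>S * j - p\<bar> \<le> \<kappa> / j"
      by (meson not_le)
    then obtain P where P: "\<And>j. j \<ge> T0 \<Longrightarrow> j > 0 \<Longrightarrow> J0 j = 0 \<Longrightarrow> P j > 0 \<and> J0 (P j) = 0 \<and> \<bar>S * j - P j\<bar> \<le> \<kappa> / j"
      by metis
    obtain e where e: "e > 0" "\<And>N::nat. \<bar>real N - S\<bar> < e \<Longrightarrow> real N = S"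
      using nat_near_real by blast
    have "\<forall>\<^sub>F j in at_top. r * (j + 1 + pi) + \<kappa> / j < S * j"
      using r by real_asymp
    moreover have "((\<lambda>j. (S + 2 * \<kappa> / (pi * j)) * sqrt (liouville_Q j)) \<longlongrightarrow> S) at_top"
      unfolding liouville_Q_def by real_asymp
    then have "\<forall>\<^sub>F j in at_top. (S + 2 * \<kappa> / (pi * j)) * sqrt (liouville_Q j) < S + e"
      using e(1) by (intro order_tendstoD) auto
    moreover have "((\<lambda>j. S / sqrt (liouville_Q j) - 2 * \<kappa> / (pi * j)) \<longlongrightarrow> S) at_top"
      unfolding liouville_Q_def by real_asymp
    then have "\<forall>\<^sub>F j in at_top. S / sqrt (liouville_Q j) - 2 * \<kappa> / (pi * j) > S - e"
      using e(1) by (intro order_tendstoD) auto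
    moreover have "((\<lambda>j. 2 * pi / sqrt (liouville_Q j)) \<longlongrightarrow> 2 * pi) at_top"
      unfolding liouville_Q_def by real_asymp
    then have "\<forall>\<^sub>F j in at_top. 2 * pi / sqrt (liouville_Q j) > 1 + pi"
      using pi_gt3 by (intro order_tendstoD) auto
    moreover have "((\<lambda>j. 2 * (\<kappa> / j)) \<longlongrightarrow> 0) at_top"
      by real_asymp
    then have "\<forall>\<^sub>F j in at_top. 2 * (\<kappa> / j) < r"
      by (rule order_tendstoD(2)) (use r in auto)
    ultimately have "\<forall>\<^sub>F j in at_top. r * (j + 1 + pi) + \<kappa> / j < S * j \<and>
        (S + 2 * \<kappa> / (pi * j)) * sqrt (liouville_Q j) < S + e \<and>
        S / sqrt (liouville_Q j) - 2 * \<kappa> / (pi * j) > S - e \<and>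
        2 * pi / sqrt (liouville_Q j) > 1 + pi \<and> 2 * (\<kappa> / j) < r"
      by eventually_elim simp
    then obtain T1 where T1: "\<And>j. j \<ge> T1 \<Longrightarrow> r * (j + 1 + pi) + \<kappa> / j < S * j"
        "\<And>j. j \<ge> T1 \<Longrightarrow> (S + 2 * \<kappa> / (pi * j)) * sqrt (liouville_Q j) < S + e"
        "\<And>j. j \<ge> T1 \<Longrightarrow> S / sqrt (liouville_Q j) - 2 * \<kappa> / (pi * j) > S - e"
        "\<And>j. j \<ge> T1 \<Longrightarrow> 2 * pi / sqrt (liouville_Q j) > 1 + pi"
        "\<And>j. j \<ge> T1 \<Longrightarrow> 2 * (\<kappa> / j) < r"
      unfolding eventually_at_top_linorder by blast
    define T where "T = max 1 (max T0 T1)"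
    define d where "d j = S * j - P j - c / j" for j
    have step: "\<exists>j'\<ge>j+1. J0 j' = 0 \<and> d j' \<le> d j" if j: "j \<ge> T" "J0 j = 0" for j
    proof -
      have j1: "j \<ge> 1" "j \<ge> T0" "j \<ge> T1" using j by (auto simp: T_def)
      obtain j' where j': "j + 1 \<le> j'" "j' \<le> j + 1 + pi" "J0 j' = 0"
        using J0_zero_exists[of "j + 1"] j1 by auto
      have Pj: "P j > 0" "J0 (P j) = 0" "\<bar>S * j - P j\<bar> \<le> \<kappa> / j" using P[of j] j j1 by auto
      have Pj': "P j' > 0" "J0 (P j') = 0" "\<bar>S * j' - P j'\<bar> \<le> \<kappa> / j'" using P[of j'] j' j1 by auto
      have kj: "\<kappa> / j' \<le> \<kappa> / j" using j' j1 \<kappa> by (auto intro!: divide_left_mono)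
      have kj1: "\<kappa> / j \<ge> 0" using \<kappa> j1 by simp
      have rP: "r * j' \<le> P j"
      proof -
        have "r * j' \<le> r * (j + 1 + pi)" using r j' by simp
        then show ?thesis using T1(1)[OF j1(3)] Pj(3) by linarith
      qed
      have jP: "j \<le> P j"
      proof -
        have "j' \<le> r * j'" using r j' j1 by simp
        then show ?thesis using rP j' by linarith
      qed
      have sQ: "sqrt (liouville_Q x) > 1" if "x > 0" for x using liouville_Q_gt_1[of x] that by simp
      have sQP: "sqrt (liouville_Q (P j)) \<le> sqrt (liouville_Q j)"
        using liouville_Q_antimono[of j "P j"] jP j1 by simp
      obtain k :: nat where k: "real k \<ge> 1" "k * pi / sqrt (liouville_Q j) \<le> j' - j"
        "j' - j \<le> k * pi / sqrt (liouville_Q j')"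
        using J0_zero_gaps[OF _ _ j(2) j'(3)] j'(1) j1(1) by auto
      have "k = 1"
      proof (rule ccontr)
        assume "k \<noteq> 1"
        then have "real k \<ge> 2" using k(1) by simp
        then have "2 * pi / sqrt (liouville_Q j) \<le> k * pi / sqrt (liouville_Q j)"
          using sQ[of j] j1 by (intro divide_right_mono mult_right_mono) auto
        then show False using T1(4)[OF j1(3)] k(2) j' by linarith
      qed
      then have gap: "pi / sqrt (liouville_Q j) \<le> j' - j" "j' - j \<le> pi / sqrt (liouville_Q j')"
        using k by auto
      have diff: "\<bar>(P j' - P j) - S * (j' - j)\<bar> \<le> 2 * (\<kappa> / j)"
      proof -
        have "(P j' - P j) - S * (j' - j) = (S * j - P j) - (S * j' - P j')" by (simp add: algebra_simps)
        then show ?thesis using Pj(3) Pj'(3) kj by linarith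
      qed
      have "P j < P j'"
      proof -
        have "S * (j' - j) \<ge> r * 1" using r j' by (intro mult_mono) auto
        moreover have "2 * (\<kappa> / j) < r" by (rule T1(5)[OF j1(3)])
        ultimately show ?thesis using diff by linarith
      qed
      from J0_zero_gaps[OF Pj(1) this Pj(2) Pj'(2)]
      obtain N :: nat where N: "real N \<ge> 1" "N * pi / sqrt (liouville_Q (P j)) \<le> P j' - P j"
        "P j' - P j \<le> N * pi / sqrt (liouville_Q (P j'))"
        by (elim exE conjE)
      have "N * pi \<le> (S * (j' - j) + 2 * (\<kappa> / j)) * sqrt (liouville_Q (P j))"
      proof -
        have "N * pi \<le> (P j' - P j) * sqrt (liouville_Q (P j))"
          using N(2) sQ[of "P j"] Pj(1) by (simp add: pos_divide_le_eq)
        also have "\<dots> \<le> (S * (j' - j) + 2 * (\<kappa> / j)) * sqrt (liouville_Q (P j))"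
          using diff sQ[of "P j"] Pj(1) by (intro mult_right_mono) auto
        finally show ?thesis .
      qed
      also have "\<dots> \<le> (S * pi + 2 * (\<kappa> / j)) * sqrt (liouville_Q j)"
      proof (rule mult_mono)
        have "pi / sqrt (liouville_Q j') \<le> pi / 1"
          using sQ[of j'] j' j1 by (intro divide_left_mono) auto
        then have "j' - j \<le> pi" using gap(2) by simp
        then show "S * (j' - j) + 2 * (\<kappa> / j) \<le> S * pi + 2 * (\<kappa> / j)" using S by simp
      qed (use sQP S kj1 Pj liouville_Q_gt_1[of "P j"] in auto)
      also have "\<dots> = pi * ((S + 2 * \<kappa> / (pi * j)) * sqrt (liouville_Q j))"
        using j1 by (simp add: field_simps)
      also have "\<dots> < pi * (S + e)" using T1(2)[OF j1(3)] by simp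
      finally have "N < S + e" by simp
      moreover have "S - e < N"
      proof -
        have "pi * (S - e) < pi * (S / sqrt (liouville_Q j) - 2 * \<kappa> / (pi * j))"
          using T1(3)[OF j1(3)] by simp
        also have "\<dots> = S * (pi / sqrt (liouville_Q j)) - 2 * (\<kappa> / j)"
          using j1 by (simp add: field_simps)
        also have "\<dots> \<le> S * (j' - j) - 2 * (\<kappa> / j)"
          by (intro diff_right_mono mult_left_mono gap(1)) (use S in simp)
        also have "\<dots> \<le> P j' - P j" using diff by linarith
        also have "\<dots> \<le> N * pi / sqrt (liouville_Q (P j'))" by (rule N(3))
        also have "\<dots> \<le> N * pi / 1" using sQ[of "P j'"] Pj' by (intro divide_left_mono) auto
        finally show ?thesis by (simp add: mult.commute)
      qed
      ultimately have NS: "real N = S" by (intro e(2)) auto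
      have jj: "j' \<le> 6 * j" using j'(2) pi_less_4 j1 by linarith
      have cj: "c / j - c / j' \<le> c2 / j'\<^sup>2"
      proof -
        have "c / j - c / j' = c * (j' - j) / (j * j')" using j1 j' by (simp add: field_simps)
        also have "\<dots> \<le> c * 5 / (j * j')"
          using j' j1 c2 pi_less_4 by (intro divide_right_mono mult_left_mono) (auto simp: c_def)
        also have "\<dots> \<le> c * 5 / (j' / 6 * j')"
          using jj j' j1 c2 by (intro divide_left_mono mult_right_mono) (auto simp: c_def)
        also have "\<dots> = c2 / j'\<^sup>2" by (simp add: c_def power2_eq_square)
        finally show ?thesis .
      qed
      have "c2 / j'\<^sup>2 = S * pi * ((1 - 1 / r\<^sup>2) / (24 * j'\<^sup>2))" by (simp add: c2_def)
      also have "\<dots> \<le> S * pi * (1 / sqrt (liouville_Q (r * j')) - 1 / sqrt (liouville_Q j'))"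
        using S j' j1 r by (intro mult_left_mono liouville_Q_gap) auto
      also have "\<dots> = S * pi / sqrt (liouville_Q (r * j')) - S * (pi / sqrt (liouville_Q j'))"
        by (simp add: right_diff_distrib)
      also have "\<dots> \<le> S * pi / sqrt (liouville_Q (P j)) - S * (j' - j)"
      proof (rule diff_mono)
        have "sqrt (liouville_Q (P j)) \<le> sqrt (liouville_Q (r * j'))"
          using liouville_Q_antimono[of "r * j'" "P j"] rP r j' j1 by simp
        then show "S * pi / sqrt (liouville_Q (r * j')) \<le> S * pi / sqrt (liouville_Q (P j))"
          using sQ[of "P j"] Pj S by (intro divide_left_mono) auto
        show "S * (j' - j) \<le> S * (pi / sqrt (liouville_Q j'))"
          by (intro mult_left_mono gap(2)) (use S in simp)
      qed
      also have "\<dots> \<le> (P j' - P j) - S * (j' - j)" using N(2) by (simp add: NS)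
      finally have "d j' \<le> d j" using cj by (simp add: d_def algebra_simps)
      then show ?thesis using j' by blast
    qed
    have "T > 0" by (simp add: T_def)
    then obtain j0 where j0: "j0 \<ge> T" "J0 j0 = 0" by (rule J0_zero_exists)
    have dneg: "d j0 < 0"
    proof -
      have "S * j0 - P j0 \<le> \<kappa> / j0" using P[of j0] j0 by (auto simp: T_def)
      also have "\<dots> < c / j0" using \<kappa> j0 by (auto simp: T_def intro!: divide_strict_right_mono)
      finally show ?thesis by (simp add: d_def)
    qed
    have far: "\<exists>j\<ge>T + real i. J0 j = 0 \<and> d j \<le> d j0" for i
    proof (induction i)
      case 0
      then show ?case using j0 by auto
    next
      case (Suc i)
      then obtain j where j: "j \<ge> T + real i" "J0 j = 0" "d j \<le> d j0" by blast
      then have "j \<ge> T" by linarith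
      with step[OF this j(2)] obtain j' where "j' \<ge> j + 1" "J0 j' = 0" "d j' \<le> d j" by blast
      then show ?case using j by (intro exI[of _ j']) auto
    qed
    obtain i :: nat where i: "(\<kappa> + c) / (- d j0) < real i" using reals_Archimedean2 by blast
    obtain j where j: "j \<ge> T + real i" "J0 j = 0" "d j \<le> d j0" using far by blast
    have jT: "j \<ge> 1" "j \<ge> T0" "real i < j" using j by (auto simp: T_def)
    have "- d j \<le> (\<kappa> + c) / j"
      using P[of j] jT j(2) by (auto simp: d_def add_divide_distrib)
    also have "\<dots> < - d j0"
    proof -
      have "\<kappa> + c < - d j0 * real i" using i dneg by (simp add: field_simps)
      also have "\<dots> \<le> - d j0 * j" using dneg jT by (intro mult_left_mono) auto
      finally show ?thesis using jT by (simp add: field_simps)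
    qed
    finally show False using j(3) by simp
  qed
qed

subsection \<open>The characteristic function of the radial mode\<close>

definition radial_det :: "real \<Rightarrow> real \<Rightarrow> complex \<Rightarrow> complex" where
  "radial_det s \<eta> z = zJ0' (of_real s * z) * J0 z - zJ0' z * J0 (of_real s * z)
     - of_real \<eta> * J0 z * J0 (of_real s * z)"

lemma radial_det_inverse:
  assumes "s > 0"
  shows "radial_det s \<eta> z = - radial_det (1 / s) (- \<eta>) (of_real s * z)"
  using assms by (simp add: radial_det_def algebra_simps)

lemma radial_det_holomorphic: "radial_det s \<eta> holomorphic_on UNIV"
proof -
  have "(\<lambda>z. J0 (of_real s * z)) holomorphic_on (UNIV :: complex set)"
    "(\<lambda>z. zJ0' (of_real s * z)) holomorphic_on (UNIV :: complex set)"
    using holomorphic_on_compose_gen[OF _ J0_holomorphic, of "\<lambda>z. of_real s * z" UNIV UNIV]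
      holomorphic_on_compose_gen[OF _ zJ0'_holomorphic, of "\<lambda>z. of_real s * z" UNIV UNIV]
    by (auto simp: o_def intro!: holomorphic_intros)
  then show ?thesis
    unfolding radial_det_def[abs_def] by (intro holomorphic_intros J0_holomorphic zJ0'_holomorphic) auto
qed

lemma norm_radial_det_le:
  "norm (radial_det s \<eta> z) \<le> (2 * exp 1 + \<bar>\<eta>\<bar>) * exp ((2 + 2 * \<bar>s\<bar>) * norm z)"
proof -
  define a b where "a = norm z" and "b = \<bar>s\<bar> * norm z"
  have ab: "a \<ge> 0" "b \<ge> 0" by (auto simp: a_def b_def)
  have 1: "norm (J0 z) \<le> exp (2 * a)" "norm (J0 (of_real s * z)) \<le> exp (2 * b)"
    using norm_J0_le[of z] norm_J0_le[of "of_real s * z"] ab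
    by (auto simp: a_def b_def norm_mult intro: order_trans)
  have 2: "norm (zJ0' z) \<le> exp 1 * exp (2 * a)" "norm (zJ0' (of_real s * z)) \<le> exp 1 * exp (2 * b)"
    using norm_zJ0'_le[of z] norm_zJ0'_le[of "of_real s * z"] by (auto simp: a_def b_def norm_mult)
  have "norm (zJ0' (of_real s * z) * J0 z) \<le> (exp 1 * exp (2 * b)) * exp (2 * a)"
    "norm (zJ0' z * J0 (of_real s * z)) \<le> (exp 1 * exp (2 * a)) * exp (2 * b)"
    "norm (J0 z * J0 (of_real s * z)) \<le> exp (2 * a) * exp (2 * b)"
    unfolding norm_mult by (intro mult_mono 1 2; simp)+
  moreover have "norm (of_real \<eta> * J0 z * J0 (of_real s * z)) = \<bar>\<eta>\<bar> * norm (J0 z * J0 (of_real s * z))"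
    by (simp add: norm_mult)
  moreover have "\<bar>\<eta>\<bar> * norm (J0 z * J0 (of_real s * z)) \<le> \<bar>\<eta>\<bar> * (exp (2 * a) * exp (2 * b))"
    using calculation(3) by (intro mult_left_mono) auto
  ultimately have "norm (radial_det s \<eta> z)
      \<le> exp 1 * exp (2 * b) * exp (2 * a) + exp 1 * exp (2 * a) * exp (2 * b) + \<bar>\<eta>\<bar> * (exp (2 * a) * exp (2 * b))"
    unfolding radial_det_def
    by (smt (verit) norm_triangle_ineq4)
  also have "\<dots> = (2 * exp 1 + \<bar>\<eta>\<bar>) * exp (2 * a + 2 * b)"
    by (simp add: exp_add algebra_simps)
  also have "2 * a + 2 * b = (2 + 2 * \<bar>s\<bar>) * norm z" by (simp add: a_def b_def algebra_simps)
  finally show ?thesis .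
qed

lemma J0_deriv_scaled:
  fixes z :: complex
  assumes "c \<noteq> 0" "z \<noteq> 0"
  shows "((\<lambda>z. J0 (c * z)) has_field_derivative zJ0' (c * z) / z) (at z)"
  by (rule DERIV_cong[OF DERIV_chain2[where f = J0, OF J0_deriv[of "c * z"] DERIV_cmult_Id]])
     (use assms in auto)

lemma zJ0'_deriv_scaled:
  fixes z :: complex
  shows "((\<lambda>z. zJ0' (c * z)) has_field_derivative - c\<^sup>2 * z * J0 (c * z)) (at z)"
  by (rule DERIV_cong[OF DERIV_chain2[where f = zJ0', OF zJ0'_deriv[of "c * z"] DERIV_cmult_Id]])
     (simp add: power2_eq_square)

text \<open>At a zero \<open>q\<close> of \<open>J\<^sub>0(s \<cdot>)\<close> the quotient of the second derivative of the determinant by the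
  determinant is \<open>1 - s\<^sup>2\<close> up to terms carrying a factor \<open>\<eta>\<close>.\<close>

lemma logderiv2_radial_det:
  fixes s \<eta> q :: real
  assumes s: "s > 0" and q: "q > 0" "J0 (s * q) = 0" "J0 q \<noteq> 0"
  shows "radial_det s \<eta> (of_real q) \<noteq> 0"
    "Re (logderiv2 (radial_det s \<eta>) (of_real q)) =
       1 - s\<^sup>2 - 2 * \<eta> * (zJ0' q / (q * J0 q)) / q + (\<eta> - \<eta>\<^sup>2) / q\<^sup>2"
proof -
  define c e x :: complex where "c = of_real s" and "e = of_real \<eta>" and "x = of_real q"
  define R where "R z = zJ0' z * J0 (c * z) + J0 z * zJ0' (c * z)" for z
  have x0: "x \<noteq> 0" "c \<noteq> 0" using q s by (auto simp: x_def c_def)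
  have d1: "(radial_det s \<eta> has_field_derivative
      (1 - c\<^sup>2) * z * (J0 z * J0 (c * z)) - e / z * R z) (at z)" if "z \<noteq> 0" for z
    unfolding radial_det_def[abs_def] c_def[symmetric] e_def[symmetric]
    by (auto intro!: derivative_eq_intros J0_deriv[OF that] zJ0'_deriv J0_deriv_scaled[OF x0(2) that]
        zJ0'_deriv_scaled) (simp add: R_def field_simps power2_eq_square that)
  have Jx: "J0 (c * x) = 0" using q(2) by (simp add: c_def x_def flip: of_real_mult of_real_J0)
  have Jq: "J0 x = of_real (J0 q)" "J0 x \<noteq> 0" using q(3) by (simp_all add: x_def flip: of_real_J0)
  have K: "zJ0' (c * x) \<noteq> 0"
    using zJ0'_nonzero[of "s * q"] q s by (simp add: c_def x_def flip: of_real_mult of_real_zJ0')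
  have val: "radial_det s \<eta> x = zJ0' (c * x) * J0 x"
    using Jx by (simp add: radial_det_def c_def)
  then show "radial_det s \<eta> (of_real q) \<noteq> 0" using K Jq by (simp add: x_def)
  have D1: "deriv (radial_det s \<eta>) x = - e / x * radial_det s \<eta> x"
    using DERIV_imp_deriv[OF d1[OF x0(1)]] Jx by (simp add: val R_def)
  have "deriv (deriv (radial_det s \<eta>)) x =
      deriv (\<lambda>z. (1 - c\<^sup>2) * z * (J0 z * J0 (c * z)) - e / z * R z) x"
    by (rule deriv_cong_open[of "- {0}"]) (use x0 DERIV_imp_deriv[OF d1] in auto)
  also have "\<dots> = (1 - c\<^sup>2) * (J0 x * zJ0' (c * x)) + e / x\<^sup>2 * (J0 x * zJ0' (c * x))
      - e / x * (2 * zJ0' x * zJ0' (c * x) / x)"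
    unfolding R_def
    by (rule DERIV_imp_deriv)
       (auto intro!: derivative_eq_intros J0_deriv[OF x0(1)] zJ0'_deriv J0_deriv_scaled[OF x0(2,1)]
        zJ0'_deriv_scaled simp: x0 Jx, simp add: x0 field_simps power2_eq_square)
  finally have D2: "deriv (deriv (radial_det s \<eta>)) x = (1 - c\<^sup>2) * (J0 x * zJ0' (c * x))
      + e / x\<^sup>2 * (J0 x * zJ0' (c * x)) - e / x * (2 * zJ0' x * zJ0' (c * x) / x)" .
  have "logderiv2 (radial_det s \<eta>) x = (1 - c\<^sup>2) + e / x\<^sup>2 - 2 * e * (zJ0' x / (x * J0 x)) / x - (e / x)\<^sup>2"
    unfolding logderiv2_def D1 D2 using K Jq(2) x0
    by (simp add: val divide_simps) (simp add: algebra_simps power2_eq_square)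
  also have "\<dots> = of_real (1 - s\<^sup>2 - 2 * \<eta> * (zJ0' q / (q * J0 q)) / q + (\<eta> - \<eta>\<^sup>2) / q\<^sup>2)"
    using q by (simp add: c_def e_def x_def power_divide diff_divide_distrib flip: of_real_J0 of_real_zJ0')
  finally show "Re (logderiv2 (radial_det s \<eta>) (of_real q)) =
       1 - s\<^sup>2 - 2 * \<eta> * (zJ0' q / (q * J0 q)) / q + (\<eta> - \<eta>\<^sup>2) / q\<^sup>2"
    unfolding x_def by (metis Re_complex_of_real)
qed

lemma infinite_nonreal_zeros_radial_det_lt_1:
  fixes s :: real
  assumes s: "0 < s" "s < 1"
  shows "\<exists>\<eta>0>0. \<forall>\<eta>. \<bar>\<eta>\<bar> < \<eta>0 \<longrightarrow> infinite {z. radial_det s \<eta> z = 0 \<and> z \<notin> \<real>}"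
proof -
  obtain \<kappa> where \<kappa>: "\<kappa> > 0" "\<And>T. \<exists>j\<ge>T. j > 0 \<and> J0 j = 0 \<and> (\<forall>p>0. J0 p = 0 \<longrightarrow> \<bar>1 / s * j - p\<bar> > \<kappa> / j)"
    using dilated_J0_zeros_apart[of "1 / s"] s by auto
  define \<delta> where "\<delta> = 1 - s\<^sup>2"
  have "s\<^sup>2 < 1\<^sup>2" using s by (intro power_strict_mono) auto
  then have \<delta>: "\<delta> > 0" by (simp add: \<delta>_def)
  define \<eta>0 where "\<eta>0 = \<delta> * \<kappa> / (8 * s)"
  show ?thesis
  proof (intro exI[of _ \<eta>0] conjI allI impI)
    show "\<eta>0 > 0" using \<delta> \<kappa> s by (simp add: \<eta>0_def)
    fix \<eta> assume \<eta>: "\<bar>\<eta>\<bar> < \<eta>0"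
    show "infinite {z. radial_det s \<eta> z = 0 \<and> z \<notin> \<real>}"
    proof (rule infinite_nonreal_zeros[OF radial_det_holomorphic norm_radial_det_le])
      show "\<delta> / 2 > 0" using \<delta> by simp
      show "\<exists>x\<ge>T. radial_det s \<eta> (of_real x) \<noteq> 0 \<and> \<delta> / 2 \<le> Re (logderiv2 (radial_det s \<eta>) (of_real x))" for T
      proof -
        have "((\<lambda>q. (2 * \<bar>\<eta>\<bar> + \<eta>\<^sup>2) / q\<^sup>2) \<longlongrightarrow> 0) at_top" by real_asymp
        then have "\<forall>\<^sub>F q in at_top. (2 * \<bar>\<eta>\<bar> + \<eta>\<^sup>2) / q\<^sup>2 < \<delta> / 4"
          by (rule order_tendstoD(2)) (use \<delta> in simp)
        moreover have "\<forall>\<^sub>F q in at_top. \<kappa> / (s * q) < q" using s by real_asymp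
        ultimately have "\<forall>\<^sub>F q in at_top. (2 * \<bar>\<eta>\<bar> + \<eta>\<^sup>2) / q\<^sup>2 < \<delta> / 4 \<and> \<kappa> / (s * q) < q"
          by eventually_elim simp
        then obtain T1 where T1: "\<And>q. q \<ge> T1 \<Longrightarrow> (2 * \<bar>\<eta>\<bar> + \<eta>\<^sup>2) / q\<^sup>2 < \<delta> / 4 \<and> \<kappa> / (s * q) < q"
          unfolding eventually_at_top_linorder by blast
        define T2 where "T2 = max T T1"
        obtain j where j: "j \<ge> s * T2" "j > 0" "J0 j = 0"
          and far: "\<And>p. p > 0 \<Longrightarrow> J0 p = 0 \<Longrightarrow> \<bar>1 / s * j - p\<bar> > \<kappa> / j"
          using \<kappa>(2) by meson
        define q where "q = 1 / s * j"
        have q: "q > 0" "s * q = j" using j s by (auto simp: q_def)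
        have "q \<ge> T2" using j(1) s by (simp add: q_def field_simps)
        then have qT: "q \<ge> T" "q \<ge> T1" by (auto simp: T2_def)
        define M where "M = j / \<kappa>"
        have M: "M > 0" "1 / M = \<kappa> / j" using j \<kappa> by (auto simp: M_def)
        have Mq: "1 / M < q" using T1[OF qT(2)] q by (simp add: M)
        have flat: "\<bar>J0_liouville' q\<bar> < M * \<bar>J0_liouville q\<bar>"
        proof (rule ccontr)
          assume "\<not> ?thesis"
          then obtain p where "p > 0" "\<bar>p - q\<bar> \<le> 1 / M" "J0_liouville p = 0"
            using liouville_ode_steep[OF liouville_ode_J0 M(1) Mq] by auto
          then show False using far[of p] J0_liouville_eq_0_iff[of p] M(2)
            by (simp add: q_def abs_minus_commute)
        qed
        then have Jq: "J0 q \<noteq> 0" by (auto simp: J0_liouville_def)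
        define y where "y = zJ0' q / (q * J0 q)"
        have "J0_liouville' q = (y + 1 / (2 * q)) * J0_liouville q"
        proof -
          define r where "r = sqrt q"
          have r: "r > 0" "q = r\<^sup>2" "sqrt q = r" using q by (auto simp: r_def)
          show ?thesis
            unfolding y_def J0_liouville_def J0_liouville'_def r(3) using r(1) Jq
            by (simp add: r(2) field_simps power2_eq_square)
        qed
        then have "\<bar>y + 1 / (2 * q)\<bar> * \<bar>J0_liouville q\<bar> < M * \<bar>J0_liouville q\<bar>"
          using flat by (simp add: abs_mult)
        then have "\<bar>y + 1 / (2 * q)\<bar> < M" by (simp add: mult_less_cancel_right)
        moreover have "1 / (2 * q) > 0" using q by simp
        ultimately have y: "\<bar>y\<bar> \<le> M + 1 / (2 * q)" by linarith
        have "2 * \<eta> * y / q \<le> \<bar>2 * \<eta> * y / q\<bar>" by (rule abs_ge_self)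
        also have "\<dots> = 2 * \<bar>\<eta>\<bar> * \<bar>y\<bar> / q" using q by (simp add: abs_mult)
        also have "\<dots> \<le> 2 * \<bar>\<eta>\<bar> * (M + 1 / (2 * q)) / q"
          using y q by (intro divide_right_mono mult_left_mono) auto
        also have "\<dots> = 2 * \<bar>\<eta>\<bar> * s / \<kappa> + \<bar>\<eta>\<bar> / q\<^sup>2"
          using q \<kappa> unfolding M_def q(2)[symmetric] by (simp add: field_simps power2_eq_square)
        also have "2 * \<bar>\<eta>\<bar> * s / \<kappa> \<le> 2 * \<eta>0 * s / \<kappa>"
          using \<eta> s \<kappa> by (intro divide_right_mono mult_right_mono mult_left_mono) auto
        also have "2 * \<eta>0 * s / \<kappa> = \<delta> / 4" using s \<kappa> by (simp add: \<eta>0_def)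
        finally have A: "2 * \<eta> * y / q \<le> \<delta> / 4 + \<bar>\<eta>\<bar> / q\<^sup>2" by simp
        have "\<bar>\<eta>\<bar> / q\<^sup>2 - (2 * \<bar>\<eta>\<bar> + \<eta>\<^sup>2) / q\<^sup>2 \<le> (\<eta> - \<eta>\<^sup>2) / q\<^sup>2"
          unfolding diff_divide_distrib[symmetric] by (intro divide_right_mono) auto
        moreover have "(2 * \<bar>\<eta>\<bar> + \<eta>\<^sup>2) / q\<^sup>2 < \<delta> / 4" using T1[OF qT(2)] by simp
        ultimately have "\<delta> / 2 \<le> \<delta> - 2 * \<eta> * y / q + (\<eta> - \<eta>\<^sup>2) / q\<^sup>2"
          using A by argo
        then show ?thesis
          using logderiv2_radial_det[OF s(1) q(1) _ Jq, of \<eta>] q(2) j(3) qT(1)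
          by (intro exI[of _ q]) (simp add: \<delta>_def y_def)
      qed
    qed simp
  qed
qed

lemma infinite_nonreal_zeros_radial_det:
  fixes s :: real
  assumes s: "0 < s" "s \<noteq> 1"
  shows "\<exists>\<eta>0>0. \<forall>\<eta>. \<bar>\<eta>\<bar> < \<eta>0 \<longrightarrow> infinite {z. radial_det s \<eta> z = 0 \<and> z \<notin> \<real>}"
proof (cases "s < 1")
  case True
  then show ?thesis using infinite_nonreal_zeros_radial_det_lt_1 s by blast
next
  case False
  then have s1: "s > 1" using s by simp
  obtain \<eta>0 where \<eta>0: "\<eta>0 > 0" "\<And>\<eta>. \<bar>\<eta>\<bar> < \<eta>0 \<Longrightarrow> infinite {z. radial_det (1 / s) \<eta> z = 0 \<and> z \<notin> \<real>}"
    using infinite_nonreal_zeros_radial_det_lt_1[of "1 / s"] s1 by auto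
  have "infinite {z. radial_det s \<eta> z = 0 \<and> z \<notin> \<real>}" if "\<bar>\<eta>\<bar> < \<eta>0" for \<eta>
  proof
    assume "finite {z. radial_det s \<eta> z = 0 \<and> z \<notin> \<real>}"
    moreover have "{z. radial_det (1 / s) (- \<eta>) z = 0 \<and> z \<notin> \<real>} \<subseteq>
        (\<lambda>z. of_real s * z) ` {z. radial_det s \<eta> z = 0 \<and> z \<notin> \<real>}"
    proof
      fix z assume "z \<in> {z. radial_det (1 / s) (- \<eta>) z = 0 \<and> z \<notin> \<real>}"
      then have z: "radial_det (1 / s) (- \<eta>) z = 0" "z \<notin> \<real>" by auto
      have zs: "z = of_real s * (z / of_real s)" using s by simp
      have "radial_det s \<eta> (z / of_real s) = 0"
        using radial_det_inverse[OF s(1), of \<eta> "z / of_real s"] z zs by simp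
      moreover have "z / of_real s \<notin> \<real>"
        using z(2) zs Reals_mult[OF Reals_of_real] by metis
      ultimately show "z \<in> (\<lambda>z. of_real s * z) ` {z. radial_det s \<eta> z = 0 \<and> z \<notin> \<real>}"
        using zs by blast
    qed
    ultimately have "finite {z. radial_det (1 / s) (- \<eta>) z = 0 \<and> z \<notin> \<real>}"
      by (meson finite_imageI finite_subset)
    then show False using \<eta>0(2)[of "- \<eta>"] that by simp
  qed
  then show ?thesis using \<eta>0(1) by blast
qed

subsection \<open>Calculus of smooth functions\<close>

lemma partial_eq: "(f has_derivative f') (at x) \<Longrightarrow> partial i f x = f' i"
  unfolding partial_def by (metis frechet_derivative_at)

lemma C_k_Suc_imp: "C_k (Suc k) f \<Longrightarrow> C_k k f"
proof (induction k arbitrary: f)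
  case 0
  then show ?case
    by (auto intro!: continuous_at_imp_continuous_on differentiable_imp_continuous_within)
next
  case (Suc k)
  then show ?case by (metis C_k.simps(2))
qed

lemma C_k_continuous: "C_k k f \<Longrightarrow> continuous_on UNIV f"
  by (induction k) (use C_k_Suc_imp in auto)

lemma partial_const [simp]: "partial i (\<lambda>x. c) = (\<lambda>x. 0)"
  by (auto simp: fun_eq_iff intro!: partial_eq[where f' = "\<lambda>_. 0", THEN trans])

lemma C_k_const: "C_k k (\<lambda>x. c)"
  by (induction k arbitrary: c) auto

lemma partial_add:
  assumes "f differentiable (at x)" "g differentiable (at x)"
  shows "partial i (\<lambda>x. f x + g x) x = partial i f x + partial i g x"
proof -
  obtain f' g' where "(f has_derivative f') (at x)" "(g has_derivative g') (at x)"
    using assms by (auto simp: differentiable_def)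
  then show ?thesis
    using partial_eq[OF has_derivative_add] partial_eq by metis
qed

lemma partial_mult:
  assumes "f differentiable (at x)" "g differentiable (at x)"
  shows "partial i (\<lambda>x. f x * g x) x = partial i f x * g x + f x * partial i g x"
proof -
  obtain f' g' where d: "(f has_derivative f') (at x)" "(g has_derivative g') (at x)"
    using assms by (auto simp: differentiable_def)
  show ?thesis
    unfolding partial_eq[OF has_derivative_mult[OF d]] partial_eq[OF d(1)] partial_eq[OF d(2)]
    by simp
qed

lemma C_k_add: "C_k k f \<Longrightarrow> C_k k g \<Longrightarrow> C_k k (\<lambda>x. f x + g x)"
proof (induction k arbitrary: f g)
  case 0
  then show ?case by (auto intro!: continuous_intros)
next
  case (Suc k)
  then have "partial i (\<lambda>x. f x + g x) = (\<lambda>x. partial i f x + partial i g x)" for i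
    by (auto simp: partial_add)
  then show ?case using Suc by auto
qed

lemma C_k_mult: "C_k k f \<Longrightarrow> C_k k g \<Longrightarrow> C_k k (\<lambda>x. f x * g x)"
proof (induction k arbitrary: f g)
  case 0
  then show ?case by (auto intro!: continuous_intros)
next
  case (Suc k)
  then have "partial i (\<lambda>x. f x * g x) = (\<lambda>x. partial i f x * g x + f x * partial i g x)" for i
    by (auto simp: partial_mult)
  moreover have "C_k k f" "C_k k g" using Suc.prems C_k_Suc_imp by auto
  ultimately show ?case using Suc by (auto intro!: C_k_add)
qed

lemma partial_coord: "partial i (\<lambda>x. of_real (x \<bullet> b)) x = of_real (i \<bullet> b)"
  by (rule partial_eq) (auto intro!: derivative_eq_intros)

lemma C_k_coord: "C_k k (\<lambda>x. of_real (x \<bullet> b))"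
proof (cases k)
  case 0
  then show ?thesis by (auto intro!: continuous_intros)
next
  case (Suc l)
  have "(\<lambda>x. complex_of_real (x \<bullet> b)) differentiable (at x)" for x :: 'a
    unfolding differentiable_def by (rule exI) (auto intro!: derivative_eq_intros)
  moreover have "partial i (\<lambda>x. complex_of_real (x \<bullet> b)) = (\<lambda>x. of_real (i \<bullet> b))" for i :: 'a
    by (auto simp: partial_coord)
  ultimately show ?thesis by (simp add: Suc C_k_const)
qed

lemma smooth_C_k: "smooth f \<Longrightarrow> C_k k f"
  by (simp add: smooth_def)

lemma smooth_continuous: "smooth f \<Longrightarrow> continuous_on A f"
  using C_k_continuous[OF smooth_C_k, of f] continuous_on_subset by blast

lemma smooth_differentiable: "smooth f \<Longrightarrow> f differentiable (at x)"
  using smooth_C_k[of f 1] by simp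

lemma smooth_partial: "smooth f \<Longrightarrow> i \<in> Basis \<Longrightarrow> smooth (partial i f)"
  unfolding smooth_def by (metis C_k.simps(2))

lemma smooth_const: "smooth (\<lambda>x. c)"
  by (simp add: smooth_def C_k_const)

lemma smooth_coord: "smooth (\<lambda>x. of_real (x \<bullet> b))"
  by (simp add: smooth_def C_k_coord)

lemma smooth_add: "smooth f \<Longrightarrow> smooth g \<Longrightarrow> smooth (\<lambda>x. f x + g x)"
  by (simp add: smooth_def C_k_add)

lemma smooth_mult: "smooth f \<Longrightarrow> smooth g \<Longrightarrow> smooth (\<lambda>x. f x * g x)"
  by (simp add: smooth_def C_k_mult)

lemma smooth_diff: "smooth f \<Longrightarrow> smooth g \<Longrightarrow> smooth (\<lambda>x. f x - g x)"
  using smooth_add[OF _ smooth_mult[OF smooth_const[of "-1"]], of f g] by simp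

lemma partial_smooth_mult:
  assumes "smooth f" "smooth g"
  shows "partial i (\<lambda>x. f x * g x) = (\<lambda>x. partial i f x * g x + f x * partial i g x)"
  using assms by (auto simp: partial_mult smooth_differentiable)

lemma has_derivative_radial:
  fixes h :: "real \<Rightarrow> complex"
  assumes "\<And>t. (h has_vector_derivative h' t) (at t)"
  shows "((\<lambda>x. h (x \<bullet> x)) has_derivative (\<lambda>v. of_real (2 * (x \<bullet> v)) * h' (x \<bullet> x))) (at x)"
proof -
  have "((\<lambda>x. x \<bullet> x) has_derivative (\<lambda>v. 2 * (x \<bullet> v))) (at x)"
    by (auto intro!: derivative_eq_intros simp: inner_commute)
  from has_derivative_compose[OF this, of h "\<lambda>t. t *\<^sub>R h' (x \<bullet> x)"] assms
  show ?thesis by (simp add: has_vector_derivative_def scaleR_conv_of_real)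
qed

lemma partial_radial:
  fixes h :: "real \<Rightarrow> complex"
  assumes "\<And>t. (h has_vector_derivative h' t) (at t)"
  shows "partial i (\<lambda>x. h (x \<bullet> x)) = (\<lambda>x. 2 * of_real (x \<bullet> i) * h' (x \<bullet> x))"
  using partial_eq[OF has_derivative_radial[of h h', OF assms]] by auto

lemma smooth_radial:
  fixes H :: "(real \<Rightarrow> complex) set"
  assumes H: "\<And>h. h \<in> H \<Longrightarrow> \<exists>h'\<in>H. \<forall>t. (h has_vector_derivative h' t) (at t)" and h: "h \<in> H"
  shows "smooth (\<lambda>x. h (x \<bullet> x))"
proof -
  have "C_k k (\<lambda>x. h (x \<bullet> x))" if "h \<in> H" for k h
    using that
  proof (induction k arbitrary: h)
    case 0
    obtain h' where "\<And>t. (h has_vector_derivative h' t) (at t)" using H[OF 0] by blast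
    then have "continuous_on UNIV h"
      by (intro continuous_at_imp_continuous_on ballI has_vector_derivative_continuous)
    then show ?case
      by (auto intro!: continuous_on_compose2[of UNIV h] continuous_intros)
  next
    case (Suc k)
    obtain h' where h': "h' \<in> H" "\<And>t. (h has_vector_derivative h' t) (at t)" using H[OF Suc.prems] by blast
    have "(\<lambda>x. h (x \<bullet> x)) differentiable (at x)" for x :: 'b
      using has_derivative_radial[of h h', OF h'(2)] unfolding differentiable_def by blast
    then show ?case
      by (auto simp: partial_radial[of h h', OF h'(2)] intro!: C_k_mult C_k_const C_k_coord Suc.IH h')
  qed
  then show ?thesis using h by (auto simp: smooth_def)
qed

subsection \<open>Integration by parts\<close>

lemma integrable_continuous_compact_support:
  fixes f :: "'a::euclidean_space \<Rightarrow> complex"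
  assumes "continuous_on UNIV f" "compact K" "\<And>x. x \<notin> K \<Longrightarrow> f x = 0"
  shows "integrable lborel f"
proof -
  have "integrable lborel (\<lambda>x. indicator K x *\<^sub>R f x)"
    using assms by (intro borel_integrable_compact) (auto intro: continuous_on_subset)
  also have "(\<lambda>x. indicator K x *\<^sub>R f x) = f" using assms(3) by (auto simp: fun_eq_iff indicator_def)
  finally show ?thesis .
qed

lemma partial_outside_support:
  assumes "compact K" "\<And>x. x \<notin> K \<Longrightarrow> f x = 0" "x \<notin> K"
  shows "partial i f x = 0"
proof -
  have "((\<lambda>x. 0) has_derivative (\<lambda>v. 0)) (at x)" by simp
  then have "(f has_derivative (\<lambda>v. 0)) (at x)"
    by (rule has_derivative_transform_within_open[where s = "- K"])
       (use assms compact_imp_closed in \<open>auto simp: open_Compl\<close>)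
  then show ?thesis by (rule partial_eq)
qed

lemma integral_partial_eq_0:
  fixes \<psi> :: "'a::euclidean_space \<Rightarrow> complex"
  assumes \<psi>: "C_k 1 \<psi>" and K: "compact K" "\<And>x. x \<notin> K \<Longrightarrow> \<psi> x = 0" and i: "i \<in> Basis"
  shows "(LINT x|lborel. partial i \<psi> x) = 0"
proof -
  have cont: "continuous_on UNIV \<psi>" "continuous_on UNIV (partial i \<psi>)"
    using C_k_continuous[OF \<psi>] \<psi> i by auto
  have supp: "partial i \<psi> x = 0" if "x \<notin> K" for x
    by (rule partial_outside_support[of K \<psi>]) (use K that in auto)
  have "bounded (partial i \<psi> ` K)"
    using K(1) cont(2) by (intro compact_imp_bounded compact_continuous_image) (auto intro: continuous_on_subset)
  then obtain B0 where B0: "\<And>x. x \<in> K \<Longrightarrow> norm (partial i \<psi> x) \<le> B0" by (auto simp: bounded_iff)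
  define B where "B = max B0 0"
  have B: "norm (partial i \<psi> x) \<le> B" for x
    using B0[of x] supp[of x] by (cases "x \<in> K") (auto simp: B_def)
  obtain R where R: "\<And>x. x \<in> K \<Longrightarrow> norm x \<le> R" using compact_imp_bounded[OF K(1)] by (auto simp: bounded_iff)
  define t where "t n = 1 / (real n + 1)" for n
  have t: "0 < t n" "t n \<le> 1" for n by (auto simp: t_def)
  define g where "g n x = (\<psi> (t n *\<^sub>R i + x) - \<psi> x) / of_real (t n)" for n x
  have line: "((\<lambda>s. \<psi> (s *\<^sub>R i + x)) has_derivative (\<lambda>h. h *\<^sub>R partial i \<psi> (s *\<^sub>R i + x))) (at s)" for s x
  proof -
    have d: "(\<psi> has_derivative frechet_derivative \<psi> (at (s *\<^sub>R i + x))) (at (s *\<^sub>R i + x))"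
      using \<psi> by (simp add: frechet_derivative_works)
    have "((\<lambda>s. s *\<^sub>R i + x) has_derivative (\<lambda>h. h *\<^sub>R i)) (at s)" by (auto intro!: derivative_eq_intros)
    from has_derivative_compose[OF this d]
    show ?thesis
      by (simp add: partial_def linear_scale[OF has_derivative_linear[OF d]])
  qed
  have lim: "(\<lambda>n. g n x) \<longlonglongrightarrow> partial i \<psi> x" for x
  proof -
    have A: "((\<lambda>s. norm (\<psi> (s *\<^sub>R i + x) - \<psi> x - s *\<^sub>R partial i \<psi> x) / norm s) \<longlongrightarrow> 0) (at 0)"
      using line[of x 0] by (simp add: has_derivative_at)
    have eq: "norm (\<psi> (s *\<^sub>R i + x) - \<psi> x - s *\<^sub>R partial i \<psi> x) / norm s =
        norm ((\<psi> (s *\<^sub>R i + x) - \<psi> x) /\<^sub>R s - partial i \<psi> x)" if "s \<noteq> 0" for s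
    proof -
      have "\<psi> (s *\<^sub>R i + x) - \<psi> x - s *\<^sub>R partial i \<psi> x =
          s *\<^sub>R ((\<psi> (s *\<^sub>R i + x) - \<psi> x) /\<^sub>R s - partial i \<psi> x)"
        using that by (simp add: scaleR_diff_right)
      then show ?thesis using that by simp
    qed
    have "((\<lambda>s. norm ((\<psi> (s *\<^sub>R i + x) - \<psi> x) /\<^sub>R s - partial i \<psi> x)) \<longlongrightarrow> 0) (at 0)"
      by (rule Lim_transform_within[OF A zero_less_one]) (rule eq, auto)
    then have "((\<lambda>s. (\<psi> (s *\<^sub>R i + x) - \<psi> x) /\<^sub>R s) \<longlongrightarrow> partial i \<psi> x) (at 0)"
      by (rule LIM_zero_cancel[OF tendsto_norm_zero_cancel])
    moreover have "filterlim t (at 0) sequentially"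
      unfolding t_def by real_asymp
    ultimately have "(\<lambda>n. (\<psi> (t n *\<^sub>R i + x) - \<psi> x) /\<^sub>R t n) \<longlonglongrightarrow> partial i \<psi> x"
      by (rule filterlim_compose)
    then show ?thesis by (simp add: g_def scaleR_conv_of_real divide_inverse mult.commute)
  qed
  have bound: "norm (g n x) \<le> B" for n x
  proof -
    have "continuous_on {0..t n} (\<lambda>s. \<psi> (s *\<^sub>R i + x))"
      by (intro continuous_on_compose2[OF cont(1)] continuous_intros) auto
    from mvt_general[OF t(1) this line]
    obtain s where "norm (\<psi> (t n *\<^sub>R i + x) - \<psi> (0 *\<^sub>R i + x)) \<le> norm ((t n - 0) *\<^sub>R partial i \<psi> (s *\<^sub>R i + x))"
      by blast
    also have "\<dots> \<le> t n * B"
      using t(1)[of n] B[of "s *\<^sub>R i + x"] by (simp add: mult_left_mono less_imp_le)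
    finally have "norm (\<psi> (t n *\<^sub>R i + x) - \<psi> x) \<le> t n * B" by simp
    then show ?thesis using t[of n] by (simp add: g_def norm_divide field_simps)
  qed
  have g0: "g n x = 0" if "x \<notin> cball 0 (R + 1)" for n x
  proof -
    have "t n *\<^sub>R i + x \<notin> K"
    proof
      assume "t n *\<^sub>R i + x \<in> K"
      then have "norm (t n *\<^sub>R i + x) \<le> R" by (rule R)
      moreover have "norm x \<le> norm (t n *\<^sub>R i + x) + norm (t n *\<^sub>R i)"
        using norm_triangle_ineq4[of "t n *\<^sub>R i + x" "t n *\<^sub>R i"] by simp
      ultimately show False using that t[of n] i by simp
    qed
    moreover have "x \<notin> K" using R[of x] that by auto
    ultimately show ?thesis by (simp add: g_def K(2))
  qed
  have trans: "(LINT x|lborel. \<psi> (c + x)) = (LINT x|lborel. \<psi> x)" for c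
  proof -
    have "(LINT x|lborel. \<psi> x) = (LINT x|distr lborel borel ((+) c). \<psi> x)" by (simp add: lborel_distr_plus)
    also have "\<dots> = (LINT x|lborel. \<psi> (c + x))"
      using borel_measurable_continuous_onI[OF cont(1)] by (intro integral_distr) auto
    finally show ?thesis by simp
  qed
  have int: "integrable lborel \<psi>" by (rule integrable_continuous_compact_support[OF cont(1) K])
  have int': "integrable lborel (\<lambda>x. \<psi> (c + x))" for c
    by (rule integrable_continuous_compact_support[where K = "(\<lambda>x. x - c) ` K"])
       (use K cont in \<open>auto intro!: continuous_on_compose2[OF cont(1)] compact_continuous_image continuous_intros
         simp: image_iff algebra_simps\<close>)
  have "(LINT x|lborel. g n x) = 0" for n
    unfolding g_def using int int' trans by simp
  moreover have "(\<lambda>n. LINT x|lborel. g n x) \<longlonglongrightarrow> (LINT x|lborel. partial i \<psi> x)"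
  proof (rule integral_dominated_convergence[where w = "\<lambda>x. B * indicator (cball 0 (R + 1)) x"])
    show "partial i \<psi> \<in> borel_measurable lborel" using borel_measurable_continuous_onI[OF cont(2)] by simp
    show "g n \<in> borel_measurable lborel" for n
      unfolding g_def using borel_measurable_integrable[OF int] borel_measurable_integrable[OF int'] by measurable
    show "integrable lborel (\<lambda>x. B * indicator (cball 0 (R + 1)) x :: real)"
      using emeasure_lborel_cball_finite[of 0 "R + 1"]
      by (auto intro!: integrable_mult_right integrable_real_indicator)
    show "AE x in lborel. norm (g n x) \<le> B * indicator (cball 0 (R + 1)) x" for n
      using bound[of n] g0[of _ n] by (intro AE_I2) (auto simp: indicator_def)
  qed (use lim in auto)
  ultimately show ?thesis by (simp add: LIMSEQ_const_iff)
qed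

subsection \<open>Convergence in \<open>L\<^sup>2\<close>\<close>

lemma L2_times_integrable:
  assumes "L2 M f" "L2 M g"
  shows "integrable M (\<lambda>x. f x * g x)"
proof (rule Bochner_Integration.integrable_bound[where f = "\<lambda>x. (norm (f x))\<^sup>2 + (norm (g x))\<^sup>2"])
  show "AE x in M. norm (f x * g x) \<le> norm ((norm (f x))\<^sup>2 + (norm (g x))\<^sup>2)"
  proof (intro AE_I2)
    fix x
    have "0 \<le> (norm (f x) - norm (g x))\<^sup>2 + (norm (f x))\<^sup>2 + (norm (g x))\<^sup>2" by simp
    then show "norm (f x * g x) \<le> norm ((norm (f x))\<^sup>2 + (norm (g x))\<^sup>2)"
      by (simp add: power2_diff norm_mult)
  qed
qed (use assms in \<open>auto simp: L2_def\<close>)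

lemma L2_add:
  assumes "L2 M f" "L2 M g"
  shows "L2 M (\<lambda>x. f x + g x)"
  unfolding L2_def
proof
  show [measurable]: "(\<lambda>x. f x + g x) \<in> borel_measurable M" using assms by (auto simp: L2_def)
  show "integrable M (\<lambda>x. (norm (f x + g x))\<^sup>2)"
  proof (rule Bochner_Integration.integrable_bound[where f = "\<lambda>x. 2 * ((norm (f x))\<^sup>2 + (norm (g x))\<^sup>2)"])
    show "AE x in M. norm ((norm (f x + g x))\<^sup>2) \<le> norm (2 * ((norm (f x))\<^sup>2 + (norm (g x))\<^sup>2))"
    proof (intro AE_I2)
      fix x
      have "(norm (f x + g x))\<^sup>2 \<le> (norm (f x) + norm (g x))\<^sup>2" by (intro power_mono norm_triangle_ineq) auto
      moreover have "0 \<le> (norm (f x) - norm (g x))\<^sup>2" by simp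
      ultimately show "norm ((norm (f x + g x))\<^sup>2) \<le> norm (2 * ((norm (f x))\<^sup>2 + (norm (g x))\<^sup>2))"
        by (simp add: power2_sum power2_diff)
    qed
  qed (use assms in \<open>auto simp: L2_def\<close>)
qed

lemma L2_cmult: "L2 M f \<Longrightarrow> L2 M (\<lambda>x. c * f x)"
  by (auto simp: L2_def norm_mult power_mult_distrib)

lemma L2_diff: "L2 M f \<Longrightarrow> L2 M g \<Longrightarrow> L2 M (\<lambda>x. f x - g x)"
  using L2_add[OF _ L2_cmult[of M g "-1"], of f] by simp

lemma L2_sum: "(\<And>i. i \<in> I \<Longrightarrow> L2 M (f i)) \<Longrightarrow> L2 M (\<lambda>x. \<Sum>i\<in>I. f i x)"
  by (induction I rule: infinite_finite_induct) (auto intro: L2_add simp: L2_def[of _ "\<lambda>x. 0"])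

lemma L2_bounded:
  assumes "finite_measure M" "f \<in> borel_measurable M" "\<And>x. x \<in> space M \<Longrightarrow> norm (f x) \<le> C"
  shows "L2 M f"
  unfolding L2_def
proof
  interpret finite_measure M by fact
  have [measurable]: "f \<in> borel_measurable M" by fact
  show "integrable M (\<lambda>x. (norm (f x))\<^sup>2)"
  proof (rule integrable_const_bound[where B = "C\<^sup>2"])
    show "AE x in M. norm ((norm (f x))\<^sup>2) \<le> C\<^sup>2"
      using assms(3) by (intro AE_I2) (auto intro: power_mono)
  qed measurable
qed fact

lemma L2_tendsto_const: "L2 M f \<Longrightarrow> L2_tendsto M (\<lambda>_. f) f"
  by (simp add: L2_tendsto_def)

lemma L2_tendsto_bounded:
  assumes M: "finite_measure M" and meas: "\<And>m. F m \<in> borel_measurable M" "f \<in> borel_measurable M"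
    and C: "\<And>m x. x \<in> space M \<Longrightarrow> norm (F m x) \<le> C"
    and lim: "\<And>x. x \<in> space M \<Longrightarrow> (\<lambda>m. F m x) \<longlonglongrightarrow> f x"
  shows "L2_tendsto M F f"
proof -
  interpret finite_measure M by fact
  note [measurable] = meas
  have C': "norm (f x) \<le> C" if "x \<in> space M" for x
    by (rule LIMSEQ_le_const2[OF tendsto_norm[OF lim[OF that]]]) (use C that in auto)
  have "(\<lambda>m. LINT x|M. (norm (F m x - f x))\<^sup>2) \<longlonglongrightarrow> (LINT x|M. 0)"
  proof (rule integral_dominated_convergence[where w = "\<lambda>x. (2 * C)\<^sup>2"])
    show "AE x in M. (\<lambda>m. (norm (F m x - f x))\<^sup>2) \<longlonglongrightarrow> 0"
    proof (intro AE_I2)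
      fix x assume "x \<in> space M"
      from tendsto_power[OF tendsto_norm[OF LIM_zero[OF lim[OF this]]], of 2]
      show "(\<lambda>m. (norm (F m x - f x))\<^sup>2) \<longlonglongrightarrow> 0" by simp
    qed
    show "AE x in M. norm ((norm (F m x - f x))\<^sup>2) \<le> (2 * C)\<^sup>2" for m
    proof (intro AE_I2)
      fix x assume x: "x \<in> space M"
      have "norm (F m x - f x) \<le> 2 * C"
        using norm_triangle_ineq4[of "F m x" "f x"] C[OF x, of m] C'[OF x] by linarith
      then have "(norm (F m x - f x))\<^sup>2 \<le> (2 * C)\<^sup>2" by (intro power_mono) auto
      then show "norm ((norm (F m x - f x))\<^sup>2) \<le> (2 * C)\<^sup>2" by simp
    qed
  qed auto
  then show ?thesis
    unfolding L2_tendsto_def using L2_bounded[OF M meas(1) C] L2_bounded[OF M meas(2) C'] by auto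
qed

lemma L2_tendsto_integral:
  assumes F: "L2_tendsto M F f" and g: "L2 M g"
  shows "(\<lambda>m. LINT x|M. F m x * g x) \<longlonglongrightarrow> (LINT x|M. f x * g x)"
proof (rule LIMSEQ_I)
  fix r :: real assume r: "r > 0"
  define G where "G = (LINT x|M. (norm (g x))\<^sup>2)"
  define a where "a m = (LINT x|M. (norm (F m x - f x))\<^sup>2)" for m
  have G: "G \<ge> 0" by (simp add: G_def)
  define e where "e = r / (2 * (G + 1))"
  have e: "e > 0" using r G by (simp add: e_def)
  have eG: "e * G < r / 2" using r G by (simp add: e_def field_simps)
  have "a \<longlonglongrightarrow> 0" using F by (simp add: L2_tendsto_def a_def[abs_def])
  then obtain N where N: "\<And>m. m \<ge> N \<Longrightarrow> a m < e * r / 2"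
    using order_tendstoD(2)[of a 0 sequentially "e * r / 2"] e r by (auto simp: eventually_sequentially)
  have L: "L2 M (F m)" "L2 M f" "L2 M (\<lambda>x. F m x - f x)" for m
    using F L2_diff by (auto simp: L2_tendsto_def)
  show "\<exists>N. \<forall>m\<ge>N. norm ((LINT x|M. F m x * g x) - (LINT x|M. f x * g x)) < r"
  proof (intro exI[of _ N] allI impI)
    fix m assume m: "m \<ge> N"
    have "(LINT x|M. F m x * g x) - (LINT x|M. f x * g x) = (LINT x|M. (F m x - f x) * g x)"
      using L2_times_integrable[OF L(1) g] L2_times_integrable[OF L(2) g]
      by (simp add: left_diff_distrib)
    also have "norm \<dots> \<le> (LINT x|M. norm ((F m x - f x) * g x))" by (rule integral_norm_bound)
    also have "\<dots> \<le> (LINT x|M. (norm (F m x - f x))\<^sup>2 / e + e * (norm (g x))\<^sup>2)"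
    proof (rule integral_mono)
      show "integrable M (\<lambda>x. norm ((F m x - f x) * g x))"
        using L2_times_integrable[OF L(3) g] by (rule integrable_norm)
      show "integrable M (\<lambda>x. (norm (F m x - f x))\<^sup>2 / e + e * (norm (g x))\<^sup>2)"
        using L(3)[of m] g by (auto simp: L2_def)
      fix x
      define b c where "b = norm (F m x - f x)" and "c = norm (g x)"
      have "0 \<le> (b - e * c)\<^sup>2 + b\<^sup>2 + (e * c)\<^sup>2" by simp
      then have "b * c * e \<le> b\<^sup>2 + e * c\<^sup>2 * e" by (simp add: power2_eq_square algebra_simps)
      then have "b * c \<le> b\<^sup>2 / e + e * c\<^sup>2" using e by (simp add: field_simps)
      then show "norm ((F m x - f x) * g x) \<le> (norm (F m x - f x))\<^sup>2 / e + e * (norm (g x))\<^sup>2"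
        by (simp add: norm_mult b_def c_def)
    qed
    also have "\<dots> = a m / e + e * G"
      using L(3)[of m] g by (simp add: L2_def a_def G_def)
    also have "\<dots> < r"
    proof -
      have "a m / e < r / 2" using N[OF m] e by (simp add: field_simps)
      then show ?thesis using eG by linarith
    qed
    finally show "norm ((LINT x|M. F m x * g x) - (LINT x|M. f x * g x)) < r" .
  qed
qed

subsection \<open>Smooth functions on a bounded open set\<close>

lemma smooth_sum: "(\<And>i. i \<in> I \<Longrightarrow> smooth (f i)) \<Longrightarrow> smooth (\<lambda>x. \<Sum>i\<in>I. f i x)"
  by (induction I rule: infinite_finite_induct) (auto intro: smooth_add smooth_const)

lemma test_function_smooth: "test_function D \<phi> \<Longrightarrow> smooth \<phi>"
  by (simp add: test_function_def)

lemma test_function_mult: "smooth f \<Longrightarrow> test_function D \<phi> \<Longrightarrow> test_function D (\<lambda>x. f x * \<phi> x)"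
  unfolding test_function_def by (metis mult_zero_right smooth_mult)

lemma test_function_partial:
  assumes "test_function D \<phi>" "i \<in> Basis" shows "test_function D (partial i \<phi>)"
proof -
  obtain K where K: "compact K" "K \<subseteq> D" "\<And>x. x \<notin> K \<Longrightarrow> \<phi> x = 0"
    using assms by (auto simp: test_function_def)
  then have "\<forall>x. x \<notin> K \<longrightarrow> partial i \<phi> x = 0"
    by (auto intro: partial_outside_support[of K \<phi>])
  with K(1,2) show ?thesis
    using smooth_partial[of \<phi> i] assms unfolding test_function_def by blast
qed

context
  fixes D :: "'a::euclidean_space set"
  assumes D: "open D" "bounded D"
begin

lemma finite_measure_domain: "finite_measure (lebesgue_on D)"
  by (intro finite_measure_lebesgue_on lmeasurable_open D)

lemma continuous_measurable_domain:
  "continuous_on UNIV f \<Longrightarrow> f \<in> borel_measurable (lebesgue_on D)"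
  using D by (intro continuous_imp_measurable_on_sets_lebesgue) (auto intro: continuous_on_subset)

lemma continuous_bounded_domain:
  fixes f :: "'a \<Rightarrow> 'b::real_normed_vector"
  assumes "continuous_on UNIV f"
  obtains C where "C \<ge> 0" "\<And>x. x \<in> D \<Longrightarrow> norm (f x) \<le> C"
proof -
  have "compact (f ` closure D)"
    using D assms by (intro compact_continuous_image) (auto intro: continuous_on_subset)
  from compact_imp_bounded[OF this]
  obtain C where C: "\<And>x. x \<in> closure D \<Longrightarrow> norm (f x) \<le> C"
    by (auto simp: bounded_iff)
  show ?thesis
    by (rule that[of "max C 0"]) (use C closure_subset in fastforce)+
qed

lemma L2_continuous:
  assumes "continuous_on UNIV f" shows "L2 (lebesgue_on D) f"
proof -
  obtain C where "\<And>x. x \<in> D \<Longrightarrow> norm (f x) \<le> C" using continuous_bounded_domain[OF assms] by blast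
  then show ?thesis
    by (intro L2_bounded[OF finite_measure_domain continuous_measurable_domain[OF assms]]) auto
qed

lemma integral_domain_eq_lborel:
  fixes f :: "'a \<Rightarrow> 'b::{banach,second_countable_topology}"
  assumes f: "continuous_on UNIV f" and z: "\<And>x. x \<notin> D \<Longrightarrow> f x = 0"
  shows "(LINT x|lebesgue_on D. f x) = (LINT x|lborel. f x)"
proof -
  have "(LINT x|lebesgue_on D. f x) = (LINT x|lebesgue. indicator D x *\<^sub>R f x)"
    using D by (intro integral_restrict_space) auto
  also have "(\<lambda>x. indicator D x *\<^sub>R f x) = f" using z by (auto simp: fun_eq_iff indicator_def)
  also have "(LINT x|lebesgue. f x) = (LINT x|lborel. f x)"
    using borel_measurable_continuous_onI[OF f] by (intro integral_completion) simp
  finally show ?thesis .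
qed

lemma integral_partial_test_function:
  assumes "test_function D \<psi>" "i \<in> Basis"
  shows "(LINT x|lebesgue_on D. partial i \<psi> x) = 0"
proof -
  obtain K where K: "compact K" "K \<subseteq> D" "\<And>x. x \<notin> K \<Longrightarrow> \<psi> x = 0"
    using assms by (auto simp: test_function_def)
  have "(LINT x|lebesgue_on D. partial i \<psi> x) = (LINT x|lborel. partial i \<psi> x)"
  proof (rule integral_domain_eq_lborel)
    show "continuous_on UNIV (partial i \<psi>)"
      by (rule smooth_continuous[OF test_function_smooth[OF test_function_partial[OF assms]]])
    show "partial i \<psi> x = 0" if "x \<notin> D" for x
      by (rule partial_outside_support[of K \<psi>]) (use K that in auto)
  qed
  also have "\<dots> = 0"
    by (rule integral_partial_eq_0[OF smooth_C_k[OF test_function_smooth[OF assms(1)]] K(1,3) assms(2)])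
  finally show ?thesis .
qed

lemma integral_by_parts:
  assumes f: "smooth f" and \<phi>: "test_function D \<phi>" and i: "i \<in> Basis"
  shows "(LINT x|lebesgue_on D. f x * partial i \<phi> x) = - (LINT x|lebesgue_on D. partial i f x * \<phi> x)"
proof -
  note s = test_function_smooth[OF \<phi>]
  have L: "L2 (lebesgue_on D) f" "L2 (lebesgue_on D) \<phi>" "L2 (lebesgue_on D) (partial i f)"
    "L2 (lebesgue_on D) (partial i \<phi>)"
    using f s i by (auto intro!: L2_continuous smooth_continuous smooth_partial)
  have "0 = (LINT x|lebesgue_on D. partial i (\<lambda>x. f x * \<phi> x) x)"
    using integral_partial_test_function[OF test_function_mult[OF f \<phi>] i] by simp
  also have "\<dots> = (LINT x|lebesgue_on D. partial i f x * \<phi> x) + (LINT x|lebesgue_on D. f x * partial i \<phi> x)"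
    unfolding partial_smooth_mult[OF f s]
    by (intro Bochner_Integration.integral_add L2_times_integrable L)
  finally show ?thesis by (simp add: eq_neg_iff_add_eq_0 add.commute)
qed

lemma weak_partial_smooth:
  assumes "smooth f" "i \<in> Basis" shows "weak_partial D i f (partial i f)"
  unfolding weak_partial_def
  using assms by (auto intro!: L2_continuous smooth_continuous smooth_partial integral_by_parts)

lemma H_k_smooth: "smooth f \<Longrightarrow> H_k k D f"
proof (induction k arbitrary: f)
  case 0
  then show ?case by (simp add: L2_continuous smooth_continuous)
next
  case (Suc k)
  then show ?case
    by (auto simp: L2_continuous smooth_continuous intro!: exI[of _ "partial _ f"] weak_partial_smooth smooth_partial)
qed

lemma H1_tendsto_smooth:
  assumes "smooth f" shows "H1_tendsto D (\<lambda>_. f) f"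
  unfolding H1_tendsto_def
proof (intro conjI ballI exI)
  show "L2_tendsto (lebesgue_on D) (\<lambda>_. f) f"
    by (intro L2_tendsto_const L2_continuous smooth_continuous assms)
  fix i :: 'a assume i: "i \<in> Basis"
  show "weak_partial D i f (partial i f)" by (rule weak_partial_smooth[OF assms i])
  show "L2_tendsto (lebesgue_on D) (\<lambda>_. partial i f) (partial i f)"
    by (intro L2_tendsto_const L2_continuous smooth_continuous smooth_partial assms i)
qed

lemma weak_laplacian_smooth:
  assumes f: "smooth f"
  shows "weak_laplacian D f (\<lambda>x. \<Sum>i\<in>Basis. partial i (partial i f) x)"
  unfolding weak_laplacian_def
proof (intro conjI allI impI)
  show "L2 (lebesgue_on D) f" "L2 (lebesgue_on D) (\<lambda>x. \<Sum>i\<in>Basis. partial i (partial i f) x)"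
    using f by (auto intro!: L2_continuous smooth_continuous smooth_partial L2_sum)
  fix \<phi> assume \<phi>: "test_function D \<phi>"
  note s = test_function_smooth[OF \<phi>]
  have "(LINT x|lebesgue_on D. f x * (\<Sum>i\<in>Basis. partial i (partial i \<phi>) x)) =
      (\<Sum>i\<in>Basis. LINT x|lebesgue_on D. f x * partial i (partial i \<phi>) x)"
    unfolding sum_distrib_left
    by (intro Bochner_Integration.integral_sum L2_times_integrable L2_continuous smooth_continuous
        smooth_partial f s)
  also have "\<dots> = (\<Sum>i\<in>Basis. LINT x|lebesgue_on D. partial i (partial i f) x * \<phi> x)"
    by (intro sum.cong refl) (simp add: integral_by_parts f \<phi> test_function_partial smooth_partial)
  also have "\<dots> = (LINT x|lebesgue_on D. (\<Sum>i\<in>Basis. partial i (partial i f) x) * \<phi> x)"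
    unfolding sum_distrib_right
    by (intro Bochner_Integration.integral_sum[symmetric] L2_times_integrable L2_continuous smooth_continuous
        smooth_partial f s)
  finally show "(LINT x|lebesgue_on D. f x * (\<Sum>i\<in>Basis. partial i (partial i \<phi>) x)) =
      (LINT x|lebesgue_on D. (\<Sum>i\<in>Basis. partial i (partial i f) x) * \<phi> x)" .
qed

end

subsection \<open>Cutoff functions on the unit ball\<close>

text \<open>The functions \<open>p(1/t) exp(-1/t)\<close>, extended by \<open>0\<close> to \<open>t \<le> 0\<close>, form a class closed under
  differentiation.\<close>

definition flat :: "real poly \<Rightarrow> real \<Rightarrow> real" where
  "flat p t = (if t > 0 then poly p (1 / t) * exp (- (1 / t)) else 0)"

definition flat_deriv :: "real poly \<Rightarrow> real poly" where
  "flat_deriv p = pCons 0 (pCons 0 (p - pderiv p))"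

lemma poly_times_exp_tendsto_0: "((\<lambda>y::real. poly p y * exp (- y)) \<longlongrightarrow> 0) at_top"
proof -
  have "((\<lambda>y::real. \<Sum>i\<le>degree p. coeff p i * (y ^ i / exp y)) \<longlongrightarrow> (\<Sum>i\<le>degree p. coeff p i * 0)) at_top"
    by (intro tendsto_sum tendsto_mult_left tendsto_power_div_exp_0)
  then show ?thesis
    by (simp add: poly_altdef sum_distrib_right exp_minus divide_inverse mult.assoc)
qed

lemma flat_has_derivative: "(flat p has_real_derivative flat (flat_deriv p) t) (at t)"
proof -
  consider "t > 0" | "t < 0" | "t = 0" by linarith
  then show ?thesis
  proof cases
    case 1
    have "((\<lambda>t. poly p (1 / t) * exp (- (1 / t))) has_real_derivative flat (flat_deriv p) t) (at t)"
      using 1 by (auto intro!: derivative_eq_intros simp: flat_def flat_deriv_def field_simps power2_eq_square)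
    then show ?thesis
      by (rule has_field_derivative_transform_within_open[where S = "{0<..}"]) (use 1 in \<open>auto simp: flat_def\<close>)
  next
    case 2
    have "((\<lambda>t. 0) has_real_derivative flat (flat_deriv p) t) (at t)"
      using 2 by (auto intro!: derivative_eq_intros simp: flat_def)
    then show ?thesis
      by (rule has_field_derivative_transform_within_open[where S = "{..<0}"]) (use 2 in \<open>auto simp: flat_def\<close>)
  next
    case 3
    have "((\<lambda>h. poly (pCons 0 p) (inverse h) * exp (- inverse h)) \<longlongrightarrow> 0) (at_right 0)"
      by (rule filterlim_compose[OF poly_times_exp_tendsto_0 filterlim_inverse_at_top_right])
    then have "((\<lambda>h. flat p h / h) \<longlongrightarrow> 0) (at_right 0)"
      by (rule Lim_transform_eventually)
         (auto simp: eventually_at_filter flat_def divide_inverse mult_ac)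
    moreover have "((\<lambda>h. flat p h / h) \<longlongrightarrow> 0) (at_left 0)"
      by (rule Lim_transform_eventually[OF tendsto_const]) (auto simp: eventually_at_filter flat_def)
    ultimately have "((\<lambda>h. flat p h / h) \<longlongrightarrow> 0) (at 0)" by (simp add: filterlim_at_split)
    then show ?thesis using 3 by (simp add: DERIV_def flat_def)
  qed
qed

lemma flat_smult: "flat (Polynomial.smult c p) t = c * flat p t"
  by (simp add: flat_def)

lemma continuous_flat: "continuous_on A (flat p)"
  by (intro continuous_at_imp_continuous_on ballI DERIV_isCont[OF flat_has_derivative])

abbreviation bump :: "real \<Rightarrow> real" where "bump \<equiv> flat 1"

abbreviation bump' :: "real \<Rightarrow> real" where "bump' \<equiv> flat (flat_deriv 1)"

lemma bump_le_1: "0 \<le> bump t" "bump t \<le> 1"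
  by (auto simp: flat_def)

lemma bump_tendsto_1: "(bump \<longlongrightarrow> 1) at_top"
proof -
  have "((\<lambda>t::real. exp (- (1 / t))) \<longlongrightarrow> 1) at_top" by real_asymp
  then show ?thesis
    by (rule Lim_transform_eventually)
       (auto intro!: eventually_mono[OF eventually_gt_at_top[of 0]] simp: flat_def)
qed

lemma bump'_eq: "bump' t = (if t > 0 then (1 / t)\<^sup>2 * exp (- (1 / t)) else 0)"
  by (simp add: flat_def flat_deriv_def power2_eq_square)

lemma bump'_bounds: "0 \<le> (t + 1) * bump' t" "(t + 1) * bump' t \<le> 3"
proof -
  have "0 \<le> (t + 1) * bump' t \<and> (t + 1) * bump' t \<le> 3"
  proof (cases "t > 0")
    case True
    define y where "y = 1 / t"
    have y: "y > 0" "t = 1 / y" using True by (auto simp: y_def)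
    have eq: "(t + 1) * bump' t = (y + y\<^sup>2) * exp (- y)"
    proof -
      have "bump' t = y\<^sup>2 * exp (- y)" using True by (simp add: bump'_eq y_def)
      moreover have "(t + 1) * y\<^sup>2 = y + y\<^sup>2" using y(1) by (simp add: y(2) power2_eq_square ring_distribs)
      ultimately show ?thesis by (metis mult.assoc)
    qed
    have "y + y\<^sup>2 \<le> 3 * exp y"
      using exp_lower_Taylor_quadratic[of y] y(1) zero_le_power2[of y] exp_gt_zero[of y] by linarith
    then have "(y + y\<^sup>2) * exp (- y) \<le> 3" by (simp add: exp_minus field_simps)
    then show ?thesis using eq y(1) by simp
  qed (simp add: bump'_eq)
  then show "0 \<le> (t + 1) * bump' t" "(t + 1) * bump' t \<le> 3" by auto
qed

lemma bump'_tendsto_0: "((\<lambda>t. (t + 1) * bump' t) \<longlongrightarrow> 0) at_top"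
proof -
  have "((\<lambda>t::real. (t + 1) * ((1 / t)\<^sup>2 * exp (- (1 / t)))) \<longlongrightarrow> 0) at_top" by real_asymp
  then show ?thesis
    by (rule Lim_transform_eventually)
       (auto intro!: eventually_mono[OF eventually_gt_at_top[of 0]] simp: bump'_eq)
qed

definition cutoff :: "nat \<Rightarrow> 'a::euclidean_space \<Rightarrow> complex" where
  "cutoff m x = of_real (bump (real (Suc m) * (1 - x \<bullet> x) - 1))"

definition boundary_density :: "nat \<Rightarrow> 'a::euclidean_space \<Rightarrow> real" where
  "boundary_density m x = 2 * real (Suc m) * bump' (real (Suc m) * (1 - x \<bullet> x) - 1)"

lemma flat_radial_derivative:
  "((\<lambda>t. complex_of_real (flat p (c * (1 - t) - 1))) has_vector_derivative
     of_real (flat (Polynomial.smult (- c) (flat_deriv p)) (c * (1 - t) - 1))) (at t)"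
proof -
  have "((\<lambda>t. flat p (c * (1 - t) - 1)) has_real_derivative flat (flat_deriv p) (c * (1 - t) - 1) * (- c)) (at t)"
    by (rule DERIV_chain2[OF flat_has_derivative]) (auto intro!: derivative_eq_intros)
  then have "((\<lambda>t. flat p (c * (1 - t) - 1)) has_vector_derivative
      flat (Polynomial.smult (- c) (flat_deriv p)) (c * (1 - t) - 1)) (at t)"
    unfolding has_real_derivative_iff_has_vector_derivative flat_smult by (simp add: mult.commute)
  then show ?thesis by (rule bounded_linear.has_vector_derivative[OF bounded_linear_of_real])
qed

lemma smooth_cutoff: "smooth (cutoff m)"
proof -
  define H where "H = range (\<lambda>p t. complex_of_real (flat p (real (Suc m) * (1 - t) - 1)))"
  have "smooth (\<lambda>x::'a. (\<lambda>t. complex_of_real (bump (real (Suc m) * (1 - t) - 1))) (x \<bullet> x))"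
  proof (rule smooth_radial[of H])
    fix h assume "h \<in> H"
    then obtain p where "h = (\<lambda>t. complex_of_real (flat p (real (Suc m) * (1 - t) - 1)))" by (auto simp: H_def)
    then have "\<forall>t. (h has_vector_derivative
        (\<lambda>t. complex_of_real (flat (Polynomial.smult (- real (Suc m)) (flat_deriv p)) (real (Suc m) * (1 - t) - 1))) t) (at t)"
      using flat_radial_derivative[of p "real (Suc m)"] by blast
    then show "\<exists>h'\<in>H. \<forall>t. (h has_vector_derivative h' t) (at t)"
      by (intro bexI[where x = "\<lambda>t. complex_of_real (flat (Polynomial.smult (- real (Suc m)) (flat_deriv p)) (real (Suc m) * (1 - t) - 1))"])
         (auto simp: H_def)
  qed (simp add: H_def)
  then show ?thesis by (simp add: cutoff_def[abs_def])
qed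

lemma partial_cutoff: "partial i (cutoff m) = (\<lambda>x. - of_real ((x \<bullet> i) * boundary_density m x))"
  using partial_radial[OF flat_radial_derivative[of 1 "real (Suc m)"], of i]
  unfolding cutoff_def[abs_def] boundary_density_def flat_smult by (simp add: fun_eq_iff algebra_simps)

lemma test_function_cutoff: "test_function (ball 0 1) (cutoff m)"
  unfolding test_function_def
proof (intro conjI exI allI impI)
  define r where "r = sqrt (1 - 1 / real (Suc m))"
  have r: "r\<^sup>2 = 1 - 1 / real (Suc m)" "r \<ge> 0" by (auto simp: r_def)
  have "r\<^sup>2 < 1\<^sup>2" by (simp add: r)
  then have r1: "r < 1" by (rule power2_less_imp_less) simp
  show "smooth (cutoff m)" by (rule smooth_cutoff)
  show "compact (cball 0 r :: 'a set)" by simp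
  show "cball 0 r \<subseteq> (ball 0 1 :: 'a set)" using r1 by auto
  fix x :: 'a assume "x \<notin> cball 0 r"
  then have "r\<^sup>2 < (norm x)\<^sup>2" using r(2) by (intro power_strict_mono) auto
  then have "real (Suc m) * (1 - x \<bullet> x) \<le> real (Suc m) * (1 / real (Suc m))"
    unfolding r(1) power2_norm_eq_inner by (intro mult_left_mono) auto
  then show "cutoff m x = 0" by (simp add: cutoff_def flat_def)
qed

lemma norm_cutoff_le: "norm (cutoff m x) \<le> 1"
  using bump_le_1 by (simp add: cutoff_def)

lemma cutoff_argument_at_top:
  assumes "x \<in> ball 0 1"
  shows "filterlim (\<lambda>m. real (Suc m) * (1 - x \<bullet> x) - 1) at_top sequentially"
proof -
  have "(norm x)\<^sup>2 < 1\<^sup>2" using assms by (intro power_strict_mono) auto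
  then have "1 - x \<bullet> x > 0" by (simp add: power2_norm_eq_inner)
  then show ?thesis by real_asymp
qed

lemma cutoff_tendsto_1: "x \<in> ball 0 1 \<Longrightarrow> (\<lambda>m. cutoff m x) \<longlonglongrightarrow> 1"
  using tendsto_of_real[OF filterlim_compose[OF bump_tendsto_1 cutoff_argument_at_top]]
  by (simp add: cutoff_def)

lemma boundary_density_decay:
  fixes x :: "'a::euclidean_space"
  shows "(1 - x \<bullet> x) * boundary_density m x =
    2 * (((real (Suc m) * (1 - x \<bullet> x) - 1) + 1) * bump' (real (Suc m) * (1 - x \<bullet> x) - 1))"
  by (simp add: boundary_density_def)

lemma boundary_density_decay_bounds:
  "0 \<le> (1 - x \<bullet> x) * boundary_density m x" "(1 - x \<bullet> x) * boundary_density m x \<le> 6"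
  unfolding boundary_density_decay
  using bump'_bounds[of "real (Suc m) * (1 - x \<bullet> x) - 1"] by linarith+

lemma boundary_density_decay_tendsto:
  "x \<in> ball 0 1 \<Longrightarrow> (\<lambda>m. (1 - x \<bullet> x) * boundary_density m x) \<longlonglongrightarrow> 0"
  unfolding boundary_density_decay
  using tendsto_mult_left[OF filterlim_compose[OF bump'_tendsto_0 cutoff_argument_at_top], of x 2] by simp

lemma boundary_density_nonneg: "boundary_density m x \<ge> 0"
  by (simp add: boundary_density_def bump'_eq)

lemma boundary_density_outside: "x \<notin> ball 0 1 \<Longrightarrow> boundary_density m x = 0"
proof -
  assume "x \<notin> ball 0 1"
  then have "1 \<le> (norm x)\<^sup>2" by simp
  then have "real (Suc m) * (1 - x \<bullet> x) \<le> 0" by (simp add: power2_norm_eq_inner mult_nonneg_nonpos)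
  then show ?thesis by (simp add: boundary_density_def bump'_eq)
qed

lemma continuous_boundary_density: "continuous_on A (boundary_density m)"
  unfolding boundary_density_def[abs_def]
  by (intro continuous_intros continuous_on_compose2[OF continuous_flat[of UNIV]]) auto

lemma cutoff_integral_tendsto:
  fixes h :: "'a::euclidean_space \<Rightarrow> complex"
  assumes h: "integrable (lebesgue_on (ball 0 1)) h"
  shows "(\<lambda>m. LINT x|lebesgue_on (ball 0 1). h x * cutoff m x) \<longlonglongrightarrow> (LINT x|lebesgue_on (ball 0 1). h x)"
proof (rule integral_dominated_convergence[where w = "\<lambda>x. norm (h x)"])
  show "(\<lambda>x. h x * cutoff m x) \<in> borel_measurable (lebesgue_on (ball 0 1))" for m
    using h continuous_measurable_domain[OF _ _ smooth_continuous[OF smooth_cutoff], of "ball 0 1" m]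
    by (intro borel_measurable_times) auto
  show "AE x in lebesgue_on (ball 0 1). (\<lambda>m. h x * cutoff m x) \<longlonglongrightarrow> h x"
  proof (intro AE_I2)
    fix x :: 'a assume "x \<in> space (lebesgue_on (ball 0 1))"
    then show "(\<lambda>m. h x * cutoff m x) \<longlonglongrightarrow> h x"
      using tendsto_mult_left[OF cutoff_tendsto_1, of x "h x"] by simp
  qed
  show "AE x in lebesgue_on (ball 0 1). norm (h x * cutoff m x) \<le> norm (h x)" for m
    by (intro AE_I2) (simp add: norm_mult mult_left_le norm_cutoff_le)
qed (use h in auto)

lemma H1_0_smooth_vanishing:
  fixes u :: "'a::euclidean_space \<Rightarrow> complex"
  assumes u: "smooth u" and C: "\<And>x. x \<in> ball 0 1 \<Longrightarrow> norm (u x) \<le> C * (1 - x \<bullet> x)"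
  shows "H1_0 (ball 0 1) u"
  unfolding H1_0_def H1_tendsto_def
proof (intro exI[of _ "\<lambda>m x. u x * cutoff m x"] conjI allI ballI)
  let ?D = "ball 0 1 :: 'a set"
  note fin = finite_measure_domain[of ?D, OF open_ball bounded_ball]
  note meas = continuous_measurable_domain[of ?D, OF open_ball bounded_ball]
  show test: "test_function ?D (\<lambda>x. u x * cutoff m x)" for m
    by (rule test_function_mult[OF u test_function_cutoff])
  obtain C0 where C0: "C0 \<ge> 0" "\<And>x. x \<in> ?D \<Longrightarrow> norm (u x) \<le> C0"
    using continuous_bounded_domain[of ?D, OF open_ball bounded_ball smooth_continuous[OF u]] by blast
  show "L2_tendsto (lebesgue_on ?D) (\<lambda>m x. u x * cutoff m x) u"
  proof (rule L2_tendsto_bounded[OF fin, where C = "C0 * 1"])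
    show "(\<lambda>x. u x * cutoff m x) \<in> borel_measurable (lebesgue_on ?D)" for m
      by (intro meas smooth_continuous test_function_smooth[OF test])
    show "norm (u x * cutoff m x) \<le> C0 * 1" if "x \<in> space (lebesgue_on ?D)" for m x
      unfolding norm_mult using C0(1) C0(2)[of x] that norm_cutoff_le[of m x] by (intro mult_mono) auto
    show "(\<lambda>m. u x * cutoff m x) \<longlonglongrightarrow> u x" if "x \<in> space (lebesgue_on ?D)" for x
      using tendsto_mult_left[OF cutoff_tendsto_1, of x "u x"] that by simp
  qed (intro meas smooth_continuous u)
  fix i :: 'a assume i: "i \<in> Basis"
  show "\<exists>g. weak_partial ?D i u g \<and> L2_tendsto (lebesgue_on ?D) (\<lambda>m. partial i (\<lambda>x. u x * cutoff m x)) g"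
  proof (intro exI conjI)
    show "weak_partial ?D i u (partial i u)" by (rule weak_partial_smooth[OF open_ball bounded_ball u i])
    obtain C1 where C1: "C1 \<ge> 0" "\<And>x. x \<in> ?D \<Longrightarrow> norm (partial i u x) \<le> C1"
      using continuous_bounded_domain[of ?D, OF open_ball bounded_ball smooth_continuous[OF smooth_partial[OF u i]]]
      by blast
    have eq: "partial i (\<lambda>x. u x * cutoff m x) =
        (\<lambda>x. partial i u x * cutoff m x - u x * of_real ((x \<bullet> i) * boundary_density m x))" for m
      unfolding partial_smooth_mult[OF u smooth_cutoff] partial_cutoff by simp
    have bd: "norm (u x * of_real ((x \<bullet> i) * boundary_density m x)) \<le> C * ((1 - x \<bullet> x) * boundary_density m x)"
      if "x \<in> ?D" for x m
    proof -
      have "\<bar>x \<bullet> i\<bar> \<le> 1" using Basis_le_norm[OF i, of x] that by simp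
      then have "norm (of_real ((x \<bullet> i) * boundary_density m x) :: complex) \<le> 1 * boundary_density m x"
        using boundary_density_nonneg[of m x] by (simp only: norm_of_real abs_mult) (intro mult_mono, auto)
      then have "norm (u x) * norm (of_real ((x \<bullet> i) * boundary_density m x) :: complex)
          \<le> (C * (1 - x \<bullet> x)) * (1 * boundary_density m x)"
        using C[OF that] order_trans[OF norm_ge_zero C[OF that]] by (intro mult_mono) auto
      then show ?thesis by (simp only: norm_mult mult_1 mult.assoc)
    qed
    have Cnn: "C \<ge> 0" using C[of 0] norm_ge_zero[of "u 0"] by (simp, linarith)
    show "L2_tendsto (lebesgue_on ?D) (\<lambda>m. partial i (\<lambda>x. u x * cutoff m x)) (partial i u)"
    proof (rule L2_tendsto_bounded[OF fin, where C = "C1 * 1 + C * 6"])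
      show "partial i (\<lambda>x. u x * cutoff m x) \<in> borel_measurable (lebesgue_on ?D)" for m
        by (intro meas smooth_continuous smooth_partial test_function_smooth[OF test] i)
      show "partial i u \<in> borel_measurable (lebesgue_on ?D)" by (intro meas smooth_continuous smooth_partial u i)
      show "norm (partial i (\<lambda>x. u x * cutoff m x) x) \<le> C1 * 1 + C * 6"
        if "x \<in> space (lebesgue_on ?D)" for m x
      proof -
        have x: "x \<in> ?D" using that by simp
        have "norm (partial i u x * cutoff m x) \<le> C1 * 1"
          unfolding norm_mult using C1(1) C1(2)[OF x] norm_cutoff_le[of m x] by (intro mult_mono) auto
        moreover have "C * ((1 - x \<bullet> x) * boundary_density m x) \<le> C * 6"
          using boundary_density_decay_bounds(2) Cnn by (rule mult_left_mono)
        ultimately show ?thesis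
          unfolding eq using bd[OF x, of m] norm_triangle_ineq4 by (meson add_mono order_trans)
      qed
      show "(\<lambda>m. partial i (\<lambda>x. u x * cutoff m x) x) \<longlonglongrightarrow> partial i u x"
        if "x \<in> space (lebesgue_on ?D)" for x
      proof -
        have x: "x \<in> ?D" using that by simp
        have "(\<lambda>m. C * ((1 - x \<bullet> x) * boundary_density m x)) \<longlonglongrightarrow> 0"
          using tendsto_mult_left[OF boundary_density_decay_tendsto[OF x], of C] by simp
        then have "(\<lambda>m. u x * of_real ((x \<bullet> i) * boundary_density m x)) \<longlonglongrightarrow> 0"
          by (rule Lim_null_comparison[rotated]) (use bd[OF x] in auto)
        from tendsto_diff[OF tendsto_mult_left[OF cutoff_tendsto_1[OF x], of "partial i u x"] this]
        show ?thesis unfolding eq by simp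
      qed
    qed
  qed
qed

subsection \<open>Rotations and the unit circle\<close>

definition circle_point :: "real \<Rightarrow> real^2" where
  "circle_point t = vector [cos t, sin t]"

definition rotate_plane :: "real \<Rightarrow> real^2 \<Rightarrow> real^2" where
  "rotate_plane t x = vector [cos t * x $ 1 - sin t * x $ 2, sin t * x $ 1 + cos t * x $ 2]"

lemma inner_real2: "(x::real^2) \<bullet> y = x $ 1 * y $ 1 + x $ 2 * y $ 2"
  by (simp add: inner_vec_def sum_2)

lemma circle_point_inner: "circle_point t \<bullet> circle_point t = 1"
  using sin_cos_squared_add2[of t] by (simp add: inner_real2 circle_point_def power2_eq_square)

lemma norm_circle_point: "norm (circle_point t) = 1"
  by (simp add: norm_eq_sqrt_inner circle_point_inner)

lemma rotate_circle_point: "rotate_plane t (r *\<^sub>R circle_point s) = r *\<^sub>R circle_point (t + s)"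
  by (simp add: rotate_plane_def circle_point_def vec_eq_iff forall_2 cos_add sin_add algebra_simps)

lemma circle_point_periodic: "circle_point (t + 2 * pi) = circle_point t"
  by (simp add: circle_point_def)

lemma polar_real2:
  fixes x :: "real^2"
  obtains s where "0 \<le> s" "s < 2 * pi" "x = norm x *\<^sub>R circle_point s"
proof (cases "x = 0")
  case True
  then show ?thesis by (intro that[of 0]) auto
next
  case False
  have "(x $ 1 / norm x)\<^sup>2 + (x $ 2 / norm x)\<^sup>2 = (x \<bullet> x) / (norm x)\<^sup>2"
    by (simp add: inner_real2 power_divide power2_eq_square add_divide_distrib)
  also have "\<dots> = 1" using False by (simp add: power2_norm_eq_inner)
  finally have "(x $ 1 / norm x)\<^sup>2 + (x $ 2 / norm x)\<^sup>2 = 1" .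
  then obtain s where s: "0 \<le> s" "s < 2 * pi" "x $ 1 / norm x = cos s" "x $ 2 / norm x = sin s"
    by (rule sincos_total_2pi)
  have "x $ 1 = norm x * cos s" "x $ 2 = norm x * sin s"
    unfolding s(3)[symmetric] s(4)[symmetric] using False by simp_all
  then show ?thesis
    by (intro that[OF s(1,2)]) (simp add: circle_point_def vec_eq_iff forall_2)
qed

lemma vector_2_eq_axis: "(vector [a, b] :: real^2) = a *\<^sub>R axis 1 1 + b *\<^sub>R axis 2 1"
  by (simp add: vec_eq_iff forall_2 axis_def)

lemma continuous_circle_point: "continuous_on A circle_point"
  unfolding circle_point_def vector_2_eq_axis by (intro continuous_intros)

lemma continuous_rotate:
  fixes f :: "'a::t2_space \<Rightarrow> real"
  assumes "continuous_on A f" "continuous_on A g"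
  shows "continuous_on A (\<lambda>p. rotate_plane (f p) (g p))"
  unfolding rotate_plane_def vector_2_eq_axis by (intro continuous_intros assms)

lemma rotate_inverse: "rotate_plane (- t) (rotate_plane t x) = x" "rotate_plane t (rotate_plane (- t) x) = x"
proof -
  have *: "rotate_plane (- t) (rotate_plane t x) = x" for t x
  proof -
    obtain s where s: "x = norm x *\<^sub>R circle_point s" using polar_real2[of x] by blast
    show ?thesis by (subst (1 2) s) (simp add: rotate_circle_point)
  qed
  show "rotate_plane (- t) (rotate_plane t x) = x" "rotate_plane t (rotate_plane (- t) x) = x"
    using *[of t x] *[of "- t" x] by auto
qed

lemma orthogonal_transformation_rotate: "orthogonal_transformation (rotate_plane t)"
  unfolding orthogonal_transformation
proof (intro conjI allI)
  show "linear (rotate_plane t)"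
    by (rule linearI) (auto simp: rotate_plane_def vec_eq_iff forall_2 algebra_simps)
  fix x
  obtain s where s: "x = norm x *\<^sub>R circle_point s" using polar_real2[of x] by blast
  show "norm (rotate_plane t x) = norm x"
    by (subst s) (simp add: rotate_circle_point norm_circle_point)
qed

lemma norm_rotate: "norm (rotate_plane t x) = norm x"
  using orthogonal_transformation_rotate orthogonal_transformation_norm by blast

lemma lborel_distr_rotate: "distr lborel borel (rotate_plane t) = lborel"
proof (rule lborel_eqI[symmetric])
  have cont: "continuous_on UNIV (rotate_plane t)" for t by (intro continuous_rotate continuous_intros)
  have meas: "rotate_plane t \<in> measurable lborel borel"
    using borel_measurable_continuous_onI[OF cont] by simp
  fix l u :: "real^2" assume lu: "\<And>b. b \<in> Basis \<Longrightarrow> l \<bullet> b \<le> u \<bullet> b"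
  have pre: "rotate_plane t -` box l u = rotate_plane (- t) ` box l u"
    using rotate_inverse by (auto simp: image_iff) (metis)+
  have "open (rotate_plane t -` box l u)" using cont by (intro open_vimage) auto
  then have b: "rotate_plane (- t) ` box l u \<in> sets borel" using pre by simp
  have lm: "rotate_plane (- t) ` box l u \<in> lmeasurable"
    by (rule measurable_orthogonal_image[OF orthogonal_transformation_rotate]) simp
  have "emeasure (distr lborel borel (rotate_plane t)) (box l u) = emeasure lborel (rotate_plane (- t) ` box l u)"
    by (simp add: emeasure_distr[OF meas] pre)
  also have "\<dots> = emeasure lebesgue (rotate_plane (- t) ` box l u)" using b by simp
  also have "\<dots> = ennreal (measure lebesgue (rotate_plane (- t) ` box l u))" by (rule emeasure_eq_measure2[OF lm])
  also have "measure lebesgue (rotate_plane (- t) ` box l u) = measure lebesgue (box l u)"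
    by (rule measure_orthogonal_image[OF orthogonal_transformation_rotate]) simp
  also have "ennreal (measure lebesgue (box l u)) = emeasure lborel (box l u)"
    using emeasure_eq_measure2[of "box l u" lebesgue] by simp
  also have "\<dots> = (\<Prod>b\<in>Basis. (u - l) \<bullet> b)"
    by (rule emeasure_lborel_box[OF lu])
  finally show "emeasure (distr lborel borel (rotate_plane t)) (box l u) = (\<Prod>b\<in>Basis. (u - l) \<bullet> b)" .
qed simp

lemma integral_rotate:
  fixes f :: "real^2 \<Rightarrow> complex"
  assumes "continuous_on UNIV f"
  shows "(LINT x|lborel. f (rotate_plane t x)) = (LINT x|lborel. f x)"
proof -
  have "rotate_plane t \<in> measurable lborel borel"
    using borel_measurable_continuous_onI[OF continuous_rotate[OF continuous_on_const continuous_on_id]] by simp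
  then have "(LINT x|distr lborel borel (rotate_plane t). f x) = (LINT x|lborel. f (rotate_plane t x))"
    using borel_measurable_continuous_onI[OF assms] by (intro integral_distr) auto
  then show ?thesis by (simp add: lborel_distr_rotate)
qed

lemma integral_arc_length:
  fixes f :: "real^2 \<Rightarrow> complex"
  assumes f: "continuous_on UNIV f"
  shows "(LINT x|arc_length. f x) = (LINT t|lborel. indicator {0..2*pi} t *\<^sub>R f (circle_point t))"
proof -
  have fc: "continuous_on UNIV (\<lambda>t. f (circle_point t))"
    by (intro continuous_on_compose2[OF f] continuous_circle_point) auto
  have "circle_point \<in> measurable (lebesgue_on {0..2*pi}) borel"
    by (intro continuous_imp_measurable_on_sets_lebesgue continuous_circle_point) auto
  then have "(LINT x|arc_length. f x) = (LINT t|lebesgue_on {0..2*pi}. f (circle_point t))"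
    unfolding arc_length_def circle_point_def[abs_def]
    using borel_measurable_continuous_onI[OF f] by (intro integral_distr) auto
  also have "\<dots> = (LINT t|lebesgue. indicator {0..2*pi} t *\<^sub>R f (circle_point t))"
    by (intro integral_restrict_space) auto
  also have "\<dots> = (LINT t|lborel. indicator {0..2*pi} t *\<^sub>R f (circle_point t))"
    using borel_measurable_continuous_onI[OF fc] by (intro integral_completion) auto
  finally show ?thesis .
qed

lemma integral_periodic_shift:
  fixes g :: "real \<Rightarrow> complex"
  assumes g: "continuous_on UNIV g" and per: "\<And>t. g (t + p) = g t" and s: "0 \<le> s" "s \<le> p"
  shows "(LINT t|lborel. indicator {0..p} t *\<^sub>R g (t + s)) = (LINT t|lborel. indicator {0..p} t *\<^sub>R g t)"
proof -
  have int: "g integrable_on {a..b}" for a b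
    by (intro integrable_continuous_real continuous_on_subset[OF g]) auto
  have hk: "(LINT t|lborel. indicator {0..p} t *\<^sub>R h t) = integral {0..p} h"
    if h: "continuous_on UNIV h" for h :: "real \<Rightarrow> complex"
    using set_borel_integral_eq_integral(2)[of "{0..p}" h]
      borel_integrable_compact[OF compact_Icc continuous_on_subset[OF h]]
    by (simp add: set_integrable_def set_lebesgue_integral_def)
  have gs: "continuous_on UNIV (\<lambda>t. g (t + s))"
    by (intro continuous_on_compose2[OF g] continuous_intros) auto
  have shift: "integral {a..b} (\<lambda>t. g (t + c)) = integral {a + c..b + c} g" for a b c
    using integral_shift_Icc_real[of a b g c] by (simp add: o_def add.commute)
  have "integral {0..p} (\<lambda>t. g (t + s)) = integral {s..p + s} g"
    using shift[of 0 p s] by simp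
  also have "\<dots> = integral {s..p} g + integral {p..p + s} g"
    using s by (intro Henstock_Kurzweil_Integration.integral_combine[symmetric] int) auto
  also have "integral {p..p + s} g = integral {0..s} (\<lambda>t. g (t + p))"
    using shift[of 0 s p] by (simp add: add.commute)
  also have "\<dots> = integral {0..s} g" by (simp add: per)
  also have "integral {s..p} g + integral {0..s} g = integral {0..p} g"
    using s Henstock_Kurzweil_Integration.integral_combine[of 0 s p g] int by (simp add: add.commute)
  finally show ?thesis using hk[OF g] hk[OF gs] by simp
qed

subsection \<open>The divergence theorem on the unit disk\<close>

lemma integral_disk_density:
  fixes f :: "'a::euclidean_space \<Rightarrow> 'b::euclidean_space"
  assumes "continuous_on UNIV f"
  shows "integrable (lebesgue_on (ball 0 1)) (\<lambda>x. boundary_density m x *\<^sub>R f x)"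
proof -
  have c: "continuous_on UNIV (\<lambda>x. boundary_density m x *\<^sub>R f x)"
    by (intro continuous_intros continuous_boundary_density assms)
  interpret finite_measure "lebesgue_on (ball 0 1 :: 'a set)"
    by (rule finite_measure_domain) auto
  obtain C where "\<And>x. x \<in> ball 0 1 \<Longrightarrow> norm (boundary_density m x *\<^sub>R f x) \<le> C"
    using continuous_bounded_domain[OF open_ball bounded_ball c] by blast
  then show ?thesis
    by (intro integrable_const_bound[where B = C] AE_I2 continuous_measurable_domain c) auto
qed

lemma decaying_density_tendsto:
  "(\<lambda>m. LINT x|lebesgue_on (ball 0 1). (1 - x \<bullet> x) * boundary_density m (x::'a::euclidean_space)) \<longlonglongrightarrow> 0"
proof -
  interpret finite_measure "lebesgue_on (ball 0 1 :: 'a set)"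
    by (rule finite_measure_domain) auto
  have "(\<lambda>m. LINT x|lebesgue_on (ball 0 1). (1 - x \<bullet> x) * boundary_density m (x::'a)) \<longlonglongrightarrow>
      (LINT x|lebesgue_on (ball 0 1 :: 'a set). 0)"
  proof (rule integral_dominated_convergence[where w = "\<lambda>x. 6"])
    show "(\<lambda>x::'a. (1 - x \<bullet> x) * boundary_density m x) \<in> borel_measurable (lebesgue_on (ball 0 1))" for m
      by (intro continuous_measurable_domain continuous_intros continuous_boundary_density) auto
    show "AE x in lebesgue_on (ball 0 1). (\<lambda>m. (1 - x \<bullet> x) * boundary_density m (x::'a)) \<longlonglongrightarrow> 0"
      using boundary_density_decay_tendsto by (intro AE_I2) auto
    show "AE x in lebesgue_on (ball 0 1). norm ((1 - x \<bullet> x) * boundary_density m (x::'a)) \<le> 6" for m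
      unfolding real_norm_def abs_of_nonneg[OF boundary_density_decay_bounds(1)]
      using boundary_density_decay_bounds(2) by (intro AE_I2) auto
  qed auto
  then show ?thesis by simp
qed

lemma divergence_cutoff:
  fixes \<Psi> :: "'a::euclidean_space \<Rightarrow> complex"
  assumes \<Psi>: "smooth \<Psi>" and i: "i \<in> Basis"
  shows "(\<lambda>m. LINT x|lebesgue_on (ball 0 1). boundary_density m x *\<^sub>R (\<Psi> x * of_real (x \<bullet> i)))
    \<longlonglongrightarrow> (LINT x|lebesgue_on (ball 0 1). partial i \<Psi> x)"
proof -
  let ?D = "ball 0 1 :: 'a set"
  have "(LINT x|lebesgue_on ?D. boundary_density m x *\<^sub>R (\<Psi> x * of_real (x \<bullet> i)))
      = (LINT x|lebesgue_on ?D. partial i \<Psi> x * cutoff m x)" for m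
  proof -
    have "(LINT x|lebesgue_on ?D. boundary_density m x *\<^sub>R (\<Psi> x * of_real (x \<bullet> i)))
        = - (LINT x|lebesgue_on ?D. \<Psi> x * partial i (cutoff m) x)"
      unfolding partial_cutoff Bochner_Integration.integral_minus[symmetric]
      by (simp add: scaleR_conv_of_real mult_ac)
    then show ?thesis
      by (simp add: integral_by_parts[OF open_ball bounded_ball \<Psi> test_function_cutoff i])
  qed
  moreover have "integrable (lebesgue_on ?D) (partial i \<Psi>)"
  proof -
    have "L2 (lebesgue_on ?D) (partial i \<Psi>)" "L2 (lebesgue_on ?D) (\<lambda>x. 1)"
      by (auto intro!: L2_continuous smooth_continuous smooth_partial smooth_const \<Psi> i)
    from L2_times_integrable[OF this] show ?thesis by simp
  qed
  ultimately show ?thesis by (simp add: cutoff_integral_tendsto)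
qed

lemma boundary_density_mass:
  "(\<lambda>m. LINT x|lebesgue_on unit_disk. boundary_density m x) \<longlonglongrightarrow> 2 * pi"
proof -
  have "(\<lambda>m. \<Sum>i\<in>Basis. LINT x|lebesgue_on unit_disk. boundary_density m x *\<^sub>R (of_real (x \<bullet> i) * of_real (x \<bullet> i) :: complex))
    \<longlonglongrightarrow> (\<Sum>i\<in>Basis. LINT x|lebesgue_on unit_disk. partial i (\<lambda>x. of_real (x \<bullet> i)) x)"
    by (intro tendsto_sum divergence_cutoff smooth_coord) auto
  also have "(\<Sum>i\<in>Basis. LINT x|lebesgue_on unit_disk. partial i (\<lambda>x. of_real (x \<bullet> i)) x) = of_real (2 * pi)"
  proof -
    have "partial i (\<lambda>x. complex_of_real (x \<bullet> i)) = (\<lambda>x. 1)" if "i \<in> Basis" for i :: "real^2"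
      using that by (auto simp: partial_coord)
    then have "(\<Sum>i\<in>Basis. LINT x|lebesgue_on unit_disk. partial i (\<lambda>x. of_real (x \<bullet> i)) x)
        = (\<Sum>i\<in>(Basis :: (real^2) set). LINT x|lebesgue_on unit_disk. 1)"
      by (intro sum.cong) auto
    also have "\<dots> = 2 * of_real (measure (lebesgue_on unit_disk) unit_disk)"
      by (simp add: scaleR_conv_of_real)
    also have "measure (lebesgue_on unit_disk) unit_disk = pi"
      by (simp add: measure_restrict_space content_ball unit_ball_vol_2)
    finally show ?thesis by simp
  qed
  also have "(\<lambda>m. \<Sum>i\<in>Basis. LINT x|lebesgue_on unit_disk. boundary_density m x *\<^sub>R (of_real (x \<bullet> i) * of_real (x \<bullet> i) :: complex))
      = (\<lambda>m. of_real (LINT x|lebesgue_on unit_disk. boundary_density m x * (x \<bullet> x)))"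
  proof
    fix m
    have "(\<Sum>i\<in>Basis. LINT x|lebesgue_on unit_disk. boundary_density m x *\<^sub>R (of_real (x \<bullet> i) * of_real (x \<bullet> i) :: complex))
        = (LINT x|lebesgue_on unit_disk. (\<Sum>i\<in>Basis. boundary_density m x *\<^sub>R (of_real (x \<bullet> i) * of_real (x \<bullet> i))))"
      by (intro Bochner_Integration.integral_sum[symmetric] integral_disk_density continuous_intros)
    also have "\<dots> = (LINT x|lebesgue_on unit_disk. of_real (boundary_density m x * (x \<bullet> x)))"
    proof -
      have "(\<Sum>i\<in>Basis. boundary_density m x *\<^sub>R (of_real (x \<bullet> i) * of_real (x \<bullet> i) :: complex))
          = of_real (boundary_density m x * (x \<bullet> x))" for x :: "real^2"
        unfolding euclidean_inner[of x x] by (simp add: scaleR_conv_of_real sum_distrib_left)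
      then show ?thesis by (intro Bochner_Integration.integral_cong refl)
    qed
    finally show "(\<Sum>i\<in>Basis. LINT x|lebesgue_on unit_disk. boundary_density m x *\<^sub>R (of_real (x \<bullet> i) * of_real (x \<bullet> i) :: complex))
        = of_real (LINT x|lebesgue_on unit_disk. boundary_density m x * (x \<bullet> x))"
      unfolding integral_complex_of_real .
  qed
  finally have "(\<lambda>m. LINT x|lebesgue_on unit_disk. boundary_density m x * (x \<bullet> x)) \<longlonglongrightarrow> 2 * pi"
    by (simp only: tendsto_of_real_iff)
  from tendsto_add[OF this decaying_density_tendsto]
  have "(\<lambda>m. (LINT x|lebesgue_on unit_disk. boundary_density m x * (x \<bullet> x)) +
      (LINT x|lebesgue_on unit_disk. (1 - x \<bullet> x) * boundary_density m x)) \<longlonglongrightarrow> 2 * pi" by simp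
  moreover have "(LINT x|lebesgue_on unit_disk. boundary_density m x * (x \<bullet> x)) +
      (LINT x|lebesgue_on unit_disk. (1 - x \<bullet> x) * boundary_density m x)
      = (LINT x|lebesgue_on unit_disk. boundary_density m x)" for m
  proof -
    have "integrable (lebesgue_on unit_disk) (\<lambda>x. boundary_density m x *\<^sub>R (x \<bullet> x))"
      "integrable (lebesgue_on unit_disk) (\<lambda>x. boundary_density m x *\<^sub>R (1 - x \<bullet> x))"
      by (intro integral_disk_density continuous_intros)+
    note sum = Bochner_Integration.integral_add[OF this]
    have eq: "boundary_density m x *\<^sub>R (x \<bullet> x) + boundary_density m x *\<^sub>R (1 - x \<bullet> x) = boundary_density m x"
      for x :: "real^2" by (simp add: algebra_simps)
    show ?thesis using sum unfolding eq by (simp add: mult.commute)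
  qed
  ultimately show ?thesis by simp
qed

lemma smooth_Lipschitz:
  fixes f :: "'a::euclidean_space \<Rightarrow> complex"
  assumes f: "smooth f"
  obtains L where "L \<ge> 0" "\<And>x y. x \<in> cball 0 1 \<Longrightarrow> y \<in> cball 0 1 \<Longrightarrow> norm (f x - f y) \<le> L * norm (x - y)"
proof -
  have "\<exists>C. \<forall>x\<in>cball 0 1. norm (partial i f x) \<le> C" if "i \<in> Basis" for i
  proof -
    have "compact (partial i f ` cball 0 1)"
      by (intro compact_continuous_image smooth_continuous smooth_partial f that) auto
    from compact_imp_bounded[OF this] show ?thesis by (auto simp: bounded_iff)
  qed
  then obtain C where C: "\<And>i x. i \<in> Basis \<Longrightarrow> x \<in> cball 0 1 \<Longrightarrow> norm (partial i f x) \<le> C i" by metis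
  define L where "L = (\<Sum>i\<in>(Basis::'a set). C i)"
  have Cnn: "C i \<ge> 0" if "i \<in> Basis" for i
    using order_trans[OF norm_ge_zero C[OF that, of 0]] by simp
  show ?thesis
  proof (rule that[of L])
    show "L \<ge> 0" unfolding L_def by (intro sum_nonneg Cnn)
    fix x y :: 'a assume xy: "x \<in> cball 0 1" "y \<in> cball 0 1"
    show "norm (f x - f y) \<le> L * norm (x - y)"
    proof (rule differentiable_bound[where S = "cball 0 1"])
      fix z :: 'a assume z: "z \<in> cball 0 1"
      have d: "(f has_derivative frechet_derivative f (at z)) (at z)"
        using smooth_differentiable[OF f] by (simp add: frechet_derivative_works)
      then show "(f has_derivative frechet_derivative f (at z)) (at z within cball 0 1)"
        by (rule has_derivative_at_withinI)
      note lin = has_derivative_linear[OF d]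
      show "onorm (frechet_derivative f (at z)) \<le> L"
      proof (rule onorm_le)
        fix v :: 'a
        have "frechet_derivative f (at z) v = (\<Sum>i\<in>Basis. (v \<bullet> i) *\<^sub>R partial i f z)"
          by (subst (1) euclidean_representation[symmetric, of v])
             (simp only: linear_sum[OF lin] linear_scale[OF lin] partial_def)
        also have "norm \<dots> \<le> (\<Sum>i\<in>Basis. C i * norm v)"
        proof (rule sum_norm_le)
          fix i :: 'a assume i: "i \<in> Basis"
          have "\<bar>v \<bullet> i\<bar> * norm (partial i f z) \<le> norm v * C i"
            using Basis_le_norm[OF i] C[OF i z] by (intro mult_mono) auto
          then show "norm ((v \<bullet> i) *\<^sub>R partial i f z) \<le> C i * norm v" by (simp add: mult.commute)
        qed
        finally show "norm (frechet_derivative f (at z) v) \<le> L * norm v"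
          by (simp add: L_def sum_distrib_right)
      qed
    qed (use xy in auto)
  qed
qed

lemma smooth_radial_increment:
  fixes f :: "real^2 \<Rightarrow> complex"
  assumes "smooth f"
  obtains L where "L \<ge> 0"
    "\<And>r s. 0 \<le> r \<Longrightarrow> r \<le> 1 \<Longrightarrow> norm (f (r *\<^sub>R circle_point s) - f (circle_point s)) \<le> L * (1 - r\<^sup>2)"
proof -
  obtain L where L: "L \<ge> 0" "\<And>x y::real^2. x \<in> cball 0 1 \<Longrightarrow> y \<in> cball 0 1 \<Longrightarrow> norm (f x - f y) \<le> L * norm (x - y)"
    using smooth_Lipschitz[OF assms] by blast
  show ?thesis
  proof (rule that[OF L(1)])
    fix r s :: real assume r: "0 \<le> r" "r \<le> 1"
    have "r\<^sup>2 \<le> r" using r by (simp add: power2_eq_square mult_left_le)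
    have "norm (f (r *\<^sub>R circle_point s) - f (circle_point s)) \<le> L * norm (r *\<^sub>R circle_point s - circle_point s)"
      using r by (intro L(2)) (auto simp: norm_circle_point)
    also have "r *\<^sub>R circle_point s - circle_point s = (r - 1) *\<^sub>R circle_point s" by (simp add: scaleR_left_diff_distrib)
    also have "norm \<dots> = 1 - r" using r by (simp add: norm_circle_point)
    also have "L * (1 - r) \<le> L * (1 - r\<^sup>2)" using \<open>r\<^sup>2 \<le> r\<close> L(1) by (intro mult_left_mono) auto
    finally show "norm (f (r *\<^sub>R circle_point s) - f (circle_point s)) \<le> L * (1 - r\<^sup>2)" .
  qed
qed

text \<open>Averaging over rotations turns the integral against a radial density into one of the mean
  over circles, and the densities concentrate on the unit circle.\<close>

lemma boundary_density_tendsto_arc_length: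
  fixes f :: "real^2 \<Rightarrow> complex"
  assumes f: "smooth f"
  shows "(\<lambda>m. LINT x|lebesgue_on unit_disk. boundary_density m x *\<^sub>R f x) \<longlonglongrightarrow> (LINT x|arc_length. f x)"
proof -
  obtain L where L: "L \<ge> 0"
    "\<And>r s. 0 \<le> r \<Longrightarrow> r \<le> 1 \<Longrightarrow> norm (f (r *\<^sub>R circle_point s) - f (circle_point s)) \<le> L * (1 - r\<^sup>2)"
    using smooth_radial_increment[OF f] by blast
  note fc = smooth_continuous[OF f, of UNIV]
  define I :: "real set" where "I = {0..2*pi}"
  define A where "A = (LINT x|arc_length. f x)"
  define B where "B x = (LINT t|lborel. indicator I t *\<^sub>R f (rotate_plane t x))" for x
  define d where "d m = (boundary_density m :: real^2 \<Rightarrow> real)" for m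
  define J where "J m = (LINT x|lebesgue_on unit_disk. d m x *\<^sub>R f x)" for m
  have frot: "continuous_on UNIV (\<lambda>t. f (rotate_plane t x))" "continuous_on UNIV (\<lambda>x. f (rotate_plane t x))" for x t
    by (intro continuous_on_compose2[OF fc] continuous_rotate continuous_intros; simp)+
  have intI: "integrable lborel (\<lambda>t. indicator I t *\<^sub>R g t)" if "continuous_on UNIV g" for g :: "real \<Rightarrow> complex"
    unfolding I_def by (intro borel_integrable_compact continuous_on_subset[OF that]) auto
  have dc: "continuous_on UNIV (d m)" for m unfolding d_def by (rule continuous_boundary_density)
  have d0: "d m x = 0" if "x \<notin> unit_disk" for m x unfolding d_def by (rule boundary_density_outside[OF that])
  have drot: "d m (rotate_plane t x) = d m x" for m t x
    by (simp add: d_def boundary_density_def norm_rotate flip: power2_norm_eq_inner)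
  have J_lborel: "J m = (LINT x|lborel. d m x *\<^sub>R f x)" for m
    unfolding J_def using d0 by (intro integral_domain_eq_lborel continuous_intros dc fc) auto
  have Jrot: "(LINT x|lborel. d m x *\<^sub>R f (rotate_plane t x)) = J m" for m t
    using integral_rotate[of "\<lambda>x. d m x *\<^sub>R f x" t] dc fc
    by (simp add: drot J_lborel continuous_on_scaleR)
  have fubini: "of_real (2 * pi) * J m = (LINT x|lborel. d m x *\<^sub>R B x)"
    and Bc: "integrable lborel (\<lambda>x. d m x *\<^sub>R B x)" for m
  proof -
    have "integrable lborel (\<lambda>p::real \<times> (real^2). indicator (I \<times> cball 0 1) p *\<^sub>R (d m (snd p) *\<^sub>R f (rotate_plane (fst p) (snd p))))"
    proof (rule borel_integrable_compact)
      show "compact (I \<times> cball (0::real^2) 1)" unfolding I_def by (intro compact_Times) auto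
      show "continuous_on (I \<times> cball 0 1) (\<lambda>p. d m (snd p) *\<^sub>R f (rotate_plane (fst p) (snd p)))"
        by (intro continuous_intros continuous_on_compose2[OF dc] continuous_on_compose2[OF fc] continuous_rotate) auto
    qed
    also have "(\<lambda>p::real \<times> (real^2). indicator (I \<times> cball 0 1) p *\<^sub>R (d m (snd p) *\<^sub>R f (rotate_plane (fst p) (snd p)))) =
        (\<lambda>(t, x). indicator I t *\<^sub>R (d m x *\<^sub>R f (rotate_plane t x)))"
      using d0[of _ m] by (force simp: fun_eq_iff indicator_def)
    finally have int: "integrable (lborel \<Otimes>\<^sub>M lborel) (\<lambda>(t, x). indicator I t *\<^sub>R (d m x *\<^sub>R f (rotate_plane t x)))"
      by (simp add: lborel_prod)
    have inner: "(LINT t|lborel. indicator I t *\<^sub>R (d m x *\<^sub>R f (rotate_plane t x))) = d m x *\<^sub>R B x" for x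
    proof -
      have "(\<lambda>t. indicator I t *\<^sub>R (d m x *\<^sub>R f (rotate_plane t x))) = (\<lambda>t. d m x *\<^sub>R (indicator I t *\<^sub>R f (rotate_plane t x)))"
        by (rule ext) (rule scaleR_left_commute)
      then show ?thesis unfolding B_def by (simp del: scaleR_scaleR)
    qed
    from lborel_pair.integrable_snd[OF int] show "integrable lborel (\<lambda>x. d m x *\<^sub>R B x)"
      unfolding inner .
    have "(LINT x|lborel. LINT t|lborel. indicator I t *\<^sub>R (d m x *\<^sub>R f (rotate_plane t x)))
        = (LINT t|lborel. LINT x|lborel. indicator I t *\<^sub>R (d m x *\<^sub>R f (rotate_plane t x)))"
      by (rule lborel_pair.Fubini_integral[OF int])
    also have "\<dots> = (LINT t|lborel. indicator I t *\<^sub>R J m)" by (simp add: Jrot del: scaleR_scaleR)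
    also have "\<dots> = of_real (2 * pi) * J m" by (simp add: I_def scaleR_conv_of_real)
    finally have "of_real (2 * pi) * J m = (LINT x|lborel. LINT t|lborel. indicator I t *\<^sub>R (d m x *\<^sub>R f (rotate_plane t x)))" ..
    then show "of_real (2 * pi) * J m = (LINT x|lborel. d m x *\<^sub>R B x)" unfolding inner .
  qed
  have AB: "norm (B x - A) \<le> 2 * pi * L * (1 - x \<bullet> x)" if "x \<in> unit_disk" for x
  proof -
    obtain s where s: "0 \<le> s" "s < 2 * pi" "x = norm x *\<^sub>R circle_point s" using polar_real2[of x] by blast
    have fe1: "continuous_on UNIV (\<lambda>t. f (circle_point t))"
      by (intro continuous_on_compose2[OF fc] continuous_circle_point) auto
    have "continuous_on UNIV (\<lambda>t. f (circle_point (t + s)))"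
      by (rule continuous_on_compose2[OF fe1]) (auto intro!: continuous_intros)
    note fe = fe1 this
    have "A = (LINT t|lborel. indicator I t *\<^sub>R f (circle_point (t + s)))"
      unfolding A_def integral_arc_length[OF fc] I_def
      using integral_periodic_shift[OF fe(1), of "2 * pi" s] s by (simp add: circle_point_periodic)
    then have "B x - A = (LINT t|lborel. indicator I t *\<^sub>R (f (rotate_plane t x) - f (circle_point (t + s))))"
      unfolding B_def using intI[OF frot(1)] intI[OF fe(2)] by (simp add: scaleR_diff_right)
    also have "norm \<dots> \<le> (LINT t|lborel. norm (indicator I t *\<^sub>R (f (rotate_plane t x) - f (circle_point (t + s)))))"
      by (rule integral_norm_bound)
    also have "\<dots> \<le> (LINT t|lborel. indicator I t * (L * (1 - x \<bullet> x)))"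
    proof (rule integral_mono)
      show "integrable lborel (\<lambda>t. norm (indicator I t *\<^sub>R (f (rotate_plane t x) - f (circle_point (t + s)))))"
        by (intro integrable_norm intI continuous_intros frot fe)
      show "integrable lborel (\<lambda>t. indicator I t * (L * (1 - x \<bullet> x)))"
        by (intro integrable_mult_left integrable_real_indicator) (auto simp: I_def)
      fix t
      have "rotate_plane t x = norm x *\<^sub>R circle_point (t + s)" by (subst s(3)) (rule rotate_circle_point)
      then have "norm (f (rotate_plane t x) - f (circle_point (t + s))) \<le> L * (1 - x \<bullet> x)"
        using L(2)[of "norm x" "t + s"] that by (simp add: power2_norm_eq_inner)
      then show "norm (indicator I t *\<^sub>R (f (rotate_plane t x) - f (circle_point (t + s)))) \<le> indicator I t * (L * (1 - x \<bullet> x))"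
        by (simp add: indicator_def)
    qed
    also have "\<dots> = 2 * pi * L * (1 - x \<bullet> x)" by (simp add: I_def)
    finally show ?thesis .
  qed
  define \<mu> where "\<mu> m = (LINT x|lebesgue_on unit_disk. d m x)" for m
  define \<epsilon> where "\<epsilon> m = (LINT x|lebesgue_on unit_disk. (1 - x \<bullet> x) * d m x)" for m
  have \<mu>: "\<mu> m = (LINT x|lborel. d m x)" for m
    unfolding \<mu>_def using d0 by (intro integral_domain_eq_lborel dc) auto
  have \<epsilon>: "\<epsilon> m = (LINT x|lborel. (1 - x \<bullet> x) * d m x)" for m
    unfolding \<epsilon>_def using d0 by (intro integral_domain_eq_lborel continuous_intros dc) auto
  have int0: "integrable lborel (\<lambda>x. h x * d m x)" if "continuous_on UNIV h" for h :: "real^2 \<Rightarrow> real" and m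
  proof -
    have "integrable lborel (\<lambda>x. indicator (cball 0 1) x *\<^sub>R (h x * d m x))"
      by (intro borel_integrable_compact continuous_intros continuous_on_subset[OF that] continuous_on_subset[OF dc]) auto
    also have "(\<lambda>x. indicator (cball 0 1) x *\<^sub>R (h x * d m x)) = (\<lambda>x. h x * d m x)"
      using d0[of _ m] by (force simp: fun_eq_iff indicator_def)
    finally show ?thesis .
  qed
  have dist_le: "norm (of_real (2 * pi) * J m - of_real (\<mu> m) * A) \<le> 2 * pi * L * \<epsilon> m" for m
  proof -
    have dA: "integrable lborel (\<lambda>x. d m x *\<^sub>R A)"
      using int0[of "\<lambda>_. 1" m] by (intro integrable_scaleR_left) simp
    have "of_real (\<mu> m) * A = (LINT x|lborel. d m x *\<^sub>R A)"
      using int0[of "\<lambda>_. 1" m] by (simp add: \<mu> scaleR_conv_of_real)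
    then have "of_real (2 * pi) * J m - of_real (\<mu> m) * A = (LINT x|lborel. d m x *\<^sub>R (B x - A))"
      unfolding fubini scaleR_diff_right using Bc[of m] dA by simp
    also have "norm \<dots> \<le> (LINT x|lborel. norm (d m x *\<^sub>R (B x - A)))" by (rule integral_norm_bound)
    also have "\<dots> \<le> (LINT x|lborel. 2 * pi * L * ((1 - x \<bullet> x) * d m x))"
    proof (rule integral_mono)
      show "integrable lborel (\<lambda>x. norm (d m x *\<^sub>R (B x - A)))"
        using Bochner_Integration.integrable_diff[OF Bc dA] by (simp add: scaleR_diff_right)
      show "integrable lborel (\<lambda>x. 2 * pi * L * ((1 - x \<bullet> x) * d m x))"
        by (intro integrable_mult_right int0 continuous_intros)
      fix x
      show "norm (d m x *\<^sub>R (B x - A)) \<le> 2 * pi * L * ((1 - x \<bullet> x) * d m x)"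
      proof (cases "x \<in> unit_disk")
        case True
        have "d m x \<ge> 0" unfolding d_def by (rule boundary_density_nonneg)
        then have "d m x * norm (B x - A) \<le> d m x * (2 * pi * L * (1 - x \<bullet> x))"
          by (intro mult_left_mono AB[OF True])
        then show ?thesis using \<open>d m x \<ge> 0\<close> by (simp add: mult_ac)
      qed (simp add: d0)
    qed
    also have "\<dots> = 2 * pi * L * \<epsilon> m" by (simp add: \<epsilon>)
    finally show ?thesis .
  qed
  have "\<epsilon> \<longlonglongrightarrow> 0" unfolding \<epsilon>_def d_def by (rule decaying_density_tendsto)
  then have lim0: "(\<lambda>m. 2 * pi * L * \<epsilon> m) \<longlonglongrightarrow> 0" by (rule tendsto_mult_right_zero)
  have lim1: "(\<lambda>m. of_real (2 * pi) * J m - of_real (\<mu> m) * A) \<longlonglongrightarrow> 0"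
    by (rule Lim_null_comparison[OF always_eventually lim0]) (intro allI dist_le)
  have "\<mu> \<longlonglongrightarrow> 2 * pi" unfolding \<mu>_def d_def by (rule boundary_density_mass)
  then have lim2: "(\<lambda>m. of_real (\<mu> m) * A) \<longlonglongrightarrow> of_real (2 * pi) * A"
    by (intro tendsto_mult_right tendsto_of_real)
  have "(\<lambda>m. of_real (2 * pi) * J m) \<longlonglongrightarrow> of_real (2 * pi) * A"
    using tendsto_add[OF lim1 lim2] by simp
  from tendsto_mult_left[OF this, of "1 / of_real (2 * pi)"] show ?thesis
    by (simp add: A_def J_def d_def)
qed

theorem divergence_unit_disk:
  assumes "smooth \<Psi>" "i \<in> Basis"
  shows "(LINT x|lebesgue_on unit_disk. partial i \<Psi> x) = (LINT x|arc_length. \<Psi> x * of_real (x \<bullet> i))"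
  by (rule LIMSEQ_unique[OF divergence_cutoff[OF assms]])
     (intro boundary_density_tendsto_arc_length smooth_mult smooth_coord assms)

subsection \<open>Green's formula\<close>

lemma AE_arc_length:
  assumes "{x. P x} \<in> sets borel" "\<And>t. P (circle_point t)"
  shows "AE x in arc_length. P x"
proof -
  have m: "circle_point \<in> measurable (lebesgue_on {0..2*pi}) borel"
    by (intro continuous_imp_measurable_on_sets_lebesgue continuous_circle_point) auto
  show ?thesis
    unfolding arc_length_def circle_point_def[symmetric, abs_def]
    using assms by (subst AE_distr_iff[OF m]) auto
qed

lemma finite_measure_arc_length: "finite_measure arc_length"
proof -
  have m: "circle_point \<in> measurable (lebesgue_on {0..2*pi}) borel"
    by (intro continuous_imp_measurable_on_sets_lebesgue continuous_circle_point) auto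
  have "finite_measure (lebesgue_on {0..2*pi})"
    by (intro finite_measure_lebesgue_on) auto
  then show ?thesis
    unfolding arc_length_def circle_point_def[symmetric, abs_def]
    by (rule finite_measure.finite_measure_distr[OF _ m])
qed

lemma AE_arc_length_norm: "AE x in arc_length. norm x = 1"
proof (rule AE_arc_length)
  have "closed {x::real^2. norm x = 1}" by (intro closed_Collect_eq continuous_intros)
  then show "{x::real^2. norm x = 1} \<in> sets borel" by simp
qed (rule norm_circle_point)

lemma L2_arc_length:
  assumes f: "continuous_on UNIV f" shows "L2 arc_length f"
proof -
  have meas: "f \<in> borel_measurable arc_length"
    using borel_measurable_continuous_onI[OF f] by (simp add: arc_length_def)
  interpret finite_measure arc_length by (rule finite_measure_arc_length)
  have "compact (f ` cball 0 1)" by (intro compact_continuous_image continuous_on_subset[OF f]) auto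
  from compact_imp_bounded[OF this] have "\<exists>C. \<forall>x\<in>cball 0 1. norm (f x) \<le> C" by (auto simp: bounded_iff)
  then obtain C where C: "\<And>x. x \<in> cball 0 1 \<Longrightarrow> norm (f x) \<le> C" by blast
  show ?thesis
    unfolding L2_def
  proof
    show "integrable arc_length (\<lambda>x. (norm (f x))\<^sup>2)"
    proof (rule integrable_const_bound[where B = "C\<^sup>2"])
      show "AE x in arc_length. norm ((norm (f x))\<^sup>2) \<le> C\<^sup>2"
        using AE_arc_length_norm
      proof eventually_elim
        case (elim x)
        then show ?case using C[of x] by (auto intro: power_mono)
      qed
    qed (use meas in measurable)
  qed (rule meas)
qed

lemma weak_partial_unique_smooth:
  assumes g: "weak_partial (ball 0 1) i f g" "weak_partial (ball 0 1) i f g'" and Y: "smooth Y"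
  shows "(LINT x|lebesgue_on (ball 0 1). g x * Y x) = (LINT x|lebesgue_on (ball 0 1). g' x * Y x)"
proof -
  let ?D = "ball 0 1 :: 'a set"
  have Y2: "L2 (lebesgue_on ?D) Y" by (intro L2_continuous smooth_continuous Y) auto
  have *: "(\<lambda>m. - (LINT x|lebesgue_on ?D. f x * partial i (\<lambda>x. Y x * cutoff m x) x)) \<longlonglongrightarrow>
      (LINT x|lebesgue_on ?D. h x * Y x)" if h: "weak_partial ?D i f h" for h
  proof -
    have "(LINT x|lebesgue_on ?D. h x * (Y x * cutoff m x)) =
        - (LINT x|lebesgue_on ?D. f x * partial i (\<lambda>x. Y x * cutoff m x) x)" for m
      using h test_function_mult[OF Y test_function_cutoff] by (simp add: weak_partial_def)
    moreover have "(\<lambda>m. LINT x|lebesgue_on ?D. (h x * Y x) * cutoff m x) \<longlonglongrightarrow> (LINT x|lebesgue_on ?D. h x * Y x)"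
      using h Y2 by (intro cutoff_integral_tendsto L2_times_integrable) (auto simp: weak_partial_def)
    ultimately show ?thesis by (simp add: mult.assoc)
  qed
  show ?thesis by (rule LIMSEQ_unique[OF *[OF g(1)] *[OF g(2)]])
qed

lemma weak_partial_integral_smooth:
  assumes h: "weak_laplacian (ball 0 1) \<phi> h"
    and G: "\<And>i. i \<in> Basis \<Longrightarrow> weak_partial (ball 0 1) i \<phi> (G i)"
    and g: "\<And>i. i \<in> Basis \<Longrightarrow> weak_partial (ball 0 1) i (G i) (g i)" and V: "smooth V"
  shows "(LINT x|lebesgue_on (ball 0 1). h x * V x) = (\<Sum>i\<in>Basis. LINT x|lebesgue_on (ball 0 1). g i x * V x)"
proof -
  let ?D = "ball 0 1 :: 'a set"
  have V2: "L2 (lebesgue_on ?D) V" by (intro L2_continuous smooth_continuous V) auto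
  have test: "(LINT x|lebesgue_on ?D. h x * \<psi> x) = (\<Sum>i\<in>Basis. LINT x|lebesgue_on ?D. g i x * \<psi> x)"
    if \<psi>: "test_function ?D \<psi>" for \<psi>
  proof -
    have \<phi>2: "L2 (lebesgue_on ?D) \<phi>" using h by (simp add: weak_laplacian_def)
    have "(LINT x|lebesgue_on ?D. h x * \<psi> x) = (LINT x|lebesgue_on ?D. \<phi> x * (\<Sum>i\<in>Basis. partial i (partial i \<psi>) x))"
      using h \<psi> by (simp add: weak_laplacian_def)
    also have "\<dots> = (\<Sum>i\<in>Basis. LINT x|lebesgue_on ?D. \<phi> x * partial i (partial i \<psi>) x)"
      unfolding sum_distrib_left
      by (intro Bochner_Integration.integral_sum L2_times_integrable \<phi>2 L2_continuous smooth_continuous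
          smooth_partial test_function_smooth[OF \<psi>]) auto
    also have "\<dots> = (\<Sum>i\<in>Basis. LINT x|lebesgue_on ?D. g i x * \<psi> x)"
    proof (rule sum.cong[OF refl])
      fix i :: 'a assume i: "i \<in> Basis"
      show "(LINT x|lebesgue_on ?D. \<phi> x * partial i (partial i \<psi>) x) = (LINT x|lebesgue_on ?D. g i x * \<psi> x)"
        using G[OF i] g[OF i] \<psi> test_function_partial[OF \<psi> i] by (simp add: weak_partial_def)
    qed
    finally show ?thesis .
  qed
  have lim_h: "(\<lambda>m. LINT x|lebesgue_on ?D. (h x * V x) * cutoff m x) \<longlonglongrightarrow> (LINT x|lebesgue_on ?D. h x * V x)"
    using h V2 by (intro cutoff_integral_tendsto L2_times_integrable) (auto simp: weak_laplacian_def)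
  have lim_g: "(\<lambda>m. \<Sum>i\<in>Basis. LINT x|lebesgue_on ?D. (g i x * V x) * cutoff m x) \<longlonglongrightarrow>
      (\<Sum>i\<in>Basis. LINT x|lebesgue_on ?D. g i x * V x)"
    using g V2 by (intro tendsto_sum cutoff_integral_tendsto L2_times_integrable) (auto simp: weak_partial_def)
  have "(LINT x|lebesgue_on ?D. (h x * V x) * cutoff m x) =
      (\<Sum>i\<in>Basis. LINT x|lebesgue_on ?D. (g i x * V x) * cutoff m x)" for m
    using test[OF test_function_mult[OF V test_function_cutoff], of m] by (simp add: mult.assoc)
  then show ?thesis using lim_g by (intro LIMSEQ_unique[OF lim_h]) simp
qed

lemma H1_0_by_parts:
  assumes \<phi>: "H1_0 (ball 0 1) \<phi>" and G: "weak_partial (ball 0 1) i \<phi> G" and i: "i \<in> Basis" and Y: "smooth Y"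
  shows "(LINT x|lebesgue_on (ball 0 1). G x * Y x) = - (LINT x|lebesgue_on (ball 0 1). \<phi> x * partial i Y x)"
proof -
  let ?D = "ball 0 1 :: 'a set"
  obtain \<Phi> g where \<Phi>: "\<And>m. test_function ?D (\<Phi> m)" "L2_tendsto (lebesgue_on ?D) \<Phi> \<phi>"
    "weak_partial ?D i \<phi> g" "L2_tendsto (lebesgue_on ?D) (\<lambda>m. partial i (\<Phi> m)) g"
    using \<phi> i unfolding H1_0_def H1_tendsto_def by blast
  have Y2: "L2 (lebesgue_on ?D) Y" "L2 (lebesgue_on ?D) (partial i Y)"
    by (intro L2_continuous smooth_continuous smooth_partial Y i; simp)+
  have "(LINT x|lebesgue_on ?D. partial i (\<Phi> m) x * Y x) = - (LINT x|lebesgue_on ?D. \<Phi> m x * partial i Y x)" for m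
    using integral_by_parts[OF open_ball bounded_ball Y \<Phi>(1) i, of m] by (simp add: mult.commute)
  then have lim: "(\<lambda>m. - (LINT x|lebesgue_on ?D. \<Phi> m x * partial i Y x)) \<longlonglongrightarrow> (LINT x|lebesgue_on ?D. g x * Y x)"
    using L2_tendsto_integral[OF \<Phi>(4) Y2(1)] by simp
  have lim': "(\<lambda>m. - (LINT x|lebesgue_on ?D. \<Phi> m x * partial i Y x)) \<longlonglongrightarrow>
      - (LINT x|lebesgue_on ?D. \<phi> x * partial i Y x)"
    by (intro tendsto_minus L2_tendsto_integral[OF \<Phi>(2) Y2(2)])
  show ?thesis
    unfolding weak_partial_unique_smooth[OF G \<Phi>(3) Y] by (rule LIMSEQ_unique[OF lim lim'])
qed

lemma trace_by_parts:
  fixes V :: "real^2 \<Rightarrow> complex"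
  assumes tr: "has_trace unit_disk arc_length G T" and i: "i \<in> Basis" and V: "smooth V"
  obtains g where "weak_partial unit_disk i G g"
    "(LINT x|lebesgue_on unit_disk. g x * V x) + (LINT x|lebesgue_on unit_disk. G x * partial i V x)
      = (LINT x|arc_length. T x * (V x * of_real (x \<bullet> i)))"
proof -
  obtain \<Phi> g where \<Phi>: "\<And>m. smooth (\<Phi> m)" "L2_tendsto (lebesgue_on unit_disk) \<Phi> G"
    "weak_partial unit_disk i G g" "L2_tendsto (lebesgue_on unit_disk) (\<lambda>m. partial i (\<Phi> m)) g"
    "L2_tendsto arc_length \<Phi> T"
    using tr i unfolding has_trace_def H1_tendsto_def by blast
  have L: "L2 (lebesgue_on unit_disk) V" "L2 (lebesgue_on unit_disk) (partial i V)"
    "L2 arc_length (\<lambda>x. V x * of_real (x \<bullet> i))"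
    by (intro L2_continuous L2_arc_length smooth_continuous smooth_partial smooth_mult smooth_coord V i; simp)+
  have \<Phi>L: "L2 (lebesgue_on unit_disk) (\<Phi> m)" "L2 (lebesgue_on unit_disk) (partial i (\<Phi> m))" for m
    by (intro L2_continuous smooth_continuous smooth_partial \<Phi> i; simp)+
  have "(LINT x|lebesgue_on unit_disk. partial i (\<Phi> m) x * V x) + (LINT x|lebesgue_on unit_disk. \<Phi> m x * partial i V x)
      = (LINT x|arc_length. \<Phi> m x * (V x * of_real (x \<bullet> i)))" for m
  proof -
    have "(LINT x|lebesgue_on unit_disk. partial i (\<Phi> m) x * V x) + (LINT x|lebesgue_on unit_disk. \<Phi> m x * partial i V x)
        = (LINT x|lebesgue_on unit_disk. partial i (\<lambda>x. \<Phi> m x * V x) x)"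
      unfolding partial_smooth_mult[OF \<Phi>(1) V]
      by (intro Bochner_Integration.integral_add[symmetric] L2_times_integrable L \<Phi>L)
    also have "\<dots> = (LINT x|arc_length. (\<Phi> m x * V x) * of_real (x \<bullet> i))"
      by (intro divergence_unit_disk smooth_mult \<Phi> V i)
    finally show ?thesis by (simp add: mult.assoc)
  qed
  then have "(\<lambda>m. LINT x|arc_length. \<Phi> m x * (V x * of_real (x \<bullet> i))) \<longlonglongrightarrow>
      (LINT x|lebesgue_on unit_disk. g x * V x) + (LINT x|lebesgue_on unit_disk. G x * partial i V x)"
    using tendsto_add[OF L2_tendsto_integral[OF \<Phi>(4) L(1)] L2_tendsto_integral[OF \<Phi>(2) L(2)]] by simp
  then have "(LINT x|lebesgue_on unit_disk. g x * V x) + (LINT x|lebesgue_on unit_disk. G x * partial i V x)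
      = (LINT x|arc_length. T x * (V x * of_real (x \<bullet> i)))"
    using L2_tendsto_integral[OF \<Phi>(5) L(3)] by (rule LIMSEQ_unique)
  then show ?thesis using that \<Phi>(3) by blast
qed

lemma has_dual_trace_smooth:
  fixes V :: "real^2 \<Rightarrow> complex"
  assumes V: "smooth V" and b: "L2 arc_length b" "AE x in arc_length. b x = V x"
  shows "has_dual_trace unit_disk arc_length (\<lambda>x. x) V b"
  unfolding has_dual_trace_def
proof (intro conjI exI allI impI b(1))
  show "weak_laplacian unit_disk V (\<lambda>x. \<Sum>i\<in>Basis. partial i (partial i V) x)"
    by (rule weak_laplacian_smooth[OF open_ball bounded_ball V])
  fix \<phi> h p
  assume "H_k 2 unit_disk \<phi> \<and> H1_0 unit_disk \<phi> \<and> weak_laplacian unit_disk \<phi> h \<and>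
    has_normal_deriv unit_disk arc_length (\<lambda>x. x) \<phi> p"
  then have \<phi>: "H1_0 unit_disk \<phi>" and h: "weak_laplacian unit_disk \<phi> h"
    and nd: "has_normal_deriv unit_disk arc_length (\<lambda>x. x) \<phi> p" by auto
  obtain G T where G: "\<And>i. i \<in> Basis \<Longrightarrow> weak_partial unit_disk i \<phi> (G i)"
    and T: "\<And>i. i \<in> Basis \<Longrightarrow> has_trace unit_disk arc_length (G i) (T i)"
    and p: "L2 arc_length p" "AE x in arc_length. p x = (\<Sum>i\<in>Basis. of_real (x \<bullet> i) * T i x)"
    using nd unfolding has_normal_deriv_def by blast
  have "\<forall>i\<in>Basis. \<exists>g. weak_partial unit_disk i (G i) g \<and>
      (LINT x|lebesgue_on unit_disk. g x * V x) + (LINT x|lebesgue_on unit_disk. G i x * partial i V x)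
      = (LINT x|arc_length. T i x * (V x * of_real (x \<bullet> i)))"
    (is "\<forall>i\<in>Basis. \<exists>g. ?P i g")
  proof
    fix i :: "real^2" assume i: "i \<in> Basis"
    show "\<exists>g. ?P i g" by (rule trace_by_parts[OF T[OF i] i V]) (intro exI conjI)
  qed
  then obtain g where "\<forall>i\<in>Basis. ?P i (g i)" by (rule bchoice[THEN exE])
  then have g: "\<And>i. i \<in> Basis \<Longrightarrow> weak_partial unit_disk i (G i) (g i)"
    and gi: "\<And>i. i \<in> Basis \<Longrightarrow> (LINT x|lebesgue_on unit_disk. g i x * V x) +
      (LINT x|lebesgue_on unit_disk. G i x * partial i V x) = (LINT x|arc_length. T i x * (V x * of_real (x \<bullet> i)))"
    by simp_all
  have \<phi>2: "L2 (lebesgue_on unit_disk) \<phi>" and h2: "L2 (lebesgue_on unit_disk) h"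
    using h by (auto simp: weak_laplacian_def)
  have V2: "L2 (lebesgue_on unit_disk) V" "L2 arc_length V"
    by (intro L2_continuous L2_arc_length smooth_continuous V; simp)+
  have VV: "L2 (lebesgue_on unit_disk) (partial i (partial i V))" if "i \<in> Basis" for i
    by (intro L2_continuous smooth_continuous smooth_partial V that) auto
  have SVV: "L2 (lebesgue_on unit_disk) (\<lambda>x. \<Sum>i\<in>Basis. partial i (partial i V) x)"
    by (intro L2_sum VV)
  have TL: "L2 arc_length (T i)" if "i \<in> Basis" for i
    using T[OF that] by (auto simp: has_trace_def L2_tendsto_def)
  have Vi: "L2 arc_length (\<lambda>x. V x * of_real (x \<bullet> i))" for i
    by (intro L2_arc_length smooth_continuous smooth_mult smooth_coord V)
  have "(LINT x|lebesgue_on unit_disk. V x * h x - \<phi> x * (\<Sum>i\<in>Basis. partial i (partial i V) x))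
      = (LINT x|lebesgue_on unit_disk. h x * V x) -
        (LINT x|lebesgue_on unit_disk. \<phi> x * (\<Sum>i\<in>Basis. partial i (partial i V) x))"
    using L2_times_integrable[OF h2 V2(1)] L2_times_integrable[OF \<phi>2 SVV]
    by (simp add: mult.commute)
  also have "(LINT x|lebesgue_on unit_disk. \<phi> x * (\<Sum>i\<in>Basis. partial i (partial i V) x)) =
      (\<Sum>i\<in>Basis. LINT x|lebesgue_on unit_disk. \<phi> x * partial i (partial i V) x)"
    unfolding sum_distrib_left by (intro Bochner_Integration.integral_sum L2_times_integrable \<phi>2 VV)
  also have "\<dots> = - (\<Sum>i\<in>Basis. LINT x|lebesgue_on unit_disk. G i x * partial i V x)"
    unfolding sum_negf[symmetric]
    by (intro sum.cong refl) (simp add: H1_0_by_parts[OF \<phi> G] smooth_partial V)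
  also have "(LINT x|lebesgue_on unit_disk. h x * V x) = (\<Sum>i\<in>Basis. LINT x|lebesgue_on unit_disk. g i x * V x)"
    by (rule weak_partial_integral_smooth[OF h G g V])
  also have "(\<Sum>i\<in>Basis. LINT x|lebesgue_on unit_disk. g i x * V x) -
      - (\<Sum>i\<in>Basis. LINT x|lebesgue_on unit_disk. G i x * partial i V x)
      = (\<Sum>i\<in>Basis. LINT x|arc_length. T i x * (V x * of_real (x \<bullet> i)))"
    by (simp add: sum.distrib[symmetric] gi)
  also have "\<dots> = (LINT x|arc_length. (\<Sum>i\<in>Basis. T i x * (V x * of_real (x \<bullet> i))))"
    by (intro Bochner_Integration.integral_sum[symmetric] L2_times_integrable TL Vi)
  also have "\<dots> = (LINT x|arc_length. b x * p x)"
  proof (rule integral_cong_AE)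
    show "(\<lambda>x. \<Sum>i\<in>Basis. T i x * (V x * of_real (x \<bullet> i))) \<in> borel_measurable arc_length"
      by (intro borel_measurable_sum borel_measurable_integrable L2_times_integrable TL Vi)
    show "(\<lambda>x. b x * p x) \<in> borel_measurable arc_length"
      using b(1) p(1) by (intro borel_measurable_times) (auto simp: L2_def)
    show "AE x in arc_length. (\<Sum>i\<in>Basis. T i x * (V x * of_real (x \<bullet> i))) = b x * p x"
      using p(2) b(2)
    proof eventually_elim
      case (elim x)
      show ?case unfolding elim sum_distrib_left by (intro sum.cong) (auto simp: mult_ac)
    qed
  qed
  finally show "(LINT x|lebesgue_on unit_disk. V x * h x - \<phi> x * (\<Sum>i\<in>Basis. partial i (partial i V) x))
      = (LINT x|arc_length. b x * p x)" .
qed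

lemma has_trace_smooth:
  fixes f :: "real^2 \<Rightarrow> complex"
  assumes f: "smooth f" and t: "L2 arc_length t" "AE x in arc_length. f x = t x"
  shows "has_trace unit_disk arc_length f t"
  unfolding has_trace_def
proof (intro exI[of _ "\<lambda>_. f"] conjI allI f)
  show "H1_tendsto unit_disk (\<lambda>m. f) f" by (intro H1_tendsto_smooth f) auto
  have f2: "L2 arc_length f" by (intro L2_arc_length smooth_continuous f)
  have "(LINT x|arc_length. (norm (f x - t x))\<^sup>2) = (LINT x|arc_length. 0)"
    by (rule integral_cong_AE) (use f2 t in \<open>auto simp: L2_def elim: AE_mp\<close>)
  then show "L2_tendsto arc_length (\<lambda>_. f) t"
    using f2 t by (simp add: L2_tendsto_def)
qed

lemma has_normal_deriv_smooth:
  fixes u :: "real^2 \<Rightarrow> complex"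
  assumes u: "smooth u"
  shows "has_normal_deriv unit_disk arc_length (\<lambda>x. x) u (\<lambda>x. \<Sum>i\<in>Basis. of_real (x \<bullet> i) * partial i u x)"
  unfolding has_normal_deriv_def
proof (intro conjI exI[of _ "\<lambda>i. partial i u"] ballI)
  show "L2 arc_length (\<lambda>x. \<Sum>i\<in>Basis. of_real (x \<bullet> i) * partial i u x)"
    by (intro L2_arc_length smooth_continuous smooth_sum smooth_mult smooth_coord smooth_partial u)
  fix i :: "real^2" assume i: "i \<in> Basis"
  show "weak_partial unit_disk i u (partial i u)" by (rule weak_partial_smooth[OF open_ball bounded_ball u i])
  show "has_trace unit_disk arc_length (partial i u) (partial i u)"
    by (intro has_trace_smooth L2_arc_length smooth_continuous smooth_partial u i) auto
qed auto

subsection \<open>Radial eigenfunctions\<close>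

lemma bessel0_ode:
  "power_series (diffs bessel_coeff) z + z * power_series (diffs (diffs bessel_coeff)) z = - bessel0 (z::complex) / 4"
proof -
  have "(power_series bessel_euler_coeff has_field_derivative
      power_series (diffs bessel_coeff) z + z * power_series (diffs (diffs bessel_coeff)) z) (at z)"
    unfolding power_series_bessel_euler[abs_def]
    by (auto intro!: derivative_eq_intros power_series_deriv fast_decay_diffs fast_decay_bessel_coeff)
  then show ?thesis
    using DERIV_unique[OF power_series_deriv[OF fast_decay_bessel_euler_coeff, of z]]
      power_series_diffs_bessel_euler[of z] by simp
qed

lemma power_series_vector_derivative:
  fixes c d :: complex
  assumes "fast_decay e"
  shows "((\<lambda>t. d * power_series e (c * of_real t)) has_vector_derivative
    c * d * power_series (diffs e) (c * of_real t)) (at t)"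
proof (rule has_vector_derivative_real_field)
  have "((\<lambda>z. c * z) has_field_derivative c) (at (of_real t))" by (auto intro!: derivative_eq_intros)
  from DERIV_chain2[OF power_series_deriv[OF assms] this]
  show "((\<lambda>z. d * power_series e (c * z)) has_field_derivative c * d * power_series (diffs e) (c * of_real t)) (at (of_real t))"
    by (auto intro!: derivative_eq_intros)
qed

lemma smooth_power_series_radial:
  fixes c :: complex
  assumes "fast_decay e"
  shows "smooth (\<lambda>x. power_series e (c * of_real (x \<bullet> x)))"
proof -
  define H where "H = {\<lambda>t. d * power_series e (c * of_real t) |d e. fast_decay e}"
  have "smooth (\<lambda>x. (\<lambda>t. power_series e (c * of_real t)) (x \<bullet> x))"
  proof (rule smooth_radial[of H])
    fix h assume "h \<in> H"
    then obtain d e where h: "h = (\<lambda>t. d * power_series e (c * of_real t))" "fast_decay e" by (auto simp: H_def)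
    show "\<exists>h'\<in>H. \<forall>t. (h has_vector_derivative h' t) (at t)"
    proof (intro bexI allI)
      show "(h has_vector_derivative (\<lambda>t. c * d * power_series (diffs e) (c * of_real t)) t) (at t)" for t
        unfolding h(1) by (rule power_series_vector_derivative[OF h(2)])
      show "(\<lambda>t. c * d * power_series (diffs e) (c * of_real t)) \<in> H"
        using fast_decay_diffs[OF h(2)] unfolding H_def by blast
    qed
  next
    have "(\<lambda>t. power_series e (c * of_real t)) = (\<lambda>t. 1 * power_series e (c * of_real t))" by simp
    then show "(\<lambda>t. power_series e (c * of_real t)) \<in> H" using assms unfolding H_def by blast
  qed
  then show ?thesis by simp
qed

lemma partial_power_series_radial:
  fixes c :: complex
  assumes "fast_decay e"
  shows "partial i (\<lambda>x. power_series e (c * of_real (x \<bullet> x)))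
    = (\<lambda>x. 2 * of_real (x \<bullet> i) * (c * power_series (diffs e) (c * of_real (x \<bullet> x))))"
  using partial_radial[OF power_series_vector_derivative[OF assms, of 1 c], of i] by simp

definition radial_mode :: "complex \<Rightarrow> real^2 \<Rightarrow> complex" where
  "radial_mode c x = bessel0 (c * of_real (x \<bullet> x))"

lemma smooth_radial_mode: "smooth (radial_mode c)"
  unfolding radial_mode_def[abs_def] by (rule smooth_power_series_radial[OF fast_decay_bessel_coeff])

lemma partial_radial_mode:
  "partial i (radial_mode c) = (\<lambda>x. of_real (x \<bullet> i) * (2 * c * power_series (diffs bessel_coeff) (c * of_real (x \<bullet> x))))"
  unfolding radial_mode_def[abs_def] partial_power_series_radial[OF fast_decay_bessel_coeff]
  by (simp add: mult_ac)

lemma laplacian_radial_mode: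
  "(\<Sum>i\<in>Basis. partial i (partial i (radial_mode c)) x) = - c * radial_mode c x"
proof -
  define z where "z = c * of_real (x \<bullet> x)"
  define E1 E2 where "E1 = power_series (diffs bessel_coeff) z" and "E2 = power_series (diffs (diffs bessel_coeff)) z"
  note fd = fast_decay_diffs[OF fast_decay_bessel_coeff]
  have sm: "smooth (\<lambda>x::real^2. 2 * c * power_series (diffs bessel_coeff) (c * of_real (x \<bullet> x)))"
    by (intro smooth_mult smooth_const smooth_power_series_radial fd)
  have "partial i (partial i (radial_mode c)) x = 2 * c * E1 + 4 * c\<^sup>2 * E2 * of_real ((x \<bullet> i) * (x \<bullet> i))"
    if i: "i \<in> Basis" for i
    unfolding partial_radial_mode partial_smooth_mult[OF smooth_coord sm] partial_coord
      partial_smooth_mult[OF smooth_const smooth_power_series_radial[OF fd]] partial_power_series_radial[OF fd]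
    using i by (simp add: E1_def E2_def z_def power2_eq_square algebra_simps)
  then have "(\<Sum>i\<in>Basis. partial i (partial i (radial_mode c)) x)
      = (\<Sum>i\<in>Basis. 2 * c * E1 + 4 * c\<^sup>2 * E2 * of_real ((x \<bullet> i) * (x \<bullet> i)))"
    by (intro sum.cong) auto
  also have "\<dots> = 4 * c * E1 + 4 * c\<^sup>2 * E2 * of_real (x \<bullet> x)"
    unfolding euclidean_inner[of x x] sum.distrib sum_distrib_left[symmetric] of_real_sum[symmetric] by simp
  also have "\<dots> = 4 * c * (E1 + z * E2)" by (simp add: z_def power2_eq_square algebra_simps)
  also have "E1 + z * E2 = - radial_mode c x / 4"
    unfolding E1_def E2_def bessel0_ode by (simp add: radial_mode_def z_def)
  finally show ?thesis by simp
qed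

lemma weak_laplacian_radial_mode:
  "weak_laplacian unit_disk (\<lambda>x. a * radial_mode c x) (\<lambda>x. - (c * (a * radial_mode c x)))"
proof -
  have s: "smooth (\<lambda>x. a * radial_mode c x)" by (intro smooth_mult smooth_const smooth_radial_mode)
  have p1: "partial i (\<lambda>x. a * radial_mode c x) = (\<lambda>x. a * partial i (radial_mode c) x)" for i
    unfolding partial_smooth_mult[OF smooth_const smooth_radial_mode] by simp
  have p2: "partial i (\<lambda>x. a * partial i (radial_mode c) x) = (\<lambda>x. a * partial i (partial i (radial_mode c)) x)"
    if "i \<in> Basis" for i
    unfolding partial_smooth_mult[OF smooth_const smooth_partial[OF smooth_radial_mode that]] by simp
  have "(\<Sum>i\<in>Basis. partial i (partial i (\<lambda>x. a * radial_mode c x)) x)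
      = a * (\<Sum>i\<in>Basis. partial i (partial i (radial_mode c)) x)" for x
    unfolding p1 sum_distrib_left by (intro sum.cong refl) (simp add: p2)
  then have "(\<lambda>x. \<Sum>i\<in>Basis. partial i (partial i (\<lambda>x. a * radial_mode c x)) x)
      = (\<lambda>x. - (c * (a * radial_mode c x)))"
    unfolding laplacian_radial_mode by auto
  then show ?thesis using weak_laplacian_smooth[OF open_ball bounded_ball s, of 0 1] by simp
qed

lemma radial_mode_boundary: "norm x = 1 \<Longrightarrow> radial_mode (z\<^sup>2) x = J0 z"
  by (simp add: radial_mode_def J0_def flip: power2_norm_eq_inner)

lemma radial_mode_normal_deriv:
  assumes "norm x = 1"
  shows "(\<Sum>i\<in>Basis. of_real (x \<bullet> i) * partial i (radial_mode (z\<^sup>2)) x) = zJ0' z"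
proof -
  have x: "x \<bullet> x = 1" using assms by (simp flip: power2_norm_eq_inner)
  have "(\<Sum>i\<in>Basis. of_real (x \<bullet> i) * partial i (radial_mode (z\<^sup>2)) x)
      = of_real (\<Sum>i\<in>Basis. (x \<bullet> i) * (x \<bullet> i)) * (2 * z\<^sup>2 * power_series (diffs bessel_coeff) (z\<^sup>2))"
    unfolding partial_radial_mode of_real_sum sum_distrib_right by (intro sum.cong) (simp_all add: x)
  also have "(\<Sum>i\<in>Basis. (x \<bullet> i) * (x \<bullet> i)) = 1" unfolding euclidean_inner[symmetric] by (rule x)
  finally show ?thesis by (simp add: zJ0'_eq power2_eq_square)
qed

lemma AE_zero_open_continuous:
  fixes f :: "'a::euclidean_space \<Rightarrow> complex"
  assumes f: "continuous_on UNIV f" and ae: "AE x in lebesgue_on (ball 0 1). f x = 0"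
  shows "f 0 = 0"
proof (rule ccontr)
  assume "f 0 \<noteq> 0"
  define U where "U = ball 0 1 \<inter> f -` (- {0})"
  have U: "open U" "0 \<in> U"
    using \<open>f 0 \<noteq> 0\<close> unfolding U_def by (auto intro!: open_Int open_vimage f)
  have "AE x in lebesgue. x \<in> ball 0 1 \<longrightarrow> f x = 0"
    using ae by (simp add: AE_restrict_space_iff)
  then have "AE x in lebesgue. x \<notin> U" by eventually_elim (auto simp: U_def)
  then have "U \<in> null_sets lebesgue"
    using U(1) by (subst (asm) AE_iff_null_sets[symmetric]) auto
  then show False using open_not_negligible[OF U(1)] U(2) by (auto simp: negligible_iff_null_sets)
qed

lemma transmission_eigenvalue_of_radial_det:
  assumes s: "s > 0" and det: "radial_det s \<eta> k = 0"
  shows "disk_transmission_eigenvalue (s\<^sup>2) \<eta> k"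
proof -
  define z where "z = of_real s * k"
  have nontriv: "\<exists>a b. (a \<noteq> 0 \<or> b \<noteq> 0) \<and> a * J0 z = b * J0 k \<and>
      a * zJ0' z - b * zJ0' k = of_real \<eta> * (b * J0 k)"
  proof (cases "J0 z = 0 \<and> J0 k = 0")
    case False
    have "J0 k * zJ0' z - J0 z * zJ0' k = of_real \<eta> * (J0 z * J0 k)"
      using det by (simp add: radial_det_def z_def algebra_simps)
    then show ?thesis using False by (intro exI[of _ "J0 k"] exI[of _ "J0 z"]) (auto simp: mult.commute)
  next
    case True
    then show ?thesis
    proof (cases "zJ0' z = 0 \<and> zJ0' k = 0")
      case False
      then show ?thesis using True by (intro exI[of _ "zJ0' k"] exI[of _ "zJ0' z"]) (auto simp: mult.commute)
    qed (auto intro!: exI[of _ 1])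
  qed
  then obtain a b where ab: "a \<noteq> 0 \<or> b \<noteq> 0" "a * J0 z = b * J0 k"
    "a * zJ0' z - b * zJ0' k = of_real \<eta> * (b * J0 k)" by blast
  define w v u where "w x = a * radial_mode (z\<^sup>2) x" and "v x = b * radial_mode (k\<^sup>2) x" and "u x = w x - v x" for x
  have sw: "smooth w" and sv: "smooth v"
    unfolding w_def[abs_def] v_def[abs_def] by (intro smooth_mult smooth_const smooth_radial_mode)+
  have su: "smooth u" unfolding u_def[abs_def] by (intro smooth_diff sw sv)
  have u_boundary: "u x = 0" if "norm x = 1" for x
    using ab(2) by (simp add: u_def w_def v_def radial_mode_boundary[OF that])
  have pu: "partial i u x = a * partial i (radial_mode (z\<^sup>2)) x - b * partial i (radial_mode (k\<^sup>2)) x" for i x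
  proof -
    have "partial i (\<lambda>x. a * radial_mode (z\<^sup>2) x + (- b) * radial_mode (k\<^sup>2) x) x
        = a * partial i (radial_mode (z\<^sup>2)) x + (- b) * partial i (radial_mode (k\<^sup>2)) x"
      unfolding partial_add[OF smooth_differentiable smooth_differentiable,
          OF smooth_mult[OF smooth_const smooth_radial_mode] smooth_mult[OF smooth_const smooth_radial_mode]]
        partial_smooth_mult[OF smooth_const smooth_radial_mode] by simp
    then show ?thesis by (simp add: u_def[abs_def] w_def v_def)
  qed
  define q where "q x = (\<Sum>i\<in>Basis. of_real (x \<bullet> i) * partial i u x)" for x
  have q_boundary: "q x = of_real \<eta> * v x" if "norm x = 1" for x
  proof -
    have "q x = a * (\<Sum>i\<in>Basis. of_real (x \<bullet> i) * partial i (radial_mode (z\<^sup>2)) x)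
        - b * (\<Sum>i\<in>Basis. of_real (x \<bullet> i) * partial i (radial_mode (k\<^sup>2)) x)"
      unfolding q_def pu sum_distrib_left sum_subtractf[symmetric] by (intro sum.cong) (auto simp: algebra_simps)
    then show ?thesis
      unfolding radial_mode_normal_deriv[OF that] ab(3) v_def radial_mode_boundary[OF that] .
  qed
  have H1: "H1_0 unit_disk u"
  proof -
    obtain L where L: "\<And>r s. 0 \<le> r \<Longrightarrow> r \<le> 1 \<Longrightarrow> norm (u (r *\<^sub>R circle_point s) - u (circle_point s)) \<le> L * (1 - r\<^sup>2)"
      using smooth_radial_increment[OF su] by metis
    show ?thesis
    proof (rule H1_0_smooth_vanishing[OF su])
      fix x :: "real^2" assume x: "x \<in> unit_disk"
      obtain s where s: "x = norm x *\<^sub>R circle_point s" using polar_real2[of x] by blast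
      show "norm (u x) \<le> L * (1 - x \<bullet> x)"
        using L[of "norm x" s] x s u_boundary[OF norm_circle_point]
        by (simp flip: s) (simp add: power2_norm_eq_inner)
    qed
  qed
  have q_normal: "has_normal_deriv unit_disk arc_length (\<lambda>x. x) u q"
    unfolding q_def by (rule has_normal_deriv_smooth[OF su])
  have dual: "has_dual_trace unit_disk arc_length (\<lambda>x. x) (\<lambda>x. of_real \<eta> * v x) q"
  proof (rule has_dual_trace_smooth)
    show "smooth (\<lambda>x. of_real \<eta> * v x)" by (intro smooth_mult smooth_const sv)
    show "L2 arc_length q" using q_normal by (simp add: has_normal_deriv_def)
    show "AE x in arc_length. q x = of_real \<eta> * v x"
      using AE_arc_length_norm by eventually_elim (rule q_boundary)
  qed
  have trace: "has_trace unit_disk arc_length u (\<lambda>x. 0)"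
  proof (rule has_trace_smooth[OF su])
    show "L2 arc_length (\<lambda>x. 0)" by (simp add: L2_def)
    show "AE x in arc_length. u x = 0"
      using AE_arc_length_norm by eventually_elim (rule u_boundary)
  qed
  have nonzero: "\<not> (AE x in lebesgue_on unit_disk. w x = 0 \<and> v x = 0)"
  proof
    assume "AE x in lebesgue_on unit_disk. w x = 0 \<and> v x = 0"
    then have "AE x in lebesgue_on unit_disk. w x = 0" "AE x in lebesgue_on unit_disk. v x = 0"
      by (auto elim: eventually_mono)
    then have "w 0 = 0" "v 0 = 0"
      using AE_zero_open_continuous smooth_continuous sw sv by blast+
    then show False using ab(1) by (simp add: w_def v_def radial_mode_def)
  qed
  have z2: "z\<^sup>2 = k\<^sup>2 * of_real (s\<^sup>2)" by (simp add: z_def power_mult_distrib mult.commute)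
  have "weak_laplacian unit_disk w (\<lambda>x. - (k\<^sup>2 * of_real (s\<^sup>2) * w x))"
    unfolding z2[symmetric] w_def by (rule weak_laplacian_radial_mode)
  moreover have "weak_laplacian unit_disk v (\<lambda>x. - (k\<^sup>2 * v x))"
    unfolding v_def by (rule weak_laplacian_radial_mode)
  moreover have "L2 (lebesgue_on unit_disk) w" "L2 (lebesgue_on unit_disk) v"
    by (intro L2_continuous smooth_continuous sw sv; simp)+
  moreover have "H_k 2 unit_disk u" by (rule H_k_smooth[OF open_ball bounded_ball su])
  ultimately show ?thesis
    unfolding disk_transmission_eigenvalue_def transmission_eigenvalue_def
    using nonzero H1 trace q_normal dual unfolding u_def[abs_def] by blast
qed

theorem theorem4p2:
  fixes n :: real
  assumes "n > 0" and "n \<noteq> 1"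
  shows "\<exists>\<eta>0>0. \<forall>\<eta>::real. 0 < \<eta> \<and> \<eta> < \<eta>0 \<longrightarrow>
           infinite {k :: complex. k \<notin> \<real> \<and> disk_transmission_eigenvalue n \<eta> k}"
proof -
  define s where "s = sqrt n"
  have s: "s > 0" "s \<noteq> 1" "s\<^sup>2 = n" using assms by (auto simp: s_def)
  obtain \<eta>0 where \<eta>0: "\<eta>0 > 0" "\<And>\<eta>. \<bar>\<eta>\<bar> < \<eta>0 \<Longrightarrow> infinite {z. radial_det s \<eta> z = 0 \<and> z \<notin> \<real>}"
    using infinite_nonreal_zeros_radial_det[OF s(1,2)] by blast
  have "infinite {k. k \<notin> \<real> \<and> disk_transmission_eigenvalue n \<eta> k}" if "0 < \<eta>" "\<eta> < \<eta>0" for \<eta>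
  proof (rule infinite_super)
    show "{z. radial_det s \<eta> z = 0 \<and> z \<notin> \<real>} \<subseteq> {k. k \<notin> \<real> \<and> disk_transmission_eigenvalue n \<eta> k}"
      using transmission_eigenvalue_of_radial_det[OF s(1), of \<eta>] by (auto simp: s(3))
    show "infinite {z. radial_det s \<eta> z = 0 \<and> z \<notin> \<real>}" using \<eta>0(2)[of \<eta>] that by simp
  qed
  then show ?thesis using \<eta>0(1) by blast
qed

end
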